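(* If $2\le d\le 3$, then $\operatorname{FLD}(d)=c_{\mathrm{bal}}$, and if $d\ge 4$, then $\operatorname{FLD}(d)=c_{\mathrm{bst}}$.
   Context: A partial linear extension (ple) of a finite poset $P$ is a linear extension of a subposet of $P$ (the subposet may be $P$ itself); $\operatorname{ple}(P)$ denotes the set of all ple's of $P$. A local weight function is a map $w:\operatorname{ple}(P)\to[0,1]$. For $u\in P$ let $\mu(u,w)=\sum\{w(M):M\in\operatorname{ple}(P),\,u\in M\}$ and $\mu(P,w)=\max_{u\in P}\mu(u,w)$. The function $w$ is a fractional local realizer of $P$ if for every ordered pair $(u,v)$ of (not necessarily distinct) elements: if $u\le v$ in $P$ then $\sum\{w(M): u\le v \text{ in } M\}\ge 1$, and if $u$ and $v$ are incomparable in $P$ then $\sum\{w(M): u>v\text{ in }M\}\ge 1$. The fractional local dimension $\operatorname{fldim}(P)$ is the minimum of $\mu(P,w)$ over all fractional local realizers $w$ of $P$. For integers $2\le d<n$, $P(1,d;n)$ is the poset of all $1$-element and $d$-element subsets of $\{1,\dots,n\}$ ordered by inclusion, and $\operatorname{FLD}(d)=\lim_{n\to\infty}\operatorname{fldim}(P(1,d;n))$ (the limit exists). Fix $d\ge 2$. Let $\beta\in(0,1)$ be the unique number with $(1-\beta)^d=\beta$. On $[\beta,1]$ define \[ r(x)=\frac{1}{d+1}\Bigl[(d+1)x-dx^{\frac{d+1}{d}}-(1-x)^{d+1}\Bigr],\qquad g(x)=\frac{(d+1)r(x)-x}{(d+1)r(x)-x^2}. \] Let $x_{\mathrm{bst}}$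 be the unique point of $[\beta,1]$ at which $g$ attains its maximum, and $x_{\mathrm{bal}}$ the unique point of $[\beta,1]$ with $r(x)=x^2/2$. Define \[ c_{\mathrm{bal}}=\frac{x_{\mathrm{bal}}}{r(x_{\mathrm{bal}})},\qquad c_{\mathrm{bst}}=2+\frac{(d-1)(x_{\mathrm{bst}}-x_{\mathrm{bst}}^2)}{(d+1)r(x_{\mathrm{bst}})-x_{\mathrm{bst}}^2}. \] *)

theory Defs
  imports "HOL-Analysis.Analysis"
begin

text \<open>
  As in \<^theory>\<open>HOL.Order_Relation\<close>, a poset is given by its reflexive order relation, whose
  field is the ground set.  A linear extension of a subposet is likewise given by its order
  relation, so that ``\<open>u \<le> v\<close> in \<open>M\<close>'' is \<open>(u, v) \<in> M\<close> and \<open>u \<in> M\<close> is \<open>u \<in> Field M\<close>.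
  The empty subposet is allowed; its weight enters none of the sums below.
\<close>

definition ple :: "'a rel \<Rightarrow> 'a rel set" where
  "ple P = {M. Field M \<subseteq> Field P \<and> Linear_order M \<and> Restr P (Field M) \<subseteq> M}"

text \<open>Weight functions are total on \<^typ>\<open>'a rel\<close>; only their values on \<^const>\<open>ple\<close> are ever used.\<close>

definition local_weight :: "'a rel \<Rightarrow> ('a rel \<Rightarrow> real) \<Rightarrow> bool" where
  "local_weight P w \<longleftrightarrow> (\<forall>M\<in>ple P. 0 \<le> w M \<and> w M \<le> 1)"

definition mu_elem :: "'a rel \<Rightarrow> 'a \<Rightarrow> ('a rel \<Rightarrow> real) \<Rightarrow> real" where
  "mu_elem P u w = (\<Sum>M | M \<in> ple P \<and> u \<in> Field M. w M)"

definition mu :: "'a rel \<Rightarrow> ('a rel \<Rightarrow> real) \<Rightarrow> real" where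
  "mu P w = Max ((\<lambda>u. mu_elem P u w) ` Field P)"

definition fractional_local_realizer :: "'a rel \<Rightarrow> ('a rel \<Rightarrow> real) \<Rightarrow> bool" where
  "fractional_local_realizer P w \<longleftrightarrow>
     local_weight P w \<and>
     (\<forall>u\<in>Field P. \<forall>v\<in>Field P.
        ((u, v) \<in> P \<longrightarrow> (\<Sum>M | M \<in> ple P \<and> (u, v) \<in> M. w M) \<ge> 1) \<and>
        ((u, v) \<notin> P \<and> (v, u) \<notin> P \<longrightarrow>
           (\<Sum>M | M \<in> ple P \<and> (v, u) \<in> M \<and> u \<noteq> v. w M) \<ge> 1))"

text \<open>
  The minimum (not just the infimum) over all fractional local realizers;
  it is attained by lemma \<open>fldim_attained\<close> below.
\<close>

definition fldim :: "'a rel \<Rightarrow> real" where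
  "fldim P = (LEAST c. \<exists>w. fractional_local_realizer P w \<and> c = mu P w)"

definition subset_poset :: "nat \<Rightarrow> nat \<Rightarrow> nat set rel" where
  "subset_poset d n =
     {(X, Y). X \<subseteq> {1..n} \<and> Y \<subseteq> {1..n} \<and> card X \<in> {1, d} \<and> card Y \<in> {1, d} \<and> X \<subseteq> Y}"

definition FLD :: "nat \<Rightarrow> real" where
  "FLD d = lim (\<lambda>n. fldim (subset_poset d n))"

definition beta :: "nat \<Rightarrow> real" where
  "beta d = (THE b. 0 < b \<and> b < 1 \<and> (1 - b) ^ d = b)"

definition rfun :: "nat \<Rightarrow> real \<Rightarrow> real" where
  "rfun d x = 1 / (real d + 1) *
     ((real d + 1) * x - real d * x powr ((real d + 1) / real d) - (1 - x) ^ (d + 1))"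

text \<open>
  At \<open>x = 1\<close> the quotient reads \<open>0 / 0\<close>, which is \<open>0\<close> in HOL, while the limit there is \<open>1 / 2\<close>.
  For \<open>d \<ge> 2\<close> the function exceeds \<open>1 / 2\<close> just to the left of \<open>1\<close>, so either
  value gives the same maximum and the same point of maximum.
\<close>

definition gfun :: "nat \<Rightarrow> real \<Rightarrow> real" where
  "gfun d x = ((real d + 1) * rfun d x - x) / ((real d + 1) * rfun d x - x\<^sup>2)"

definition x_bst :: "nat \<Rightarrow> real" where
  "x_bst d = arg_max_on (gfun d) {beta d..1}"

definition x_bal :: "nat \<Rightarrow> real" where
  "x_bal d = (THE x. x \<in> {beta d..1} \<and> rfun d x = x\<^sup>2 / 2)"

definition c_bal :: "nat \<Rightarrow> real" where
  "c_bal d = x_bal d / rfun d (x_bal d)"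

definition c_bst :: "nat \<Rightarrow> real" where
  "c_bst d = 2 + (real d - 1) * (x_bst d - (x_bst d)\<^sup>2) /
     ((real d + 1) * rfun d (x_bst d) - (x_bst d)\<^sup>2)"


lemma Field_subset_poset:
  "Field (subset_poset d n) = {X. X \<subseteq> {1..n} \<and> card X \<in> {1, d}}"
  by (auto simp: subset_poset_def Field_def)

lemma partial_order_subset_poset: "Partial_order (subset_poset d n)"
  unfolding Field_subset_poset order_on_defs
  by (auto simp: subset_poset_def refl_on_def trans_def antisym_def)

lemma finite_ple:
  assumes "finite (Field P)"
  shows "finite (ple P)"
proof (rule finite_subset)
  show "ple P \<subseteq> Pow (Field P \<times> Field P)"
    unfolding ple_def by (auto intro: FieldI1 FieldI2)
  show "finite (Pow (Field P \<times> Field P))"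
    using assms by simp
qed

lemma realizer_exists:
  assumes fin: "finite (Field P)" and po: "Partial_order P"
  shows "fractional_local_realizer P (\<lambda>_. 1)"
proof -
  note f = finite_ple[OF fin]
  have refl: "\<And>u. u \<in> Field P \<Longrightarrow> (u, u) \<in> P" and anti: "antisym P"
    using po by (auto simp: order_on_defs refl_on_def)
  have two: "{(u, u), (v, v), (u, v)} \<in> ple P"
    if "u \<in> Field P" "v \<in> Field P" "(u, v) \<in> P \<or> (v, u) \<notin> P" for u v
  proof -
    let ?M = "{(u, u), (v, v), (u, v)}"
    have F: "Field ?M = {u, v}"
      by (simp add: insert_commute)
    have "trans ?M" "antisym ?M"
      unfolding trans_def antisym_def by blast+
    moreover have "refl_on {u, v} ?M" "total_on {u, v} ?M" "?M \<subseteq> {u, v} \<times> {u, v}"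
      unfolding refl_on_def total_on_def by blast+
    ultimately have "Linear_order ?M"
      unfolding F order_on_defs by blast
    moreover have "Restr P {u, v} \<subseteq> ?M"
      using that antisymD[OF anti, of u v] by blast
    ultimately show ?thesis
      unfolding ple_def mem_Collect_eq F using that by blast
  qed
  have ge: "(\<Sum>M | M \<in> ple P \<and> Q M. 1::real) \<ge> 1" if "M \<in> ple P" "Q M" for Q M
  proof -
    have "card {M. M \<in> ple P \<and> Q M} > 0"
      using that f by (auto simp: card_gt_0_iff)
    then show ?thesis by simp
  qed
  show ?thesis
    unfolding fractional_local_realizer_def local_weight_def
  proof (intro conjI ballI impI)
    fix u v assume uv: "u \<in> Field P" "v \<in> Field P"
    show "(\<Sum>M | M \<in> ple P \<and> (u, v) \<in> M. 1::real) \<ge> 1" if "(u, v) \<in> P"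
      using uv that by (intro ge[OF two[of u v]]) auto
    show "(\<Sum>M | M \<in> ple P \<and> (v, u) \<in> M \<and> u \<noteq> v. 1::real) \<ge> 1"
      if "(u, v) \<notin> P \<and> (v, u) \<notin> P"
      using uv that refl by (intro ge[OF two[of v u]]) auto
  qed auto
qed

lemma closed_Collect_Ball:
  assumes "\<And>x. x \<in> A \<Longrightarrow> closed {w. Q x w}"
  shows "closed {w. \<forall>x\<in>A. Q x w}"
proof -
  have "{w. \<forall>x\<in>A. Q x w} = (\<Inter>x\<in>A. {w. Q x w})" by blast
  then show ?thesis using assms by (simp add: closed_INT)
qed

lemma fldim_attained:
  fixes P :: "'a rel"
  assumes fin: "finite (Field P)" and ne: "Field P \<noteq> {}" and po: "Partial_order P"
  shows "\<exists>w. fractional_local_realizer P w \<and> fldim P = mu P w \<and>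
             (\<forall>w'. fractional_local_realizer P w' \<longrightarrow> mu P w \<le> mu P w')"
proof -
  define K where "K = PiE UNIV (\<lambda>_::'a rel. {0..1::real})"
  define S where "S = K \<inter> {w. fractional_local_realizer P w}"
  have K: "compact K"
    using compactin_PiE[of "\<lambda>_::'a rel. euclideanreal" UNIV "\<lambda>_. {0..1}"]
    by (simp add: K_def euclidean_product_topology)
  have cont: "continuous_on UNIV (\<lambda>w::'a rel \<Rightarrow> real. \<Sum>M\<in>A. w M)" for A
    by (intro continuous_intros continuous_on_product_coordinates)
  have cl: "closed {w::'a rel \<Rightarrow> real. (\<Sum>M\<in>A. w M) \<ge> 1}" for A
    by (intro closed_Collect_le cont continuous_intros)
  have clw: "closed {w::'a rel \<Rightarrow> real. local_weight P w}"
    unfolding local_weight_def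
    by (intro closed_Collect_Ball closed_Collect_conj closed_Collect_le
        continuous_on_product_coordinates continuous_on_const)
  have "closed {w. fractional_local_realizer P w}"
    unfolding fractional_local_realizer_def
    by (intro closed_Collect_conj clw closed_Collect_Ball closed_Collect_imp cl open_Collect_const)
  then have S: "compact S"
    unfolding S_def using K by (rule compact_Int_closed[rotated])
  have "(\<lambda>_. 1) \<in> S"
    using realizer_exists[OF fin po] by (simp add: S_def K_def PiE_def)
  then have "S \<noteq> {}" by blast
  have contM: "continuous_on UNIV (\<lambda>w. Max ((\<lambda>u. mu_elem P u w) ` U))"
    if "finite U" "U \<noteq> {}" for U
    using that
  proof (induction rule: finite_ne_induct)
    case (singleton u)
    then show ?case by (simp add: mu_elem_def cont)
  next
    case (insert u U)
    have "continuous_on UNIV (\<lambda>w. max (mu_elem P u w) (Max ((\<lambda>u. mu_elem P u w) ` U)))"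
      using insert.IH cont by (intro continuous_on_max) (auto simp: mu_elem_def)
    then show ?case using insert.hyps by simp
  qed
  have "continuous_on S (mu P)"
    using continuous_on_subset[OF contM[OF fin ne]] unfolding mu_def by blast
  from continuous_attains_inf[OF S \<open>S \<noteq> {}\<close> this]
  obtain w where w: "w \<in> S" and min: "\<And>w'. w' \<in> S \<Longrightarrow> mu P w \<le> mu P w'"
    by blast
  have all: "mu P w \<le> mu P w'" if "fractional_local_realizer P w'" for w'
  proof -
    define v where "v = (\<lambda>M. if M \<in> ple P then w' M else 0)"
    have sum: "(\<Sum>M | M \<in> ple P \<and> Q M. v M) = (\<Sum>M | M \<in> ple P \<and> Q M. w' M)" for Q
      by (intro sum.cong) (auto simp: v_def)
    have "local_weight P v" "v \<in> K"
      using that by (auto simp: fractional_local_realizer_def local_weight_def v_def K_def)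
    then have "v \<in> S"
      using that by (simp add: S_def fractional_local_realizer_def sum)
    moreover have "mu P v = mu P w'"
      by (simp add: mu_def mu_elem_def sum)
    ultimately show ?thesis using min by metis
  qed
  have "fldim P = mu P w"
    unfolding fldim_def
    using w all by (intro Least_equality) (auto simp: S_def)
  then show ?thesis
    using w all by (auto simp: S_def)
qed

end

theory Submission
  imports Defs
begin

text \<open>
  Scale a linear extension that contains a fraction \<open>q\<close> of the singletons and a fraction \<open>y\<close> of the
  \<open>d\<close>-sets.  The \<open>i\<close>-th singleton from the top can only have sets below it that avoid the top \<open>i\<close>
  singletons, so at most a fraction \<open>R(q, y) = \<integral>\<^sub>0\<^sup>q min y ((1 - t)\<^sup>d) dt\<close> of the pairs is reversed, and
  \<open>R(x, x) = r(x)\<close> for \<open>x \<ge> \<beta>\<close>.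

  Lower bound, by linear programming duality: besides the reversed pairs, only the pairs of two
  singletons and the pairs of two \<open>d\<close>-sets are needed.  They give the inequality
  \<open>\<kappa> R(q, y) + \<delta> q\<^sup>2 + \<epsilon> y\<^sup>2 \<le> \<rho> q + (1 - \<rho>) y\<close>, whose left-hand side separates as a function of \<open>q\<close>
  plus a function of \<open>y\<close> where \<open>(1 - q)\<^sup>d \<le> y\<close>; both summands have a convex derivative, so that equality
  at \<open>(x, x)\<close> and the sign at \<open>(1, 1)\<close> decide everything.

  Upper bound: give the points independent uniform labels in \<open>[0, 1]\<close> (discretised to \<open>K\<close> values,
  \<open>K \<rightarrow> \<infinity>\<close>), keep the singletons with label at least \<open>1 - x\<close> and the sets with all labels at most
  \<open>x\<^sup>1\<^sup>/\<^sup>d\<close>, and order them colexicographically.  A mixture of this extension for \<open>x\<close> and the one for \<open>1\<close>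
  meets the lower bound, provided that the weight of the latter is not negative, i.e.
  \<open>r(x) \<ge> x\<^sup>2 / 2\<close>.  This is where \<open>d \<le> 3\<close> and \<open>d \<ge> 4\<close> differ: \<open>x\<^sub>b\<^sub>s\<^sub>t \<le> x\<^sub>b\<^sub>a\<^sub>l\<close> holds exactly for \<open>d \<ge> 4\<close>.
\<close>

section \<open>The functions \<open>r\<close> and \<open>R\<close>\<close>

text \<open>The constants come from complementary slackness. The demands that determine the mixture
  are those of the reversed pairs and of the pairs inside an antichain: with weight
  \<open>W1\<close> for \<open>x\<close> and \<open>W2\<close> for \<open>1\<close> they read
  \<open>W1 * r(x) + W2 / (d + 1) = 1\<close> and \<open>W1 * x ^ 2 + W2 = 2\<close>, and the load
  \<open>W1 * x + W2\<close> of the solution is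
  \<open>2 + (d - 1) * (x - x ^ 2) / ((d + 1) * r(x) - x ^ 2)\<close>. Minimising it over
  \<open>x\<close> means maximising \<open>g\<close>. On the dual side only \<kappa> and
  \<open>G = \<delta> + \<epsilon>\<close> enter the value \<open>\<kappa> + 2 * G\<close>. Touching
  at \<open>(x, x)\<close> gives one equation for the value and one for the derivative along the
  diagonal. At \<open>x_bst\<close> equality at \<open>(1, 1)\<close> is a third equation, and
  stationarity of \<open>g\<close> makes the three consistent. At \<open>x_bal\<close> the weight
  \<open>W2\<close> is \<open>0\<close>, so \<open>(1, 1)\<close> only has to satisfy an inequality,
  which is checked by explicit estimates for \<open>d = 2\<close> and \<open>d = 3\<close>. The
  freedom that remains, the split of \<open>G\<close> and the value of \<rho>, serves to give each
  of the two separated summands its maximum at \<open>x\<close>.\<close>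

lemma scale_Suc:
  "(real d + 1) * (a - real d / (real d + 1) * b - c / (real d + 1)) = (real d + 1) * a - real d * b - c"
proof -
  have "real d + 1 \<noteq> 0" by linarith
  then show ?thesis by (simp add: right_diff_distrib)
qed

lemma rfun_root:
  assumes d: "0 < d" and x: "0 \<le> x"
  shows "(real d + 1) * rfun d x = (real d + 1) * x - real d * x * root d x - (1 - x) ^ (d + 1)"
proof -
  have "x powr ((real d + 1) / real d) = x * root d x"
  proof (cases "x = 0")
    case False
    then have "x powr ((real d + 1) / real d) = x powr (1 + 1 / real d)"
      using d by (simp add: add_divide_distrib add.commute)
    also have "\<dots> = x * root d x"
      using False x d by (subst powr_add) (simp add: root_powr_inverse)
    finally show ?thesis .
  qed simp
  then show ?thesis
    by (simp add: rfun_def mult.assoc)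
qed

lemma beta_ex1:
  assumes d: "1 \<le> d"
  shows "\<exists>!b::real. 0 < b \<and> b < 1 \<and> (1 - b) ^ d = b"
proof -
  have "\<exists>b\<ge>0. b \<le> 1 \<and> b - (1 - b) ^ d = (0::real)"
    using d by (intro IVT') (auto intro!: continuous_intros simp: power_0_left)
  then obtain b :: real where b: "0 \<le> b" "b \<le> 1" "b = (1 - b) ^ d" by auto
  have "b \<noteq> 0" "b \<noteq> 1" using b d by (auto simp: power_0_left)
  moreover have "b' = b" if "0 < b'" "b' < 1" "(1 - b') ^ d = b'" for b' :: real
  proof (rule ccontr)
    assume "b' \<noteq> b"
    then consider "b' < b" | "b < b'" by linarith
    then show False
    proof cases
      case 1
      then have "(1 - b) ^ d \<le> (1 - b') ^ d" using b that by (intro power_mono) auto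
      then show False using 1 b that by linarith
    next
      case 2
      then have "(1 - b') ^ d \<le> (1 - b) ^ d" using b that by (intro power_mono) auto
      then show False using 2 b that by linarith
    qed
  qed
  ultimately show ?thesis using b by (intro ex1I[of _ b]) auto
qed

lemma beta:
  assumes "1 \<le> d"
  shows "0 < beta d" "beta d < 1" "(1 - beta d) ^ d = beta d"
  using theI'[OF beta_ex1[OF assms]] unfolding beta_def by blast+

lemma root_beta:
  assumes "1 \<le> d"
  shows "root d (beta d) = 1 - beta d"
proof -
  have "root d ((1 - beta d) ^ d) = 1 - beta d"
    using beta[OF assms] assms by (intro real_root_power_cancel) auto
  then show ?thesis using beta(3)[OF assms] by simp
qed

lemma beta_le_iff:
  assumes "1 \<le> d" "0 \<le> x" "x \<le> 1"
  shows "beta d \<le> x \<longleftrightarrow> (1 - x) ^ d \<le> x"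
proof
  assume "beta d \<le> x"
  then have "(1 - x) ^ d \<le> (1 - beta d) ^ d" using assms by (intro power_mono) auto
  then show "(1 - x) ^ d \<le> x" using beta[OF assms(1)] \<open>beta d \<le> x\<close> by linarith
next
  assume *: "(1 - x) ^ d \<le> x"
  show "beta d \<le> x"
  proof (rule ccontr)
    assume "\<not> beta d \<le> x"
    then have "(1 - beta d) ^ d \<le> (1 - x) ^ d" using beta[OF assms(1)] by (intro power_mono) auto
    then show False using * \<open>\<not> beta d \<le> x\<close> beta[OF assms(1)] by linarith
  qed
qed

text \<open>The condition \<open>(1 - x) ^ d \<le> x\<close> under the root. It places
  \<open>(x, x)\<close> in the region \<open>1 - root d y \<le> q\<close>, where \<open>R\<close>
  splits into a part in \<open>q\<close> and a part in \<open>y\<close>.\<close>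

lemma one_minus_le_root:
  assumes "1 \<le> d" "beta d \<le> x" "x \<le> 1"
  shows "1 - x \<le> root d x"
proof -
  have "0 \<le> x" using beta(1)[OF assms(1)] assms by linarith
  then have "(1 - x) ^ d \<le> x" using beta_le_iff assms by blast
  then have "root d ((1 - x) ^ d) \<le> root d x" using assms by simp
  then show ?thesis using assms by (simp add: real_root_power_cancel)
qed

text \<open>Bernoulli's inequality at \<open>root d x - 1\<close>.\<close>

lemma bernoulli_root:
  assumes "1 \<le> d" "0 \<le> x" "x \<le> 1"
  shows "1 - x \<le> real d * (1 - root d x)"
proof -
  let ?s = "root d x"
  have s: "0 \<le> ?s" "?s ^ d = x" using assms by simp_all
  have "1 + real d * (?s - 1) \<le> (1 + (?s - 1)) ^ d"
    using s by (intro Bernoulli_inequality) auto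
  then show ?thesis using s by (simp add: algebra_simps)
qed

definition rfun' :: "nat \<Rightarrow> real \<Rightarrow> real" where
  "rfun' d x = 1 - root d x + (1 - x) ^ d"

lemma DERIV_mult_root:
  assumes "0 < d" "0 < x"
  shows "((\<lambda>x. x * root d x) has_real_derivative (1 + 1 / d) * root d x) (at x)"
proof -
  let ?s = "root d x"
  have s: "0 < ?s" "?s ^ d = x" using assms by simp_all
  obtain k where k: "d = Suc k" using assms by (cases d) auto
  have "x = ?s * ?s ^ k" using s(2) k by simp
  then have "x * inverse (real d * ?s ^ (d - Suc 0)) = (?s * ?s ^ k) * inverse (real d * ?s ^ k)"
    using k by simp
  also have "\<dots> = ?s / d" using s(1) assms by (simp add: field_simps)
  finally have "x * inverse (real d * ?s ^ (d - Suc 0)) = ?s / d" .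
  then have "1 * ?s + inverse (real d * ?s ^ (d - Suc 0)) * x = (1 + 1 / d) * ?s"
    by (simp add: algebra_simps)
  moreover have "((\<lambda>x. x * root d x) has_real_derivative
      (1 * ?s + inverse (real d * ?s ^ (d - Suc 0)) * x)) (at x)"
    using assms by (intro derivative_eq_intros DERIV_real_root refl) auto
  ultimately show ?thesis by simp
qed

lemma DERIV_power_one_minus:
  "((\<lambda>x::real. (1 - x) ^ (d + 1) / (real d + 1)) has_real_derivative - ((1 - x) ^ d)) (at x)"
proof -
  have "((\<lambda>x::real. (1 - x) ^ (d + 1) / (real d + 1)) has_real_derivative
      (of_nat (d + 1) * (1 - x) ^ (d + 1 - 1) * - 1) / (real d + 1)) (at x)"
    by (rule derivative_eq_intros refl | simp)+
  moreover have "(of_nat (d + 1) * (1 - x) ^ (d + 1 - 1) * - 1) / (real d + 1) = - ((1 - x) ^ d)"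
    by (simp add: field_simps)
  ultimately show ?thesis by simp
qed

lemma DERIV_rfun:
  assumes "0 < d" "0 < x"
  shows "(rfun d has_real_derivative rfun' d x) (at x)"
proof -
  let ?f = "\<lambda>x. x - real d / (real d + 1) * (x * root d x) - (1 - x) ^ (d + 1) / (real d + 1)"
  have "(?f has_real_derivative 1 - real d / (real d + 1) * ((1 + 1 / d) * root d x) + (1 - x) ^ d) (at x)"
    using DERIV_diff[OF DERIV_diff[OF DERIV_ident DERIV_cmult[OF DERIV_mult_root[OF assms], of "real d / (real d + 1)"]]
        DERIV_power_one_minus[of d x]] by simp
  moreover have "real d / (real d + 1) * ((1 + 1 / d) * root d x) = root d x"
  proof -
    have "1 + 1 / real d = (real d + 1) / real d" using assms by (simp add: field_simps)
    then show ?thesis using assms by simp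
  qed
  ultimately have "(?f has_real_derivative rfun' d x) (at x)"
    by (simp add: rfun'_def)
  \<comment> \<open>\<open>rfun_root\<close> speaks of nonnegative arguments only, so the two
    functions are compared on the neighbourhood \<open>{0<..}\<close> of \<open>x\<close>.\<close>
  moreover have "eventually (\<lambda>y. y \<in> {0<..}) (nhds x)"
    using assms by (intro eventually_nhds_in_open) auto
  then have "eventually (\<lambda>y. ?f y = rfun d y) (nhds x)"
  proof eventually_elim
    case (elim y)
    then have "(real d + 1) * ?f y = (real d + 1) * rfun d y"
      using assms by (subst rfun_root, simp, simp, subst scale_Suc) (simp add: mult.assoc)
    then show ?case by (simp add: mult_left_cancel)
  qed
  ultimately show ?thesis
    by (subst (asm) DERIV_cong_ev[OF refl _ refl])
qed

lemma rfun_beta: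
  assumes "1 \<le> d"
  shows "rfun d (beta d) = (beta d)\<^sup>2"
proof -
  have "(real d + 1) * rfun d (beta d) = (real d + 1) * (beta d)\<^sup>2"
    using beta[OF assms] assms by (subst rfun_root) (auto simp: root_beta algebra_simps power2_eq_square)
  then show ?thesis by (simp add: mult_left_cancel)
qed

lemma rfun_1: "0 < d \<Longrightarrow> rfun d 1 = 1 / (d + 1)"
  by (simp add: rfun_def)

lemma continuous_on_rfun: "0 < d \<Longrightarrow> A \<subseteq> {0<..} \<Longrightarrow> continuous_on A (rfun d)"
  by (meson DERIV_continuous DERIV_rfun continuous_at_imp_continuous_on greaterThan_iff subsetD)

lemma D_eq:
  assumes "0 < d" "0 \<le> x"
  shows "(real d + 1) * rfun d x - x\<^sup>2 = x * (1 - x) + d * x * (1 - root d x) - (1 - x) ^ (d + 1)"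
  using assms by (subst rfun_root) (auto simp: algebra_simps power2_eq_square)

text \<open>In \<open>D_eq\<close> the first and the last term together are
  \<open>(1 - x) * (x - (1 - x) ^ d)\<close>, nonnegative for \<open>x \<ge> \<beta>\<close>.
  Besides positivity of the denominator of \<open>g\<close>, this estimate yields the demands of
  comparable pairs in the upper bound.\<close>

lemma D_ge:
  assumes "1 \<le> d" "beta d \<le> x" "x \<le> 1"
  shows "d * x * (1 - root d x) \<le> (real d + 1) * rfun d x - x\<^sup>2"
proof -
  have x: "0 < x" using beta[OF assms(1)] assms by linarith
  have "(1 - x) * (1 - x) ^ d \<le> (1 - x) * x"
    using beta_le_iff[of d x] assms x by (intro mult_left_mono) auto
  then show ?thesis using assms x by (subst D_eq) (auto simp: algebra_simps)
qed

lemma D_pos: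
  assumes "1 \<le> d" "beta d \<le> x" "x < 1"
  shows "0 < (real d + 1) * rfun d x - x\<^sup>2"
proof -
  have "0 < x" using beta[OF assms(1)] assms by linarith
  then have "0 < d * x * (1 - root d x)" using assms by simp
  then show ?thesis using D_ge[of d x] assms by simp
qed

section \<open>Maxima of functions with a convex derivative\<close>

lemma MVT_real_derivative:
  fixes f :: "real \<Rightarrow> real"
  assumes "a < b" "continuous_on {a..b} f" "\<And>t. a < t \<Longrightarrow> t < b \<Longrightarrow> (f has_real_derivative f' t) (at t)"
  shows "\<exists>t. a < t \<and> t < b \<and> f b - f a = (b - a) * f' t"
proof -
  obtain l z where z: "a < z" "z < b" "DERIV f z :> l" "f b - f a = (b - a) * l"
    using MVT[OF assms(1,2)] assms(3) real_differentiable_def by metis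
  then have "l = f' z" using DERIV_unique assms(3) by blast
  then show ?thesis using z by blast
qed

lemma convex_comb:
  fixes a b c :: real
  assumes "a < b" "b < c"
  shows "b = (c - b) / (c - a) * a + (1 - (c - b) / (c - a)) * c"
proof -
  have "(c - b) / (c - a) * a + (1 - (c - b) / (c - a)) * c = c - (c - b) / (c - a) * (c - a)"
    by (simp only: left_diff_distrib right_diff_distrib)
  then show ?thesis using assms by simp
qed

text \<open>A larger value at some \<open>y > x\<close> would make \<open>f'\<close> positive
  somewhere before \<open>y\<close> and negative after it, although it vanishes at \<open>x\<close>;
  convexity forbids this. A larger value at some \<open>y < x\<close> would make \<open>f'\<close>
  negative left of its zero \<open>x\<close>, hence positive right of it, and \<open>f 1\<close>
  would exceed \<open>f x\<close>.\<close>

lemma max_at_critical_point: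
  fixes f f' :: "real \<Rightarrow> real"
  assumes cont: "continuous_on {0..1} f"
    and der: "\<And>t. 0 < t \<Longrightarrow> t < 1 \<Longrightarrow> (f has_real_derivative f' t) (at t)"
    and cvx: "convex_on {0<..<1} f'"
    and x: "0 < x" "x < 1" "f' x = 0" and le: "f 1 \<le> f x"
    and y: "0 \<le> y" "y \<le> 1"
  shows "f y \<le> f x"
proof (rule ccontr)
  assume "\<not> f y \<le> f x"
  then have fy: "f x < f y" by simp
  have mvt: "\<exists>t. a < t \<and> t < b \<and> f b - f a = (b - a) * f' t" if "0 \<le> a" "a < b" "b \<le> 1" for a b
    using that by (intro MVT_real_derivative der continuous_on_subset[OF cont]) auto
  have chord: "f' b \<le> max (f' a) (f' c)" if "0 < a" "a < b" "b < c" "c < 1" for a b c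
  proof -
    define u where "u = (c - b) / (c - a)"
    have u: "0 \<le> u" "u \<le> 1" "b = u * a + (1 - u) * c"
      using that convex_comb[of a b c] by (auto simp: u_def)
    have "f' (u *\<^sub>R a + (1 - u) *\<^sub>R c) \<le> u * f' a + (1 - u) * f' c"
      using that u convex_onD[OF cvx, of "1 - u" a c] by simp
    then have "f' b \<le> u * f' a + (1 - u) * f' c" using u by simp
    also have "\<dots> \<le> u * max (f' a) (f' c) + (1 - u) * max (f' a) (f' c)"
      using u by (intro add_mono mult_left_mono) auto
    finally show ?thesis by (simp add: algebra_simps)
  qed
  have chord0: "0 < f' c" if "0 < a" "a < x" "x < c" "c < 1" "f' a < 0" for a c
  proof -
    define u where "u = (c - x) / (c - a)"
    have u: "0 < u" "u < 1" "x = u * a + (1 - u) * c"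
      using that convex_comb[of a x c] by (auto simp: u_def)
    have "f' (u *\<^sub>R a + (1 - u) *\<^sub>R c) \<le> u * f' a + (1 - u) * f' c"
      using that u convex_onD[OF cvx, of "1 - u" a c] by simp
    then have "0 \<le> u * f' a + (1 - u) * f' c" using u x by simp
    moreover have "u * f' a < 0" using u that by (simp add: mult_pos_neg)
    ultimately have "0 < (1 - u) * f' c" by linarith
    then show ?thesis using u by (simp add: zero_less_mult_iff)
  qed
  have "y \<noteq> x" using fy by auto
  then consider "x < y" | "y < x" by linarith
  then show False
  proof cases
    case 1
    then have "y < 1" using le fy y by (cases "y = 1") auto
    obtain t where t: "x < t" "t < y" "f y - f x = (y - x) * f' t" using mvt[of x y] 1 x y by auto
    obtain t' where t': "y < t'" "t' < 1" "f 1 - f y = (1 - y) * f' t'" using mvt[of y 1] \<open>y < 1\<close> y by auto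
    have "0 < (y - x) * f' t" "(1 - y) * f' t' < 0" using t t' fy le by linarith+
    then have "0 < f' t" "f' t' < 0" using 1 \<open>y < 1\<close> by (auto simp: zero_less_mult_iff mult_less_0_iff)
    moreover have "f' t \<le> max (f' x) (f' t')" using t t' x by (intro chord) auto
    ultimately show False using x by simp
  next
    case 2
    obtain t where t: "y < t" "t < x" "f x - f y = (x - y) * f' t" using mvt[of y x] 2 x y by auto
    obtain t' where t': "x < t'" "t' < 1" "f 1 - f x = (1 - x) * f' t'" using mvt[of x 1] x by auto
    have "(x - y) * f' t < 0" using t fy by linarith
    then have "f' t < 0" using 2 by (auto simp: mult_less_0_iff)
    then have "0 < f' t'" using t t' x y by (intro chord0[of t t']) auto
    then have "0 < (1 - x) * f' t'" using x by simp
    then show False using t' le by linarith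
  qed
qed

section \<open>The integral \<open>R\<close> and its increments\<close>

text \<open>Closed form of the integral of \<open>min y ((1 - t) ^ d)\<close> over
  \<open>[0, q]\<close>: up to the crossing point \<open>1 - root d y\<close>, cut off at
  \<open>q\<close>, the integrand is \<open>y\<close>; beyond it, it is the power.\<close>

definition Rfun :: "nat \<Rightarrow> real \<Rightarrow> real \<Rightarrow> real" where
  "Rfun d q y = (let t = min q (1 - root d y)
     in y * t + ((1 - t) ^ (d + 1) - (1 - q) ^ (d + 1)) / (real d + 1))"

lemma Rfun_le:
  assumes "q \<le> 1 - root d y"
  shows "Rfun d q y = q * y"
  using assms by (simp add: Rfun_def min_def mult.commute)

text \<open>Past the crossing point only the upper limit of the integral of the power involves
  \<open>q\<close>. This is the separated form on which the dual inequality rests.\<close>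

lemma Rfun_ge:
  assumes "0 < d" "0 \<le> y" "1 - root d y \<le> q"
  shows "Rfun d q y = y - d / (real d + 1) * (y * root d y) - (1 - q) ^ (d + 1) / (real d + 1)"
proof -
  have "min q (1 - root d y) = 1 - root d y" using assms by simp
  moreover have "root d y ^ (d + 1) = y * root d y" using assms by simp
  ultimately have R: "Rfun d q y = y * (1 - root d y) + (y * root d y - (1 - q) ^ (d + 1)) / (real d + 1)"
    by (simp add: Rfun_def)
  have ne: "real d + 1 \<noteq> 0" by linarith
  have "(real d + 1) * Rfun d q y = (real d + 1) * y - d * (y * root d y) - (1 - q) ^ (d + 1)"
    unfolding R distrib_left times_divide_eq_right nonzero_mult_div_cancel_left[OF ne]
    by (simp add: algebra_simps)
  also have "\<dots> = (real d + 1) * (y - d / (real d + 1) * (y * root d y) - (1 - q) ^ (d + 1) / (real d + 1))"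
    by (rule scale_Suc[symmetric])
  finally show ?thesis using ne mult_left_cancel by blast
qed

lemma Rfun_diag:
  assumes "1 \<le> d" "beta d \<le> x" "x \<le> 1"
  shows "Rfun d x x = rfun d x"
proof -
  have x: "0 < x" using beta[OF assms(1)] assms by linarith
  have "(real d + 1) * Rfun d x x = (real d + 1) * rfun d x"
    using one_minus_le_root[OF assms] assms x
    by (subst rfun_root, simp, simp, subst Rfun_ge, simp, simp, simp, subst scale_Suc) (simp add: mult.assoc)
  then show ?thesis by (simp add: mult_left_cancel)
qed

lemma power_one_minus_diff:
  fixes p p' :: real
  assumes "p \<le> p'" "p' \<le> 1"
  shows "(p' - p) * (1 - p') ^ d \<le> ((1 - p) ^ (d + 1) - (1 - p') ^ (d + 1)) / (real d + 1)"
    and "((1 - p) ^ (d + 1) - (1 - p') ^ (d + 1)) / (real d + 1) \<le> (p' - p) * (1 - p) ^ d"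
proof -
  have *: "\<exists>t. p \<le> t \<and> t \<le> p' \<and>
      ((1 - p) ^ (d + 1) - (1 - p') ^ (d + 1)) / (real d + 1) = (p' - p) * (1 - t) ^ d"
  proof (cases "p = p'")
    case False
    let ?f = "\<lambda>x::real. - ((1 - x) ^ (d + 1) / (real d + 1))"
    have "\<exists>t. p < t \<and> t < p' \<and> ?f p' - ?f p = (p' - p) * (1 - t) ^ d"
      using False assms DERIV_minus[OF DERIV_power_one_minus[of d]]
      by (intro MVT_real_derivative continuous_intros) auto
    then show ?thesis by (auto simp: diff_divide_distrib intro: less_imp_le)
  qed auto
  then obtain t where t: "p \<le> t" "t \<le> p'"
      "((1 - p) ^ (d + 1) - (1 - p') ^ (d + 1)) / (real d + 1) = (p' - p) * (1 - t) ^ d" by blast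
  show "(p' - p) * (1 - p') ^ d \<le> ((1 - p) ^ (d + 1) - (1 - p') ^ (d + 1)) / (real d + 1)"
    unfolding t(3) using t assms by (intro mult_left_mono power_mono) auto
  show "((1 - p) ^ (d + 1) - (1 - p') ^ (d + 1)) / (real d + 1) \<le> (p' - p) * (1 - p) ^ d"
    unfolding t(3) using t assms by (intro mult_left_mono power_mono) auto
qed

text \<open>The integrand decreases, so an increment lies between its length times the values at the
  right and at the left end. Summed over a grid this gives both Riemann sum estimates,
  \<open>sum_le_Rfun\<close> and \<open>Rfun_le_sum\<close>, without any integration.\<close>

lemma Rfun_increment:
  assumes d: "0 < d" and p: "0 \<le> p" "p \<le> p'" "p' \<le> 1" and y: "0 \<le> y" "y \<le> 1"
  shows "(p' - p) * min y ((1 - p') ^ d) \<le> Rfun d p' y - Rfun d p y" (is ?A)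
    and "Rfun d p' y - Rfun d p y \<le> (p' - p) * min y ((1 - p) ^ d)" (is ?B)
proof -
  let ?t = "1 - root d y"
  let ?G = "\<lambda>a b::real. ((1 - a) ^ (d + 1) - (1 - b) ^ (d + 1)) / (real d + 1)"
  have yt: "(1 - ?t) ^ d = y" "0 \<le> ?t" "?t \<le> 1" using d y by auto
  have lo: "y \<le> (1 - u) ^ d" if "u \<le> ?t" for u
    using power_mono[of "1 - ?t" "1 - u" d] that yt by simp
  have hi: "(1 - u) ^ d \<le> y" if "?t \<le> u" "u \<le> 1" for u
    using power_mono[of "1 - u" "1 - ?t" d] that yt by simp
  consider "p' \<le> ?t" | "?t \<le> p" | "p < ?t" "?t < p'" by linarith
  then have "?A \<and> ?B"
  proof cases
    case 1
    then show ?thesis using p lo[of p] lo[of p'] by (simp add: Rfun_le algebra_simps)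
  next
    case 2
    then have "Rfun d p' y - Rfun d p y = ?G p p'"
      using p y d by (subst (1 2) Rfun_ge) (auto simp: diff_divide_distrib)
    then show ?thesis using power_one_minus_diff[of p p' d] p 2 hi[of p] hi[of p'] by simp
  next
    \<comment> \<open>The crossing point lies strictly between \<open>p\<close> and
      \<open>p'\<close>; the increment is split there.\<close>
    case 3
    have eq: "Rfun d p' y - Rfun d p y = (?t - p) * y + ?G ?t p'"
      using 3 by (simp add: Rfun_def Let_def min_def algebra_simps)
    have "?G ?t p' \<ge> (p' - ?t) * (1 - p') ^ d" "?G ?t p' \<le> (p' - ?t) * y"
      using power_one_minus_diff[of ?t p' d] p 3 yt by auto
    moreover have "(?t - p) * (1 - p') ^ d \<le> (?t - p) * y" using 3 hi[of p'] p by (intro mult_left_mono) auto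
    ultimately have "(?t - p) * (1 - p') ^ d + (p' - ?t) * (1 - p') ^ d \<le> Rfun d p' y - Rfun d p y"
      "Rfun d p' y - Rfun d p y \<le> (?t - p) * y + (p' - ?t) * y"
      unfolding eq by linarith+
    then have "(p' - p) * (1 - p') ^ d \<le> Rfun d p' y - Rfun d p y"
      "Rfun d p' y - Rfun d p y \<le> (p' - p) * y" by (auto simp: algebra_simps)
    then show ?thesis using 3 hi[of p'] lo[of p] p by (simp add: min_absorb1 min_absorb2)
  qed
  then show ?A ?B by auto
qed

section \<open>The dual inequality\<close>

text \<open>Convexity of \<open>- root d\<close>, expressed through its derivative.\<close>

lemma mono_neg_inverse_root:
  assumes "0 < d" "0 < x" "x \<le> y"
  shows "- inverse (real d * root d x ^ (d - Suc 0)) \<le> - inverse (real d * root d y ^ (d - Suc 0))"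
proof -
  have "root d x ^ (d - Suc 0) \<le> root d y ^ (d - Suc 0)"
    using assms by (intro power_mono) auto
  moreover have "0 < root d x ^ (d - Suc 0)" using assms by simp
  ultimately have "inverse (real d * root d y ^ (d - Suc 0)) \<le> inverse (real d * root d x ^ (d - Suc 0))"
    using assms by (intro le_imp_inverse_le mult_left_mono mult_pos_pos) auto
  then show ?thesis by linarith
qed

text \<open>\<open>eq\<close> and \<open>crit\<close> say that the inequality is sharp at
  \<open>(x, x)\<close> and stationary there along the diagonal, \<open>corner\<close> that it holds
  at \<open>(1, 1)\<close>. The split of \<open>G\<close> and \<mu> (the \<rho> of the overview) are
  chosen so that \<psi>, the summand in \<open>q\<close>, and \<phi>, the summand in
  \<open>y\<close>, both satisfy \<open>max_at_critical_point\<close>.\<close>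

lemma dual_inequality:
  fixes \<kappa> G x :: real
  assumes d: "2 \<le> d" and x: "beta d \<le> x" "x < 1" and nonneg: "0 \<le> \<kappa>" "0 \<le> G"
    and eq: "\<kappa> * rfun d x + G * x\<^sup>2 = x" and crit: "\<kappa> * rfun' d x + 2 * G * x = 1"
    and corner: "\<kappa> / (real d + 1) + G \<le> 1"
  obtains \<delta> \<epsilon> \<mu> :: real where "0 \<le> \<delta>" "0 \<le> \<epsilon>" "\<delta> + \<epsilon> = G" "0 \<le> \<mu>" "\<mu> \<le> 1"
    "\<And>q y. 0 \<le> q \<Longrightarrow> q \<le> 1 \<Longrightarrow> 0 \<le> y \<Longrightarrow> y \<le> 1 \<Longrightarrow>
       \<kappa> * Rfun d q y + \<delta> * q\<^sup>2 + \<epsilon> * y\<^sup>2 \<le> \<mu> * q + (1 - \<mu>) * y"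
proof -
  have x0: "0 < x" using beta[of d] d x by linarith
  define s where "s = root d x"
  have s: "0 < s" "s < 1" using x0 x d by (auto simp: s_def)
  \<comment> \<open>The value of \<delta> for which \<open>\<psi> 1 = \<psi> x\<close>. Cutting it
    off at \<open>G\<close> keeps \<epsilon> nonnegative.\<close>
  define \<delta>1 where "\<delta>1 = \<kappa> * real d / (real d + 1) * (1 - x) ^ (d - 1)"
  define \<delta> where "\<delta> = min \<delta>1 G"
  define \<epsilon> where "\<epsilon> = G - \<delta>"
  \<comment> \<open>Forced by \<open>\<psi>' x = 0\<close>; then \<open>\<phi>' x = 0\<close> is
    just \<open>crit\<close>.\<close>
  define \<mu> where "\<mu> = \<kappa> * (1 - x) ^ d + 2 * \<delta> * x"
  have pos: "0 \<le> \<delta>" "0 \<le> \<epsilon>" using x nonneg by (auto simp: \<delta>_def \<epsilon>_def \<delta>1_def)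
  have mu': "1 - \<mu> = \<kappa> * (1 - s) + 2 * \<epsilon> * x"
    using crit by (simp add: \<mu>_def \<epsilon>_def rfun'_def s_def algebra_simps)
  have mu: "0 \<le> \<mu>" "0 \<le> 1 - \<mu>"
    using pos nonneg x x0 s unfolding mu' by (auto simp: \<mu>_def)
  define \<psi> where "\<psi> q = \<delta> * q\<^sup>2 - \<mu> * q - \<kappa> * ((1 - q) ^ (d + 1) / (real d + 1))" for q :: real
  define \<psi>' where "\<psi>' q = 2 * \<delta> * q - \<mu> + \<kappa> * (1 - q) ^ d" for q :: real
  define \<phi> where "\<phi> y = \<kappa> * (y - d / (real d + 1) * (y * root d y)) + \<epsilon> * y\<^sup>2 - (1 - \<mu>) * y" for y :: real
  define \<phi>' where "\<phi>' y = \<kappa> * (1 - root d y) + 2 * \<epsilon> * y - (1 - \<mu>)" for y :: real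
  have ne: "real d + 1 > 0" by linarith
  have dpsi: "(\<psi> has_real_derivative \<psi>' q) (at q)" for q
  proof -
    have "(\<psi> has_real_derivative \<delta> * (2 * q) - \<mu> - \<kappa> * - ((1 - q) ^ d)) (at q)"
      unfolding \<psi>_def
      by (intro DERIV_diff DERIV_cmult DERIV_power_one_minus) (auto intro!: derivative_eq_intros)
    then show ?thesis by (simp add: \<psi>'_def algebra_simps)
  qed
  have dphi: "(\<phi> has_real_derivative \<phi>' y) (at y)" if "0 < y" for y
  proof -
    have h: "(\<phi> has_real_derivative \<kappa> * (1 - d / (real d + 1) * ((1 + 1 / d) * root d y)) + \<epsilon> * (2 * y) - (1 - \<mu>)) (at y)"
      unfolding \<phi>_def using that d
      by (intro DERIV_diff DERIV_add DERIV_cmult DERIV_mult_root) (auto intro!: derivative_eq_intros)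
    have "d / (real d + 1) * ((1 + 1 / d) * root d y) = root d y"
    proof -
      have "1 + 1 / real d = (real d + 1) / real d" using d by (simp add: field_simps)
      then show ?thesis using d by simp
    qed
    from h[unfolded this] show ?thesis by (simp add: \<phi>'_def algebra_simps)
  qed
  have at_x: "\<psi>' x = 0" "\<phi>' x = 0" by (simp_all add: \<psi>'_def \<phi>'_def mu' s_def) (simp add: \<mu>_def)
  have sum_x: "\<phi> x + \<psi> x = 0"
  proof -
    have "\<phi> x + \<psi> x = \<kappa> * Rfun d x x + G * x\<^sup>2 - x"
      using one_minus_le_root[of d x] d x x0
      by (subst Rfun_ge) (auto simp: \<phi>_def \<psi>_def \<epsilon>_def algebra_simps)
    then show ?thesis using eq Rfun_diag[of d x] d x by simp
  qed
  have sum_1: "\<phi> 1 + \<psi> 1 \<le> 0"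
  proof -
    have "\<phi> 1 + \<psi> 1 = \<kappa> * (1 - d / (real d + 1)) + G - 1"
      using d by (simp add: \<phi>_def \<psi>_def \<epsilon>_def)
    also have "1 - d / (real d + 1) = 1 / (real d + 1)" using ne by (simp add: field_simps)
    finally show ?thesis using corner by simp
  qed
  have psi_1: "\<psi> 1 - \<psi> x = (\<delta> - \<delta>1) * (1 - x)\<^sup>2"
  proof -
    obtain k where k: "d = Suc k" using d by (cases d) auto
    have "(real d + 1) * (\<psi> 1 - \<psi> x) = (real d + 1) * (\<delta> - \<delta> * x\<^sup>2 - \<mu> * (1 - x)) + \<kappa> * (1 - x) ^ (d + 1)"
      using ne by (simp add: \<psi>_def right_diff_distrib distrib_left)
    also have "\<dots> = (real d + 1) * \<delta> * (1 - x)\<^sup>2 - \<kappa> * d * ((1 - x) ^ (d - 1) * (1 - x)\<^sup>2)"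
      unfolding \<mu>_def using k by (simp add: algebra_simps power2_eq_square)
    also have "\<dots> = (real d + 1) * ((\<delta> - \<delta>1) * (1 - x)\<^sup>2)"
      using ne by (simp add: \<delta>1_def left_diff_distrib right_diff_distrib)
    finally show ?thesis using ne by simp
  qed
  have psi_le: "\<psi> 1 \<le> \<psi> x"
    using psi_1 by (smt (verit) \<delta>_def mult_nonneg_nonneg min.cobounded1 mult_minus_left zero_le_power2)
  have phi_le: "\<phi> 1 \<le> \<phi> x"
  proof (cases "\<delta>1 \<le> G")
    \<comment> \<open>Here \<psi> takes equal values at \<open>x\<close> and \<open>1\<close>, so
      the sign of the sum at \<open>1\<close> passes entirely to \<phi>.\<close>
    case True
    then have "\<psi> 1 = \<psi> x" using psi_1 by (simp add: \<delta>_def)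
    then show ?thesis using sum_1 sum_x by linarith
  next
    case False
    then have e0: "\<epsilon> = 0" by (simp add: \<epsilon>_def \<delta>_def)
    \<comment> \<open>Without the quadratic term \<open>\<phi> x - \<phi> 1\<close> is explicit, and
      Bernoulli gives its sign.\<close>
    have "0 \<le> \<kappa> * (d / (real d + 1) * (1 - x * s) - (1 - x) * s)"
    proof -
      have "(real d + 1) * (1 - x) * s \<le> real d * (1 - x * s)"
      proof -
        have "(1 - x) * s \<le> 1 - x" using x s by (simp add: mult_left_le)
        also have "\<dots> \<le> d * (1 - s)" unfolding s_def using bernoulli_root[of d x] d x x0 by simp
        finally have "real d * s + s - x * s \<le> d" by (simp add: algebra_simps)
        then show ?thesis by (simp add: algebra_simps)
      qed
      then have "(1 - x) * s \<le> d * (1 - x * s) / (real d + 1)" 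
        by (subst pos_le_divide_eq[OF ne]) (simp add: mult.commute mult.left_commute)
      then show ?thesis using nonneg by simp
    qed
    also have "\<dots> = \<phi> x - \<phi> 1"
      unfolding \<phi>_def e0 mu' s_def using d by (simp only: right_diff_distrib) (simp add: algebra_simps)
    finally show ?thesis by simp
  qed
  have cpsi: "convex_on {0<..<1} \<psi>'"
  proof (rule convex_on_realI[where f' = "\<lambda>q. 2 * \<delta> - \<kappa> * d * (1 - q) ^ (d - 1)"])
    fix q r :: real assume "q \<in> {0<..<1}" "r \<in> {0<..<1}" "q \<le> r"
    then have "(1 - r) ^ (d - 1) \<le> (1 - q) ^ (d - 1)" by (intro power_mono) auto
    then have "\<kappa> * d * (1 - r) ^ (d - 1) \<le> \<kappa> * d * (1 - q) ^ (d - 1)"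
      using nonneg by (intro mult_left_mono) auto
    then show "2 * \<delta> - \<kappa> * d * (1 - q) ^ (d - 1) \<le> 2 * \<delta> - \<kappa> * d * (1 - r) ^ (d - 1)" by simp
  qed (auto simp: \<psi>'_def[abs_def] intro!: derivative_eq_intros)
  have cphi: "convex_on {0<..<1} \<phi>'"
  proof (rule convex_on_realI[where f' = "\<lambda>y. \<kappa> * - inverse (real d * root d y ^ (d - Suc 0)) + 2 * \<epsilon>"])
    fix q r :: real assume "q \<in> {0<..<1}" "r \<in> {0<..<1}" "q \<le> r"
    then show "\<kappa> * - inverse (real d * root d q ^ (d - Suc 0)) + 2 * \<epsilon>
         \<le> \<kappa> * - inverse (real d * root d r ^ (d - Suc 0)) + 2 * \<epsilon>"
      using nonneg d by (intro add_right_mono mult_left_mono mono_neg_inverse_root) auto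
  next
    fix y :: real assume y: "y \<in> {0<..<1}"
    have "((\<lambda>y. \<kappa> * (1 - root d y) + 2 * \<epsilon> * y - (1 - \<mu>)) has_real_derivative
        \<kappa> * (0 - inverse (real d * root d y ^ (d - Suc 0))) + 2 * \<epsilon> * 1 - 0) (at y)"
      using y d by (intro DERIV_diff DERIV_add DERIV_cmult DERIV_real_root DERIV_const DERIV_ident) auto
    then show "(\<phi>' has_real_derivative \<kappa> * - inverse (real d * root d y ^ (d - Suc 0)) + 2 * \<epsilon>) (at y)"
      by (simp add: \<phi>'_def[abs_def])
  qed auto
  have "continuous_on {0..1} \<psi>" "continuous_on {0..1} \<phi>"
    unfolding \<psi>_def \<phi>_def using ne d by (intro continuous_intros; simp)+
  then have max_psi: "\<psi> q \<le> \<psi> x" and max_phi: "\<phi> q \<le> \<phi> x" if "0 \<le> q" "q \<le> 1" for q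
    using max_at_critical_point[OF _ dpsi cpsi x0 x(2) at_x(1) psi_le that]
      max_at_critical_point[OF _ dphi cphi x0 x(2) at_x(2) phi_le that] by blast+
  define F where "F q y = \<kappa> * Rfun d q y + \<delta> * q\<^sup>2 + \<epsilon> * y\<^sup>2 - \<mu> * q - (1 - \<mu>) * y" for q y
  have sep: "F q y \<le> 0" if "0 \<le> q" "q \<le> 1" "0 \<le> y" "y \<le> 1" "1 - root d y \<le> q" for q y
  proof -
    have "F q y = \<phi> y + \<psi> q"
      using that d by (simp add: F_def \<phi>_def \<psi>_def Rfun_ge algebra_simps)
    then show ?thesis using max_psi[of q] max_phi[of y] that sum_x by linarith
  qed
  have "F q y \<le> 0" if q: "0 \<le> q" "q \<le> 1" and y: "0 \<le> y" "y \<le> 1" for q y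
  proof (cases "1 - root d y \<le> q")
    case True
    then show ?thesis using sep that by blast
  next
    case False
    define p where "p = 1 - root d y"
    have p: "q < p" "0 < p" "p \<le> 1" using False q y d unfolding p_def by (linarith, linarith, simp)
    \<comment> \<open>This corner bounds \<epsilon> by \<open>1 - \<mu>\<close> and so gives the
      inequality on the whole edge \<open>q = 0\<close>.\<close>
    have "F 0 1 \<le> 0" using d by (intro sep) auto
    moreover have "Rfun d 0 1 = 0" using d by (subst Rfun_le) auto
    ultimately have "\<epsilon> \<le> 1 - \<mu>" by (simp add: F_def)
    then have "y * (\<epsilon> * y) \<le> y * (1 - \<mu>)"
      using y pos mult_left_le[of y \<epsilon>] by (intro mult_left_mono) linarith+
    then have F0: "\<epsilon> * y\<^sup>2 - (1 - \<mu>) * y \<le> 0" by (simp add: power2_eq_square algebra_simps)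
    have "F p y \<le> 0" using p y by (intro sep) (auto simp: p_def)
    then have Fp: "\<kappa> * (p * y) + \<delta> * p\<^sup>2 + \<epsilon> * y\<^sup>2 - \<mu> * p - (1 - \<mu>) * y \<le> 0"
      by (simp add: F_def Rfun_le p_def)
    have Fq: "F q y = \<kappa> * (q * y) + \<delta> * q\<^sup>2 + \<epsilon> * y\<^sup>2 - \<mu> * q - (1 - \<mu>) * y"
      using p by (simp add: F_def Rfun_le p_def)
    \<comment> \<open>Before the crossing point \<open>Rfun d q y = q * y\<close>, so
      \<open>F\<close> is a quadratic in \<open>q\<close> with leading coefficient
      \<open>\<delta> \<ge> 0\<close>. The identity is its convexity between \<open>0\<close> and
      \<open>p\<close>, with both end values already known to be nonpositive.\<close>
    have "p * (\<kappa> * (q * y) + \<delta> * q\<^sup>2 + \<epsilon> * y\<^sup>2 - \<mu> * q - (1 - \<mu>) * y) =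
        q * (\<kappa> * (p * y) + \<delta> * p\<^sup>2 + \<epsilon> * y\<^sup>2 - \<mu> * p - (1 - \<mu>) * y)
        + (p - q) * (\<epsilon> * y\<^sup>2 - (1 - \<mu>) * y) - \<delta> * p * q * (p - q)"
      by (simp add: algebra_simps power2_eq_square)
    moreover have "q * (\<kappa> * (p * y) + \<delta> * p\<^sup>2 + \<epsilon> * y\<^sup>2 - \<mu> * p - (1 - \<mu>) * y) \<le> 0"
      using Fp q by (simp add: mult_nonneg_nonpos)
    moreover have "(p - q) * (\<epsilon> * y\<^sup>2 - (1 - \<mu>) * y) \<le> 0"
      using F0 p by (simp add: mult_nonneg_nonpos)
    moreover have "0 \<le> \<delta> * p * q * (p - q)" using pos p q by simp
    ultimately have "p * F q y \<le> 0" unfolding Fq by linarith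
    then show ?thesis using p by (simp add: mult_le_0_iff)
  qed
  then show ?thesis
    using that[of \<delta> \<epsilon> \<mu>] pos mu by (simp add: F_def \<epsilon>_def algebra_simps)
qed

section \<open>The points \<open>x\<^sub>b\<^sub>a\<^sub>l\<close> and \<open>x\<^sub>b\<^sub>s\<^sub>t\<close>\<close>

text \<open>\<open>Efun\<close> is the numerator of the derivative of \<open>(x - x\<^sup>2) / ((d + 1) r(x) - x\<^sup>2) = 1 - g(x)\<close>.\<close>

definition Efun :: "nat \<Rightarrow> real \<Rightarrow> real" where
  "Efun d x = x * (1 - x) * root d x - d * x\<^sup>2 * (1 - root d x)
     - (1 - x) ^ (d + 1) * (1 + (real d - 1) * x)"

lemma Efun_eq:
  assumes "0 < d" "0 \<le> x"
  shows "(1 - 2 * x) * ((real d + 1) * rfun d x - x\<^sup>2) - (x - x\<^sup>2) * ((real d + 1) * rfun' d x - 2 * x) = Efun d x"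
  using assms by (subst D_eq) (auto simp: Efun_def rfun'_def algebra_simps power2_eq_square)

section \<open>Where \<open>Efun\<close> is positive\<close>

text \<open>The difference of the two sides vanishes at \<open>s = 1\<close> and does not increase,
  by Bernoulli. With \<open>x = s ^ d\<close>, the right-hand side times \<open>x * s\<close> is the
  part of \<open>Efun d x\<close> free of powers of \<open>1 - x\<close>; the square on the left is
  \<open>(1 - x) ^ 2\<close>, which also divides the remaining part.\<close>

lemma sum_gap_ge:
  fixes s :: real
  assumes d: "2 \<le> d" and s: "0 \<le> s" "s \<le> 1"
  shows "(real d - 1) / (2 * real d) * (1 - s ^ d)\<^sup>2 \<le> 1 - d * s ^ (d - 1) + (real d - 1) * s ^ d"
proof -
  obtain k where k: "d = Suc (Suc k)" using d by (metis Suc_le_D numeral_2_eq_2 Suc_le_mono)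
  define f where "f s = 1 - d * s ^ (d - 1) + (real d - 1) * s ^ d - (real d - 1) / (2 * real d) * (1 - s ^ d)\<^sup>2" for s :: real
  have der: "(f has_real_derivative (real d - 1) * s ^ k * (s * (1 - s ^ d) - d * (1 - s))) (at s)" for s :: real
  proof -
    have h: "(f has_real_derivative 0 - d * ((real d - 1) * s ^ k) + (real d - 1) * (d * s ^ (d - 1))
        - (real d - 1) / (2 * real d) * (2 * (1 - s ^ d) * (- (d * s ^ (d - 1))))) (at s)"
      unfolding f_def k by (rule derivative_eq_intros refl | simp)+
    have "(real d - 1) / (2 * real d) * (2 * (1 - s ^ d) * (- (d * s ^ (d - 1)))) = - ((real d - 1) * (1 - s ^ d) * s ^ (d - 1))"
      using d by simp
    note h[unfolded this]
    moreover have "0 - d * ((real d - 1) * s ^ k) + (real d - 1) * (d * s ^ (d - 1)) - - ((real d - 1) * (1 - s ^ d) * s ^ (d - 1))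
        = (real d - 1) * s ^ k * (s * (1 - s ^ d) - d * (1 - s))"
      by (simp add: k algebra_simps)
    ultimately show ?thesis by (rule DERIV_cong)
  qed
  have "f 1 \<le> f s"
  proof (rule DERIV_nonpos_imp_nonincreasing[OF s(2)])
    fix t :: real assume t: "s \<le> t" "t \<le> 1"
    have "1 + real d * (t - 1) \<le> (1 + (t - 1)) ^ d" using t s by (intro Bernoulli_inequality) auto
    then have "1 - t ^ d \<le> d * (1 - t)" by (simp add: algebra_simps)
    moreover have "t * (1 - t ^ d) \<le> 1 - t ^ d" using t s by (simp add: mult_left_le_one_le power_le_one)
    ultimately have "t * (1 - t ^ d) - d * (1 - t) \<le> 0" by linarith
    moreover have "0 \<le> (real d - 1) * t ^ k" using d t s by simp
    ultimately have "(real d - 1) * t ^ k * (t * (1 - t ^ d) - d * (1 - t)) \<le> 0"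
      by (intro mult_nonneg_nonpos)
    then show "\<exists>y. DERIV f t :> y \<and> y \<le> 0"
      using der[of t] by blast
  qed
  moreover have "f 1 = 0" using d by (simp add: f_def)
  ultimately show ?thesis by (simp add: f_def)
qed

lemma decreasing_tail:
  fixes x y :: real
  assumes "1 \<le> k" "0 \<le> x" "x \<le> y" "y \<le> 1"
  shows "(1 - y) ^ k * (1 + k * y) \<le> (1 - x) ^ k * (1 + k * x)"
proof (rule DERIV_nonpos_imp_nonincreasing[OF assms(3), where f = "\<lambda>x. (1 - x) ^ k * (1 + k * x)"])
  fix t assume t: "x \<le> t" "t \<le> y"
  obtain j where j: "k = Suc j" using assms by (cases k) auto
  have "((\<lambda>x::real. (1 - x) ^ k * (1 + k * x)) has_real_derivative
      - (k * (1 - t) ^ j * (k + 1) * t)) (at t)"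
    unfolding j by (rule derivative_eq_intros refl | simp add: algebra_simps)+
  moreover have "0 \<le> k * (1 - t) ^ j * (k + 1) * t" using t assms by auto
  ultimately show "\<exists>y. ((\<lambda>x. (1 - x) ^ k * (1 + k * x)) has_real_derivative y) (at t) \<and> y \<le> 0"
    by auto
qed

text \<open>By \<open>sum_gap_ge\<close> a factor \<open>(1 - x) ^ 2\<close> cancels, and the
  inequality \<open>*\<close> at \<open>x\<close> in place of \<open>z\<close> suffices. Its
  left-hand side decreases and its right-hand side increases with the point, so a single check at
  \<open>z\<close> covers \<open>[z, 1)\<close>.\<close>

lemma Efun_pos:
  fixes x z :: real
  assumes d: "2 \<le> d" and z: "0 < z" "z \<le> x" "x < 1"
    and *: "(1 - z) ^ (d - 1) * (1 + (real d - 1) * z) < (real d - 1) / (2 * real d) * (z * root d z)"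
  shows "0 < Efun d x"
proof -
  let ?s = "root d x"
  have s: "0 < ?s" "?s \<le> 1" "?s ^ d = x" using z d by auto
  note gap = sum_gap_ge[OF d less_imp_le[OF s(1)] s(2)]
  have xs: "0 \<le> x * ?s" using z s(1) by simp
  obtain k where k: "d = Suc k" "1 \<le> k" using d by (cases d) auto
  have "(1 - x) ^ (d - 1) * (1 + (real d - 1) * x) \<le> (1 - z) ^ (d - 1) * (1 + (real d - 1) * z)"
    using decreasing_tail[of k z x] k z by simp
  also note *
  also have "(real d - 1) / (2 * real d) * (z * root d z) \<le> (real d - 1) / (2 * real d) * (x * ?s)"
    using d z by (intro mult_left_mono mult_mono) auto
  finally have "(1 - x) ^ (d - 1) * (1 + (real d - 1) * x) < (real d - 1) / (2 * real d) * (x * ?s)" .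
  then have "(1 - x)\<^sup>2 * ((1 - x) ^ (d - 1) * (1 + (real d - 1) * x)) < (1 - x)\<^sup>2 * ((real d - 1) / (2 * real d) * (x * ?s))"
    using z by (intro mult_strict_left_mono) auto
  also have "\<dots> = x * ?s * ((real d - 1) / (2 * real d) * (1 - ?s ^ d)\<^sup>2)" by (simp add: s algebra_simps)
  also have "\<dots> \<le> x * ?s * (1 - d * ?s ^ (d - 1) + (real d - 1) * ?s ^ d)"
    using mult_left_mono[OF gap xs] by linarith
  also have "\<dots> = x * (?s - d * (?s * ?s ^ (d - 1)) + (real d - 1) * ?s ^ d * ?s)" by (simp add: algebra_simps)
  also have "?s * ?s ^ (d - 1) = x" using s k by (metis diff_Suc_1 power_Suc)
  also have "(real d - 1) * ?s ^ d = (real d - 1) * x" by (simp add: s)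
  finally have "(1 - x)\<^sup>2 * ((1 - x) ^ (d - 1) * (1 + (real d - 1) * x)) < x * (?s - d * x + (real d - 1) * x * ?s)" .
  moreover have "(1 - x)\<^sup>2 * (1 - x) ^ (d - 1) = (1 - x) ^ (d + 1)"
    using d by (subst power_add[symmetric]) simp
  ultimately show ?thesis
    by (simp add: Efun_def mult.assoc[symmetric]) (simp add: algebra_simps power2_eq_square)
qed

section \<open>The sign of \<open>r(x) - x ^ 2 / 2\<close>\<close>

text \<open>For \<open>\<beta> \<le> x < 1\<close> it has the sign of the weight that the mixture
  gives to the extension for \<open>1\<close>.\<close>

definition hfun :: "nat \<Rightarrow> real \<Rightarrow> real" where
  "hfun d x = rfun d x - x\<^sup>2 / 2"

lemma DERIV_hfun: "0 < d \<Longrightarrow> 0 < x \<Longrightarrow> (hfun d has_real_derivative (rfun' d x - x)) (at x)"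
  unfolding hfun_def by (auto intro!: derivative_eq_intros DERIV_rfun)

lemma continuous_on_hfun: "0 < d \<Longrightarrow> A \<subseteq> {0<..} \<Longrightarrow> continuous_on A (hfun d)"
  unfolding hfun_def by (intro continuous_intros continuous_on_rfun) auto

text \<open>This makes \<open>hfun\<close> strictly concave. As it is positive at \<beta> and, for
  \<open>d \<ge> 2\<close>, negative at \<open>1\<close>, it changes sign exactly once, at
  \<open>x_bal\<close>.\<close>

lemma deriv_hfun_decreasing:
  assumes "0 < d" "0 \<le> x" "x < y" "y \<le> 1"
  shows "rfun' d y - y < rfun' d x - x"
proof -
  have "root d x \<le> root d y" "(1 - y) ^ d \<le> (1 - x) ^ d" using assms by (auto intro: power_mono)
  then show ?thesis using assms(3) unfolding rfun'_def by linarith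
qed

lemma hfun_MVT:
  assumes "0 < d" "0 < a" "a < b"
  shows "\<exists>t. a < t \<and> t < b \<and> hfun d b - hfun d a = (b - a) * (rfun' d t - t)"
  using assms by (intro MVT_real_derivative DERIV_hfun continuous_on_hfun) auto

lemma hfun_beta: "1 \<le> d \<Longrightarrow> 0 < hfun d (beta d)"
  using beta(1)[of d] by (simp add: hfun_def rfun_beta)

lemma hfun_between:
  assumes "1 \<le> d" "beta d \<le> x" "x \<le> z" "z \<le> 1" "0 \<le> hfun d z"
  shows "0 \<le> hfun d x"
proof (rule ccontr)
  assume *: "\<not> 0 \<le> hfun d x"
  have b: "0 < beta d" "0 < hfun d (beta d)" using beta[OF assms(1)] hfun_beta assms(1) by auto
  then have lt: "beta d < x" "x < z" using * assms by (metis order_le_less)+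
  obtain t where t: "beta d < t" "t < x" "hfun d x - hfun d (beta d) = (x - beta d) * (rfun' d t - t)"
    using hfun_MVT[of d "beta d" x] assms b lt by auto
  obtain t' where t': "x < t'" "t' < z" "hfun d z - hfun d x = (z - x) * (rfun' d t' - t')"
    using hfun_MVT[of d x z] assms b lt by auto
  have "(x - beta d) * (rfun' d t - t) < 0" "0 < (z - x) * (rfun' d t' - t')"
    using t t' * b assms by linarith+
  then have "rfun' d t - t < 0" "0 < rfun' d t' - t'"
    using lt by (auto simp: mult_less_0_iff zero_less_mult_iff)
  moreover have "rfun' d t' - t' < rfun' d t - t"
    using t t' b assms by (intro deriv_hfun_decreasing) auto
  ultimately show False by linarith
qed

lemma hfun_zero_ex1:
  assumes d: "2 \<le> d"
  shows "\<exists>!x. x \<in> {beta d..1} \<and> hfun d x = 0"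
proof -
  have b: "0 < beta d" "beta d < 1" "0 < hfun d (beta d)" using beta[of d] hfun_beta[of d] d by auto
  have "\<exists>x\<ge>beta d. x \<le> 1 \<and> hfun d x = 0"
    using b d by (intro IVT2' continuous_on_hfun) (auto simp: hfun_def rfun_1 field_simps)
  moreover have False if xy: "beta d \<le> x" "x < y" "y \<le> 1" "hfun d x = 0" "hfun d y = 0" for x y
  proof -
    have "x \<noteq> beta d" using xy b by auto
    then have lt: "beta d < x" using xy by simp
    obtain t where t: "beta d < t" "t < x" "hfun d x - hfun d (beta d) = (x - beta d) * (rfun' d t - t)"
      using hfun_MVT[of d "beta d" x] d b lt by auto
    obtain t' where t': "x < t'" "t' < y" "hfun d y - hfun d x = (y - x) * (rfun' d t' - t')"
      using hfun_MVT[of d x y] d b lt xy by auto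
    have "(x - beta d) * (rfun' d t - t) < 0" using t xy b by linarith
    then have "rfun' d t - t < 0" using lt by (auto simp: mult_less_0_iff)
    moreover have "rfun' d t' - t' = 0" using t' xy by simp
    moreover have "rfun' d t' - t' < rfun' d t - t"
      using t t' b xy d by (intro deriv_hfun_decreasing) auto
    ultimately show False by linarith
  qed
  ultimately show ?thesis by (metis atLeastAtMost_iff linorder_neqE_linordered_idom)
qed

lemma x_bal:
  assumes "2 \<le> d"
  shows "beta d \<le> x_bal d" "x_bal d < 1" "rfun d (x_bal d) = (x_bal d)\<^sup>2 / 2"
proof -
  have "\<exists>!x. x \<in> {beta d..1} \<and> rfun d x = x\<^sup>2 / 2"
    using hfun_zero_ex1[OF assms] by (simp add: hfun_def)
  from theI'[OF this] have *: "x_bal d \<in> {beta d..1}" "rfun d (x_bal d) = (x_bal d)\<^sup>2 / 2"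
    unfolding x_bal_def by blast+
  then show "beta d \<le> x_bal d" "rfun d (x_bal d) = (x_bal d)\<^sup>2 / 2" by auto
  have "x_bal d \<noteq> 1" using * assms by (auto simp: rfun_1 field_simps)
  then show "x_bal d < 1" using * by auto
qed

text \<open>Past its zero the concave \<open>hfun\<close> cannot become positive again. This
  supplies rational lower bounds for \<open>x_bal\<close>.\<close>

lemma x_bal_ge:
  assumes "2 \<le> d" "beta d \<le> z" "z \<le> 1" "0 < hfun d z"
  shows "z < x_bal d"
proof (rule ccontr)
  assume "\<not> z < x_bal d"
  then have xz: "x_bal d < z" using assms x_bal[OF assms(1)]
    by (metis diff_eq_eq hfun_def add_0 less_irrefl linorder_neqE_linordered_idom)
  have h0: "hfun d (x_bal d) = 0" using x_bal[OF assms(1)] by (simp add: hfun_def)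
  have lt: "beta d < x_bal d" using x_bal(1)[OF assms(1)] h0 hfun_beta[of d] assms
    by (metis less_eq_real_def less_irrefl one_le_numeral order_trans)
  have b: "0 < beta d" using beta assms by auto
  obtain t where t: "beta d < t" "t < x_bal d" "hfun d (x_bal d) - hfun d (beta d) = (x_bal d - beta d) * (rfun' d t - t)"
    using hfun_MVT[of d "beta d" "x_bal d"] assms b lt by auto
  obtain t' where t': "x_bal d < t'" "t' < z" "hfun d z - hfun d (x_bal d) = (z - x_bal d) * (rfun' d t' - t')"
    using hfun_MVT[of d "x_bal d" z] assms b lt xz by auto
  have "(x_bal d - beta d) * (rfun' d t - t) < 0" "0 < (z - x_bal d) * (rfun' d t' - t')"
    using t t' h0 hfun_beta[of d] assms by linarith+
  then have "rfun' d t - t < 0" "0 < rfun' d t' - t'"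
    using lt xz by (auto simp: mult_less_0_iff zero_less_mult_iff)
  moreover have "rfun' d t' - t' < rfun' d t - t"
    using t t' b assms by (intro deriv_hfun_decreasing) auto
  ultimately show False by linarith
qed

section \<open>A point between \<open>x_bst\<close> and \<open>x_bal\<close> for
  \<open>d \<ge> 4\<close>\<close>

lemma power_ge_quadratic:
  fixes x :: real
  assumes "0 \<le> x"
  shows "1 + n * x + n * (real n - 1) / 2 * x\<^sup>2 \<le> (1 + x) ^ n"
proof (induction n)
  case (Suc n)
  have "(1 + x) * (1 + n * x + n * (real n - 1) / 2 * x\<^sup>2) \<le> (1 + x) * (1 + x) ^ n"
    using Suc assms by (intro mult_left_mono) auto
  moreover have "(1 + x) * (1 + n * x + n * (real n - 1) / 2 * x\<^sup>2)
      = 1 + real (Suc n) * x + Suc n * (real (Suc n) - 1) / 2 * x\<^sup>2 + x * (n * (real n - 1) / 2 * x\<^sup>2)"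
    by (simp add: algebra_simps power2_eq_square add_divide_distrib diff_divide_distrib)
  moreover have "0 \<le> x * (n * (real n - 1) / 2 * x\<^sup>2)"
    using assms by (cases n) auto
  ultimately show ?case by simp
qed simp

text \<open>With \<open>X = d * b\<close> the equation for \<beta> gives
  \<open>b * exp X \<le> 1\<close>. If \<open>b * X\<close> exceeded 33/100, then \<open>X\<close>
  would exceed 2.14, where \<open>33/100 * exp X\<close> is larger than \<open>X\<close>.\<close>

lemma beta_bound:
  assumes d: "14 \<le> d"
  shows "d * (beta d)\<^sup>2 \<le> 33 / 100"
proof (rule ccontr)
  assume *: "\<not> d * (beta d)\<^sup>2 \<le> 33 / 100"
  define b where "b = beta d"
  define X where "X = d * b"
  have b: "0 < b" "b < 1" "(1 - b) ^ d = b" using beta[of d] d by (auto simp: b_def)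
  have bX: "33 / 100 < b * X" using * by (simp add: X_def b_def power2_eq_square algebra_simps)
  have X0: "0 < X" using b d by (simp add: X_def)
  \<comment> \<open>Here \<open>d \<ge> 14\<close> bounds \<open>X\<close> from below: 14 times 0.33
    exceeds the square of 2.14.\<close>
  have "14 * (b * X) \<le> X * X" using b d by (simp add: X_def mult_mono)
  then have "(214/100)\<^sup>2 < X\<^sup>2" using bX by (simp add: power2_eq_square)
  then have X: "214 / 100 < X" using X0 by (intro power2_less_imp_less[of "214/100" X]) auto
  have "b \<le> exp (- b) ^ d"
    using b exp_ge_add_one_self[of "- b"] by (subst b(3)[symmetric], intro power_mono) auto
  also have "\<dots> = exp (- X)" by (simp add: X_def exp_of_nat_mult[symmetric])
  finally have "b * exp X \<le> exp (- X) * exp X" by (intro mult_right_mono) auto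
  then have le1: "b * exp X \<le> 1" by (simp add: exp_minus)
  have "(1 + X / 2 + (X / 2)\<^sup>2 / 2)\<^sup>2 \<le> (exp (X / 2))\<^sup>2"
    using X0 by (intro power_mono exp_lower_Taylor_quadratic) auto
  also have "\<dots> = exp X" by (simp add: power2_eq_square exp_add[symmetric])
  also have "(1 + X / 2 + (X / 2)\<^sup>2 / 2)\<^sup>2 = 1 + X + X\<^sup>2 / 2 + X * X\<^sup>2 / 8 + X ^ 4 / 64"
    by (simp add: field_simps power2_eq_square power4_eq_xxxx)
  finally have e: "1 + X + X\<^sup>2 / 2 + X * X\<^sup>2 / 8 \<le> exp X"
    using zero_le_power[of X 4] X0 by linarith
  \<comment> \<open>The tangent of the square at 2.14 reduces the comparison to linear
    arithmetic.\<close>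
  have "0 \<le> (X - 214 / 100)\<^sup>2" by simp
  then have X2: "428 / 100 * X - 45796 / 10000 \<le> X\<^sup>2" by (simp add: power2_eq_square algebra_simps)
  then have "X * (428 / 100 * X - 45796 / 10000) \<le> X * X\<^sup>2" using X0 by (intro mult_left_mono) auto
  then have "428 / 100 * X\<^sup>2 - 45796 / 10000 * X \<le> X * X\<^sup>2" by (simp add: algebra_simps power2_eq_square)
  moreover have "X < 33 / 100 * (1 + X + Y / 2 + Z / 8)"
    if "428 / 100 * Y - 45796 / 10000 * X \<le> Z" "428 / 100 * X - 45796 / 10000 \<le> Y" for Y Z
    using that X by (simp add: field_simps)
  ultimately have "X < 33 / 100 * (1 + X + X\<^sup>2 / 2 + X * X\<^sup>2 / 8)"
    using X2 by blast
  also have "\<dots> \<le> 33 / 100 * exp X" using e by simp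
  also have "\<dots> \<le> b * X * exp X" using bX by (intro mult_right_mono) auto
  also have "\<dots> \<le> X" using mult_left_mono[OF le1, of X] X0 by (simp add: mult.commute mult.left_commute)
  finally show False by simp
qed

text \<open>For large \<open>d\<close> the point \<open>2 \<beta>\<close> separates \<open>x\<^sub>b\<^sub>s\<^sub>t\<close> from \<open>x\<^sub>b\<^sub>a\<^sub>l\<close>.\<close>

lemma separating_point_large:
  assumes d: "14 \<le> d"
  shows "\<exists>z. beta d \<le> z \<and> z < 1 \<and> 0 \<le> hfun d z \<and>
    (1 - z) ^ (d - 1) * (1 + (real d - 1) * z) < (real d - 1) / (2 * real d) * (z * root d z)"
proof -
  define b where "b = beta d"
  define a where "a = 1 - b"
  define k where "k = d - 1"
  have k: "d = Suc k" "real d = real k + 1" "13 \<le> k" using d by (auto simp: k_def)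
  have b: "0 < b" "b < 1" "a ^ d = b" "root d b = a"
    using beta[of d] root_beta[of d] d by (auto simp: b_def a_def)
  have N: "d * b\<^sup>2 \<le> 33 / 100" using beta_bound[OF d] by (simp add: b_def)
  have "14 * b\<^sup>2 \<le> d * b\<^sup>2" using d by (intro mult_right_mono) auto
  then have "b\<^sup>2 \<le> (154/1000)\<^sup>2" using N by (simp add: power2_eq_square)
  then have b_le: "b \<le> 154 / 1000" by (rule power2_le_imp_le) simp
  have a: "846 / 1000 \<le> a" "a < 1" using b_le b by (auto simp: a_def)
  \<comment> \<open>As \<open>1 - 2 * b = a ^ 2 - b ^ 2\<close>, this \<open>y\<close> is the
    relative gap between \<open>1 - 2 * b\<close> and \<open>a ^ 2\<close>. Powers of
    \<open>a\<close> are accessible through \<open>a ^ d = b\<close>.\<close>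
  define y where "y = (b / a)\<^sup>2"
  have a2: "1 - 2 * b = a\<^sup>2 * (1 - y)"
  proof -
    have "a\<^sup>2 * y = b\<^sup>2" using a by (simp add: y_def power_divide)
    then show ?thesis by (simp add: right_diff_distrib) (simp add: a_def power2_eq_square algebra_simps)
  qed
  have y: "0 \<le> y" "y \<le> 1"
  proof -
    have "b / a \<le> 1" using a b_le by (simp add: field_simps)
    then show "0 \<le> y" "y \<le> 1" using a b by (auto simp: y_def power_le_one)
  qed
  have "0 \<le> hfun d (2 * b)"
  proof -
    have "(real d - 1) / d \<ge> 13 / 14" using d by (simp add: field_simps)
    \<comment> \<open>Three terms of the binomial expansion give
      \<open>root d 2 \<le> 1 + 8 / 10 / d\<close>, which bounds \<open>root d (2 * b)\<close> in
      terms of \<open>root d b = a\<close>.\<close>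
    have "real d * (8 / 10 / d) = 8 / 10" using d by simp
    moreover have "real d * (real d - 1) / 2 * (8 / 10 / d)\<^sup>2 = 32 / 100 * ((real d - 1) / d)"
      using d by (simp add: power2_eq_square field_simps)
    ultimately have "1 + 8 / 10 + 32 / 100 * ((real d - 1) / d) \<le> (1 + 8 / 10 / d) ^ d"
      using power_ge_quadratic[of "8 / 10 / d" d] by (simp only:) simp
    then have "2 \<le> (1 + 8 / 10 / d) ^ d"
      using \<open>(real d - 1) / d \<ge> 13 / 14\<close> by linarith
    then have "root d 2 \<le> root d ((1 + 8 / 10 / d) ^ d)" using d by simp
    also have "\<dots> = 1 + 8 / 10 / d" using d by (intro real_root_power_cancel) auto
    finally have "root d 2 * a \<le> (1 + 8 / 10 / d) * a" using a by (intro mult_right_mono) auto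
    then have "root d (2 * b) \<le> (1 + 8 / 10 / d) * a" using b by (simp add: real_root_mult)
    then have "d * root d (2 * b) \<le> d * ((1 + 8 / 10 / d) * a)" by (intro mult_left_mono) auto
    also have "\<dots> = (d + 8 / 10) * a" using d by (simp add: field_simps)
    finally have "2 * b * (d * root d (2 * b)) \<le> 2 * b * ((d + 8 / 10) * a)"
      using b by (intro mult_left_mono) auto
    then have s: "d * (2 * b) * root d (2 * b) \<le> 2 * b * ((d + 8 / 10) * a)"
      by (simp add: algebra_simps)
    have "1 - 2 * b \<le> a\<^sup>2" using b by (simp add: a_def power2_eq_square algebra_simps)
    then have "(1 - 2 * b) ^ (d + 1) \<le> (a\<^sup>2) ^ (d + 1)" using b_le by (intro power_mono) auto
    also have "\<dots> = (a ^ (d + 1))\<^sup>2" by (simp only: power_mult[symmetric] mult.commute)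
    also have "\<dots> = (a ^ d * a)\<^sup>2" by (simp add: mult.commute)
    also have "\<dots> \<le> b\<^sup>2" using a b by (simp add: power_mult_distrib power_le_one mult_left_le)
    finally have t: "(1 - 2 * b) ^ (d + 1) \<le> b\<^sup>2" .
    have "(real d + 1) * hfun d (2 * b) = (real d + 1) * rfun d (2 * b) - (real d + 1) * (2 * b\<^sup>2)"
      by (simp add: hfun_def algebra_simps power2_eq_square)
    also have "\<dots> = (real d + 1) * (2 * b) - real d * (2 * b) * root d (2 * b) - (1 - 2 * b) ^ (d + 1)
        - (real d + 1) * (2 * b\<^sup>2)"
      using d b by (subst rfun_root) auto
    also have "\<dots> \<ge> (real d + 1) * (2 * b) - 2 * b * ((d + 8 / 10) * a) - b\<^sup>2 - (real d + 1) * (2 * b\<^sup>2)"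
      using s t by linarith
    also have "(real d + 1) * (2 * b) - 2 * b * ((d + 8 / 10) * a) - b\<^sup>2 - (real d + 1) * (2 * b\<^sup>2)
        = b * (4 / 10 - 14 / 10 * b)"
      by (simp add: a_def field_simps power2_eq_square)
    also have "\<dots> \<ge> 0" using b b_le by simp
    finally show ?thesis by (simp add: zero_le_mult_iff)
  qed
  moreover have "(1 - 2 * b) ^ (d - 1) * (1 + (real d - 1) * (2 * b)) < (real d - 1) / (2 * real d) * (2 * b * root d (2 * b))"
  proof -
    \<comment> \<open>Sharpens \<open>(1 - y) ^ k \<le> 1\<close> to
      \<open>(1 - y) ^ k \<le> 1 / (1 + k * y)\<close>.\<close>
    have "1 + k * y \<le> (1 + y) ^ k" using y Bernoulli_inequality[of y k] by simp
    then have "(1 - y) ^ k * (1 + k * y) \<le> (1 - y) ^ k * (1 + y) ^ k" using y by (intro mult_left_mono) auto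
    also have "\<dots> = (1 - y\<^sup>2) ^ k" by (simp add: power_mult_distrib[symmetric] power2_eq_square algebra_simps)
    also have "\<dots> \<le> 1" using y by (intro power_le_one) (auto simp: power_le_one)
    finally have yk: "(1 - y) ^ k * (1 + k * y) \<le> 1" .
    have pos: "0 < 1 + k * y" using y by (simp add: add_pos_nonneg)
    have ak: "(a\<^sup>2) ^ k * a\<^sup>2 = b\<^sup>2"
    proof -
      have "(a\<^sup>2) ^ k * a\<^sup>2 = (a ^ d)\<^sup>2"
        unfolding k(1) by (simp add: power_mult_distrib power_mult[symmetric] mult.commute)
      then show ?thesis using b by simp
    qed
    have M: "k * b\<^sup>2 \<le> 33 / 100" 
      using N mult_right_mono[of "real k" "real d" "b\<^sup>2"] k by simp
    have a3: "605 / 1000 < a ^ 3"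
    proof -
      have "(846 / 1000) ^ 3 \<le> a ^ 3" using a by (intro power_mono) auto
      then show ?thesis by (simp add: power3_eq_cube)
    qed
    have "b * (1 + 2 * k * b) < 13 / 14 * a ^ 3 * (1 + k * y)"
    proof -
      have "a ^ 3 * (k * y) = a * (k * b\<^sup>2)" using a by (simp add: y_def power2_eq_square power3_eq_cube field_simps)
      moreover have "846 / 1000 * (k * b\<^sup>2) \<le> a * (k * b\<^sup>2)" using a by (intro mult_right_mono) auto
      moreover have "b + 2 * M < 13 / 14 * (T + A)" if "846 / 1000 * M \<le> A" "M \<le> 33 / 100" "605 / 1000 < T" for M A T
        using that b_le by (simp add: field_simps)
      moreover have "b * (1 + 2 * k * b) = b + 2 * (k * b\<^sup>2)" by (simp add: algebra_simps power2_eq_square)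
      moreover have "13 / 14 * a ^ 3 * (1 + k * y) = 13 / 14 * (a ^ 3 + a ^ 3 * (k * y))" by (simp add: algebra_simps)
      ultimately show ?thesis using M a3 by metis
    qed
    then have "b * (1 + 2 * k * b) * b < 13 / 14 * a ^ 3 * (1 + k * y) * b" using b by (intro mult_strict_right_mono) auto
    moreover have e: "(1 - 2 * b) ^ k * (1 + k * y) * a\<^sup>2 = b\<^sup>2 * ((1 - y) ^ k * (1 + k * y))"
      unfolding a2 power_mult_distrib ak[symmetric] by simp
    have "(1 - 2 * b) ^ k * (1 + k * y) * a\<^sup>2 \<le> b\<^sup>2"
      unfolding e using mult_left_mono[OF yk, of "b\<^sup>2"] by simp
    then have "(1 - 2 * b) ^ k * (1 + k * y) * a\<^sup>2 * (1 + 2 * k * b) \<le> b\<^sup>2 * (1 + 2 * k * b)"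
      using b by (intro mult_right_mono) auto
    ultimately have "((1 - 2 * b) ^ k * (1 + 2 * k * b)) * ((1 + k * y) * a\<^sup>2) < (13 / 14 * (b * a)) * ((1 + k * y) * a\<^sup>2)"
      by (simp add: power2_eq_square power3_eq_cube algebra_simps)
    then have "(1 - 2 * b) ^ k * (1 + 2 * k * b) < 13 / 14 * (b * a)"
      using pos a by (subst (asm) mult_less_cancel_right_pos) auto
    also have "\<dots> \<le> (real d - 1) / d * (b * root d (2 * b))"
    proof (intro mult_mono)
      have "root d b \<le> root d (2 * b)" using b d by (subst real_root_le_iff) auto
      then show "a \<le> root d (2 * b)" using b by simp
      show "13 / 14 \<le> (real d - 1) / d" using d by (simp add: field_simps)
    qed (use b a d in auto)
    also have "(real d - 1) / d * (b * root d (2 * b)) = (real d - 1) / (2 * real d) * (2 * b * root d (2 * b))"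
      by simp
    finally have m: "(1 - 2 * b) ^ k * (1 + 2 * k * b) < (real d - 1) / (2 * real d) * (2 * b * root d (2 * b))" .
    have e: "1 + 2 * k * b = 1 + (real d - 1) * (2 * b)" using k(2) by simp
    show ?thesis using m unfolding e by (simp only: k_def[symmetric])
  qed
  ultimately show ?thesis
    using b b_le by (intro exI[of _ "2 * b"]) (auto simp: b_def)
qed

text \<open>The numbers \<open>l\<close> and \<open>u\<close> enclose \<open>root d z\<close>:
  \<open>u\<close> serves the sign of \<open>hfun\<close>, \<open>l\<close> the test of
  \<open>Efun_pos\<close>. For rational data everything is then decided by arithmetic.\<close>

lemma separating_point_at:
  fixes z l u :: real
  assumes d: "2 \<le> d" and z: "0 < z" "z < 1" and l: "0 \<le> l" "l ^ d \<le> z" and u: "0 \<le> u" "z \<le> u ^ d"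
    and 1: "(1 - z) ^ d \<le> z"
    and 2: "real d * z * u + (1 - z) ^ (d + 1) + (real d + 1) * z\<^sup>2 / 2 \<le> (real d + 1) * z"
    and 3: "(1 - z) ^ (d - 1) * (1 + (real d - 1) * z) < (real d - 1) / (2 * real d) * (z * l)"
  shows "\<exists>z. beta d \<le> z \<and> z < 1 \<and> 0 \<le> hfun d z \<and>
    (1 - z) ^ (d - 1) * (1 + (real d - 1) * z) < (real d - 1) / (2 * real d) * (z * root d z)"
proof (intro exI[of _ z] conjI z(2))
  have "root d (l ^ d) \<le> root d z" "root d z \<le> root d (u ^ d)" using l u d by auto
  then have r: "l \<le> root d z" "root d z \<le> u" using l u d by (simp_all add: real_root_power_cancel)
  show "beta d \<le> z" using 1 z d by (subst beta_le_iff) auto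
  have "real d * z * root d z \<le> real d * z * u" using r z by (intro mult_left_mono) auto
  moreover have "(real d + 1) * hfun d z = (real d + 1) * rfun d z - (real d + 1) * z\<^sup>2 / 2"
    by (simp add: hfun_def algebra_simps)
  moreover have "(real d + 1) * rfun d z = (real d + 1) * z - real d * z * root d z - (1 - z) ^ (d + 1)"
    using z d by (subst rfun_root) auto
  ultimately have "0 \<le> (real d + 1) * hfun d z" using 2 by linarith
  then show "0 \<le> hfun d z" by (simp add: zero_le_mult_iff)
  note 3
  also have "(real d - 1) / (2 * real d) * (z * l) \<le> (real d - 1) / (2 * real d) * (z * root d z)"
    using r z d by (intro mult_left_mono) auto
  finally show "(1 - z) ^ (d - 1) * (1 + (real d - 1) * z) < (real d - 1) / (2 * real d) * (z * root d z)" .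
qed

text \<open>\<open>z\<close> certifies both sides: by \<open>Efun_pos\<close> there is no critical
  point of \<open>g\<close> in \<open>[z, 1)\<close>, and \<open>hfun d z \<ge> 0\<close> means that
  \<open>x_bal\<close> is not before \<open>z\<close>. For \<open>d \<le> 13\<close> the witnesses
  are rationals in this window together with enclosures of their roots.\<close>

lemma separating_point:
  assumes d: "4 \<le> d"
  shows "\<exists>z. beta d \<le> z \<and> z < 1 \<and> 0 \<le> hfun d z \<and>
    (1 - z) ^ (d - 1) * (1 + (real d - 1) * z) < (real d - 1) / (2 * real d) * (z * root d z)"
proof -
  have "d = 4 \<or> d = 5 \<or> d = 6 \<or> d = 7 \<or> d = 8 \<or> d = 9 \<or> d = 10 \<or> d = 11 \<or> d = 12 \<or> d = 13 \<or> 14 \<le> d"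
    using d by presburger
  then consider "d = 4" | "d = 5" | "d = 6" | "d = 7" | "d = 8" | "d = 9" | "d = 10" | "d = 11"
    | "d = 12" | "d = 13" | "14 \<le> d" by blast
  then show ?thesis
  proof cases
    case 1 then show ?thesis
      by (intro separating_point_at[of d "10/17" "148/169" "50/57"]) (simp_all add: power_divide)
  next
    case 2 then show ?thesis
      by (intro separating_point_at[of d "10/19" "3/4" "95/108"]) (simp_all add: power_divide)
  next
    case 3 then show ?thesis
      by (intro separating_point_at[of d "5/11" "6/7" "8/9"]) (simp_all add: power_divide)
  next
    case 4 then show ?thesis
      by (intro separating_point_at[of d "3/7" "3/4" "8/9"]) (simp_all add: power_divide)
  next
    case 5 then show ?thesis
      by (intro separating_point_at[of d "2/5" "2/3" "17/19"]) (simp_all add: power_divide)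
  next
    case 6 then show ?thesis
      by (intro separating_point_at[of d "3/8" "2/3" "9/10"]) (simp_all add: power_divide)
  next
    case 7 then show ?thesis
      by (intro separating_point_at[of d "1/3" "3/4" "9/10"]) (simp_all add: power_divide)
  next
    case 8 then show ?thesis
      by (intro separating_point_at[of d "1/3" "1/2" "29/32"]) (simp_all add: power_divide)
  next
    case 9 then show ?thesis
      by (intro separating_point_at[of d "2/7" "4/5" "10/11"]) (simp_all add: power_divide)
  next
    case 10 then show ?thesis
      by (intro separating_point_at[of d "2/7" "2/3" "10/11"]) (simp_all add: power_divide)
  next
    case 11 then show ?thesis by (rule separating_point_large)
  qed
qed

section \<open>The maximum of \<open>g\<close>\<close>

lemma gfun_eq:
  assumes "1 \<le> d" "beta d \<le> x" "x < 1"
  shows "gfun d x = 1 - (x - x\<^sup>2) / ((real d + 1) * rfun d x - x\<^sup>2)"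
  using D_pos[OF assms] by (simp add: gfun_def field_simps)

lemma DERIV_gfun:
  assumes "1 \<le> d" "beta d \<le> x" "x < 1"
  shows "((\<lambda>x. 1 - (x - x\<^sup>2) / ((real d + 1) * rfun d x - x\<^sup>2)) has_real_derivative
    - (Efun d x / ((real d + 1) * rfun d x - x\<^sup>2)\<^sup>2)) (at x)"
proof -
  let ?D = "\<lambda>x. (real d + 1) * rfun d x - x\<^sup>2"
  have x: "0 < x" using beta[OF assms(1)] assms by linarith
  have D: "?D x \<noteq> 0" using D_pos[OF assms] by simp
  have dD: "(?D has_real_derivative (real d + 1) * rfun' d x - 2 * x) (at x)"
    using x assms by (auto intro!: derivative_eq_intros DERIV_rfun)
  have dn: "((\<lambda>x. x - x\<^sup>2) has_real_derivative 1 - 2 * x) (at x)"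
    by (auto intro!: derivative_eq_intros)
  have "((\<lambda>x. 1 - (x - x\<^sup>2) / ?D x) has_real_derivative
      0 - ((1 - 2 * x) * ?D x - (x - x\<^sup>2) * ((real d + 1) * rfun' d x - 2 * x)) / (?D x * ?D x)) (at x)"
    by (intro DERIV_diff DERIV_const DERIV_divide dn dD D)
  then show ?thesis
    using Efun_eq[of d x] assms x by (simp add: power2_eq_square)
qed

lemma gfun_pos:
  assumes d: "1 \<le> d" and x: "beta d < x" "x < 1"
  shows "0 < gfun d x"
proof -
  have x0: "0 < x" using beta[OF d] x by linarith
  have D: "0 < (real d + 1) * rfun d x - x\<^sup>2" using D_pos[of d x] d x by simp
  have "(1 - x) ^ d \<le> (1 - beta d) ^ d" using x by (intro power_mono) auto
  then have "(1 - x) ^ d < x" using beta[OF d] x by linarith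
  then have "(1 - x) * (1 - x) ^ d < (1 - x) * x" using x by (intro mult_strict_left_mono) auto
  also have "\<dots> \<le> x * (d * (1 - root d x))"
    using bernoulli_root[of d x] d x x0 by (subst mult.commute, intro mult_left_mono) auto
  finally have "x - x\<^sup>2 < (real d + 1) * rfun d x - x\<^sup>2"
    using d x0 by (subst D_eq) (auto simp: algebra_simps power2_eq_square)
  then show ?thesis using D d x by (subst gfun_eq) auto
qed

lemma gfun_1: "gfun d 1 = 0" if "1 \<le> d"
  using that by (simp add: gfun_def rfun_1)

text \<open>Continuity of \<open>gfun\<close> breaks at \<open>1\<close>, so compactness is used on
  \<open>[\<beta>, z]\<close> only. On \<open>[z, 1)\<close> positivity of \<open>Efun\<close> makes
  \<open>g\<close> decrease, and the value \<open>0\<close> at \<open>1\<close> does not exceed the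
  maximum over \<open>[\<beta>, z]\<close>.\<close>

lemma is_arg_max_gfun_exists:
  assumes d: "4 \<le> d"
  shows "\<exists>x. is_arg_max (gfun d) (\<lambda>x. x \<in> {beta d..1}) x"
proof -
  let ?g = "\<lambda>x. 1 - (x - x\<^sup>2) / ((real d + 1) * rfun d x - x\<^sup>2)"
  obtain z where z: "beta d \<le> z" "z < 1"
    and *: "(1 - z) ^ (d - 1) * (1 + (real d - 1) * z) < (real d - 1) / (2 * real d) * (z * root d z)"
    using separating_point[OF d] by blast
  have b: "0 < beta d" "beta d < 1" using beta[of d] d by auto
  have cont: "continuous_on {beta d..z} ?g"
    using z d by (intro continuous_at_imp_continuous_on ballI DERIV_isCont[OF DERIV_gfun]) auto
  obtain x where x: "x \<in> {beta d..z}" "\<And>y. y \<in> {beta d..z} \<Longrightarrow> ?g y \<le> ?g x"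
    using continuous_attains_sup[OF compact_Icc _ cont] z by auto
  have "gfun d y \<le> gfun d x" if y: "y \<in> {beta d..1}" for y
  proof -
    have gx: "gfun d x = ?g x" using x z d by (intro gfun_eq) auto
    consider "y \<le> z" | "z < y" "y < 1" | "y = 1" using y by fastforce
    then show ?thesis
    proof cases
      case 1
      then have "gfun d y = ?g y" using y z d by (intro gfun_eq) auto
      then show ?thesis using gx x(2)[of y] 1 y by simp
    next
      case 2
      have "?g y \<le> ?g z"
      proof (rule DERIV_nonpos_imp_nonincreasing[of z y])
        fix t assume t: "z \<le> t" "t \<le> y"
        have "0 < Efun d t" using z t 2 b d * by (intro Efun_pos[of d z]) auto
        then show "\<exists>l. (?g has_real_derivative l) (at t) \<and> l \<le> 0"
          using DERIV_gfun[of d t] z t 2 d by (intro exI conjI) auto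
      qed (use 2 in auto)
      also have "?g z \<le> ?g x" using x(2)[of z] z by simp
      finally show ?thesis using gx gfun_eq[of d y] y 2 d by simp
    next
      case 3
      define m where "m = (beta d + z) / 2"
      consider "z = beta d" | "beta d < z" using z by linarith
      then show ?thesis
      proof cases
        case 1
        have "0 \<le> gfun d (beta d)"
        proof -
          have "(real d + 1) * (beta d)\<^sup>2 - beta d \<ge> 0"
          proof -
            have "1 + real d * (- beta d) \<le> (1 + (- beta d)) ^ d"
              using b by (intro Bernoulli_inequality) auto
            then have "1 \<le> (real d + 1) * beta d" using beta(3)[of d] d by (simp add: algebra_simps)
            then have "1 * beta d \<le> (real d + 1) * beta d * beta d" using b by (intro mult_right_mono) auto
            then show ?thesis by (simp add: power2_eq_square mult.assoc)
          qed
          then show ?thesis using d D_pos[of d "beta d"] b by (simp add: gfun_def rfun_beta)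
        qed
        then show ?thesis using 3 gfun_1[of d] d x 1 by simp
      next
        case 2
        then have "0 < ?g z" using gfun_pos[of d z] gfun_eq[of d z] z d by simp
        then show ?thesis using 3 gfun_1[of d] d gx x(2)[of z] z by simp
      qed
    qed
  qed
  then show ?thesis using x z by (intro exI[of _ x]) (auto simp: is_arg_max_linorder)
qed

lemma Efun_beta_neg:
  assumes "1 \<le> d"
  shows "Efun d (beta d) < 0"
proof -
  let ?b = "beta d"
  have "Efun d ?b = - (?b\<^sup>2 * (d * ?b + d * (1 - ?b)))"
    using beta[OF assms] by (simp add: Efun_def root_beta[OF assms] algebra_simps power2_eq_square)
  also have "\<dots> < 0" using beta[OF assms] assms by (simp add: algebra_simps)
  finally show ?thesis .
qed

text \<open>The slope at \<beta> is positive and \<open>gfun d 1 = 0\<close>, so the maximum is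
  interior and \<open>Efun\<close> vanishes there. Hence it lies at or before the separating point,
  up to which \<open>hfun\<close> is nonnegative by concavity.\<close>

lemma x_bst:
  assumes d: "4 \<le> d"
  shows "beta d \<le> x_bst d" "x_bst d < 1" "Efun d (x_bst d) = 0" "0 \<le> hfun d (x_bst d)"
    "0 < gfun d (x_bst d)"
proof -
  let ?g = "\<lambda>x. 1 - (x - x\<^sup>2) / ((real d + 1) * rfun d x - x\<^sup>2)"
  define x where "x = x_bst d"
  have d1: "1 \<le> d" using d by simp
  have b: "0 < beta d" "beta d < 1" using beta[OF d1] by auto
  have "is_arg_max (gfun d) (\<lambda>x. x \<in> {beta d..1}) x"
    using someI_ex[OF is_arg_max_gfun_exists[OF d]] by (simp add: x_def x_bst_def arg_max_on_def arg_max_def)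
  then have x: "beta d \<le> x" "x \<le> 1" and max: "\<And>y. beta d \<le> y \<Longrightarrow> y \<le> 1 \<Longrightarrow> gfun d y \<le> gfun d x"
    by (auto simp: is_arg_max_linorder)
  have "0 < gfun d ((beta d + 1) / 2)" using b d by (intro gfun_pos) auto
  then have pos: "0 < gfun d x" using max[of "(beta d + 1) / 2"] b by simp
  then have "x \<noteq> 1" using gfun_1[OF d1] by auto
  then have x1: "x < 1" using x by simp
  have gx: "gfun d x = ?g x" using gfun_eq[OF d1 x(1) x1] .
  have "x \<noteq> beta d"
  proof
    assume xb: "x = beta d"
    have "0 < - (Efun d x / ((real d + 1) * rfun d x - x\<^sup>2)\<^sup>2)"
      using Efun_beta_neg[OF d1] D_pos[OF d1 x(1) x1] xb by (simp add: divide_neg_pos)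
    from DERIV_pos_inc_right[OF DERIV_gfun[OF d1 x(1) x1] this]
    obtain e where e: "0 < e" "\<And>h. 0 < h \<Longrightarrow> h < e \<Longrightarrow> ?g x < ?g (x + h)" by blast
    define h where "h = min (e / 2) ((1 - x) / 2)"
    have h: "0 < h" "h < e" "x + h < 1" using e x1 by (auto simp: h_def min_def field_simps)
    then have "gfun d x < gfun d (x + h)"
      using e(2)[of h] gx gfun_eq[of d "x + h"] x d1 by simp
    then show False using max[of "x + h"] h x by simp
  qed
  then have bx: "beta d < x" using x by simp
  have "- (Efun d x / ((real d + 1) * rfun d x - x\<^sup>2)\<^sup>2) = 0"
  proof (rule DERIV_local_max[OF DERIV_gfun[OF d1 x(1) x1]])
    show "0 < min (x - beta d) (1 - x)" using bx x1 by simp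
    show "\<forall>y. \<bar>x - y\<bar> < min (x - beta d) (1 - x) \<longrightarrow> ?g y \<le> ?g x"
    proof (intro allI impI)
      fix y assume "\<bar>x - y\<bar> < min (x - beta d) (1 - x)"
      then have y: "beta d \<le> y" "y < 1" by linarith+
      show "?g y \<le> ?g x" using max[of y] y gfun_eq[OF d1 y] gx by simp
    qed
  qed
  then have E: "Efun d x = 0" using D_pos[OF d1 x(1) x1] by simp
  obtain z where z: "beta d \<le> z" "z < 1" "0 \<le> hfun d z"
    and *: "(1 - z) ^ (d - 1) * (1 + (real d - 1) * z) < (real d - 1) / (2 * real d) * (z * root d z)"
    using separating_point[OF d] by blast
  have "x \<le> z"
  proof (rule ccontr)
    assume "\<not> x \<le> z"
    then have "0 < Efun d x" using z b x1 d * by (intro Efun_pos[of d z]) auto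
    then show False using E by simp
  qed
  then have "0 \<le> hfun d x" using hfun_between[OF d1 x(1), of z] z by simp
  then show "beta d \<le> x_bst d" "x_bst d < 1" "Efun d (x_bst d) = 0" "0 \<le> hfun d (x_bst d)"
    "0 < gfun d (x_bst d)"
    using x x1 E pos by (simp_all add: x_def)
qed

section \<open>Dual multipliers at \<open>x_bst\<close> and \<open>x_bal\<close>\<close>

text \<open>With \<open>t = 1 - g(x)\<close>, take \<open>\<kappa> = (d + 1) * t\<close> and
  \<open>G = 1 - t\<close>, which is equality at \<open>(1, 1)\<close>. The definition of
  \<open>t\<close> is then equality at \<open>(x, x)\<close>, and \<open>Efun d x = 0\<close> is
  stationarity; \<open>g(x) > 0\<close> keeps \<open>G\<close> nonnegative.\<close>

lemma multipliers_bst: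
  assumes d: "4 \<le> d" and x: "x = x_bst d"
  shows "\<exists>\<kappa> G. 0 \<le> \<kappa> \<and> 0 \<le> G \<and> \<kappa> * rfun d x + G * x\<^sup>2 = x \<and> \<kappa> * rfun' d x + 2 * G * x = 1 \<and>
    \<kappa> / (real d + 1) + G \<le> 1 \<and> \<kappa> + 2 * G = c_bst d"
proof -
  let ?D = "(real d + 1) * rfun d x - x\<^sup>2"
  define t where "t = (x - x\<^sup>2) / ?D"
  have d1: "1 \<le> d" using d by simp
  have b: "beta d \<le> x" "x < 1" "Efun d x = 0" "0 < gfun d x" using x_bst[OF d] x by auto
  have x0: "0 < x" using beta[OF d1] b by linarith
  have D: "0 < ?D" using D_pos[OF d1 b(1,2)] .
  have tD: "t * ?D = x - x\<^sup>2" using D by (simp add: t_def)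
  have t1: "t \<le> 1" using b gfun_eq[OF d1 b(1,2)] by (simp add: t_def)
  have t0: "0 \<le> t" using D x0 b by (simp add: t_def power2_eq_square mult_left_le)
  have "(1 - 2 * x) * ?D = (x - x\<^sup>2) * ((real d + 1) * rfun' d x - 2 * x)"
    using Efun_eq[of d x] b d x0 by simp
  also have "\<dots> = t * ((real d + 1) * rfun' d x - 2 * x) * ?D" unfolding tD[symmetric] by simp
  finally have crit: "1 - 2 * x = t * ((real d + 1) * rfun' d x - 2 * x)" using D by simp
  show ?thesis
  proof (rule exI[of _ "(real d + 1) * t"], rule exI[of _ "1 - t"], intro conjI)
    show "(real d + 1) * t * rfun d x + (1 - t) * x\<^sup>2 = x" using tD by (simp add: algebra_simps)
    show "(real d + 1) * t * rfun' d x + 2 * (1 - t) * x = 1" using crit by (simp add: algebra_simps)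
    have "(real d + 1) * t / (real d + 1) = t" by (rule nonzero_mult_div_cancel_left) linarith
    then show "(real d + 1) * t / (real d + 1) + (1 - t) \<le> 1" by simp
    have "c_bst d = 2 + (real d - 1) * t" by (simp add: c_bst_def t_def x)
    then show "(real d + 1) * t + 2 * (1 - t) = c_bst d" by (simp add: algebra_simps)
  qed (use t0 t1 in auto)
qed

text \<open>For \<open>r(x) = x ^ 2 / 2\<close> the two equations give
  \<open>\<kappa> * (x - rfun' d x) = 1\<close> and \<open>G = 1 / x - \<kappa> / 2\<close>. The
  hypothesis \<open>r'\<close> amounts to \<open>\<kappa> * x \<le> 2\<close>, that is
  \<open>G \<ge> 0\<close>. The hypothesis \<open>*\<close> is the inequality at
  \<open>(1, 1)\<close> after \<open>root d x\<close> has been eliminated by means of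
  \<open>r(x) = x ^ 2 / 2\<close>.\<close>

lemma multipliers_bal:
  assumes d: "2 \<le> d" and x: "x = x_bal d"
    and r': "rfun' d x \<le> x / 2"
    and *: "x * (1 - x / 2 - x / (real d + 1) - (real d - 1) * x\<^sup>2 / 2) \<le> (1 - x) ^ (d + 1) * (1 + (real d - 1) * x)"
  shows "\<exists>\<kappa> G. 0 \<le> \<kappa> \<and> 0 \<le> G \<and> \<kappa> * rfun d x + G * x\<^sup>2 = x \<and> \<kappa> * rfun' d x + 2 * G * x = 1 \<and>
    \<kappa> / (real d + 1) + G \<le> 1 \<and> \<kappa> + 2 * G = c_bal d"
proof -
  have b: "beta d \<le> x" "x < 1" "rfun d x = x\<^sup>2 / 2" using x_bal[OF d] x by auto
  have x0: "0 < x" using beta[of d] d b by linarith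
  define \<kappa> where "\<kappa> = 1 / (x - rfun' d x)"
  have gap: "0 < x - rfun' d x" using r' x0 by linarith
  have k0: "0 \<le> \<kappa>" using gap by (simp add: \<kappa>_def)
  have k: "\<kappa> * (x - rfun' d x) = 1" using gap by (simp add: \<kappa>_def)
  have "\<kappa> * x \<le> 2"
  proof -
    have "\<kappa> * (x / 2) \<le> \<kappa> * (x - rfun' d x)" using k0 r' by (intro mult_left_mono) auto
    then show ?thesis using k by simp
  qed
  then have G0: "0 \<le> 1 / x - \<kappa> / 2" using x0 by (simp add: field_simps)
  show ?thesis
  proof (rule exI[of _ \<kappa>], rule exI[of _ "1 / x - \<kappa> / 2"], intro conjI)
    show "\<kappa> * rfun d x + (1 / x - \<kappa> / 2) * x\<^sup>2 = x"
      using x0 by (simp add: b(3) field_simps power2_eq_square)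
    show "\<kappa> * rfun' d x + 2 * (1 / x - \<kappa> / 2) * x = 1"
      using k x0 by (simp add: field_simps)
    show "\<kappa> + 2 * (1 / x - \<kappa> / 2) = c_bal d"
      using x0 by (simp add: c_bal_def x[symmetric] b(3) power2_eq_square)
    show "\<kappa> / (real d + 1) + (1 / x - \<kappa> / 2) \<le> 1"
    proof -
      let ?v = "(1 - x) ^ d" and ?c = "1 + (real d - 1) * x"
      have c: "0 < ?c" using d x0 by (simp add: add_pos_nonneg)
      have "(real d + 1) * (x\<^sup>2 / 2) = (real d + 1) * x - real d * x * root d x - (1 - x) * ?v"
        using rfun_root[of d x] b d x0 by simp
      then have s: "d * x * root d x = (real d + 1) * (x - x\<^sup>2 / 2) - (1 - x) * ?v"
        by (simp add: algebra_simps)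
      have "d * x * (x - rfun' d x) = d * x\<^sup>2 - d * x + d * x * root d x - d * x * ?v"
        by (simp add: rfun'_def algebra_simps power2_eq_square)
      then have g: "d * x * (x - rfun' d x) = x + (real d - 1) * x\<^sup>2 / 2 - ?c * ?v"
        unfolding s by (simp add: field_simps power2_eq_square)
      have "2 * (real d + 1) * (1 - x) * (d * x * (x - rfun' d x)) =
          2 * (real d + 1) * (x * (1 - x / 2 - x / (real d + 1) - (real d - 1) * x\<^sup>2 / 2) - (1 - x) ^ (d + 1) * ?c)
          + d * x * ((real d - 1) * x)"
      proof -
        have e: "(real d + 1) * (x / (real d + 1)) = x" by simp
        have gen: "2 * (real d + 1) * (x * (1 - x / 2 - E - (real d - 1) * x\<^sup>2 / 2) - V)
            = 2 * (real d + 1) * (x - x\<^sup>2 / 2 - (real d - 1) * x ^ 3 / 2 - V) - 2 * x * ((real d + 1) * E)" for E V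
          by (simp add: algebra_simps power2_eq_square power3_eq_cube)
        show ?thesis
          unfolding gen e g by (simp add: field_simps power2_eq_square power3_eq_cube)
      qed
      also have "\<dots> \<le> d * x * ((real d - 1) * x)"
        using * by (simp add: mult_le_0_iff)
      finally have "d * x * (2 * (real d + 1) * (1 - x) * (x - rfun' d x)) \<le> d * x * ((real d - 1) * x)"
        by (simp add: algebra_simps)
      then have "2 * (real d + 1) * (1 - x) * (x - rfun' d x) \<le> (real d - 1) * x"
        using d x0 by (simp add: mult_le_cancel_left_pos)
      then have "\<kappa> * (2 * (real d + 1) * (1 - x) * (x - rfun' d x)) \<le> \<kappa> * ((real d - 1) * x)"
        using k0 by (intro mult_left_mono)
      then have main: "2 * (real d + 1) * (1 - x) * (\<kappa> * (x - rfun' d x)) \<le> \<kappa> * (real d - 1) * x"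
        by (simp add: algebra_simps)
      have "2 * x * (real d + 1) * (\<kappa> / (real d + 1) + (1 / x - \<kappa> / 2) - 1)
          = 2 * (real d + 1) * (1 - x) - \<kappa> * (real d - 1) * x"
      proof -
        have "(real d + 1) * (\<kappa> / (real d + 1)) = \<kappa>" "x * (1 / x) = 1" using x0 by auto
        moreover have "2 * x * (real d + 1) * (A + (B - \<kappa> / 2) - 1)
            = 2 * x * ((real d + 1) * A) + 2 * (real d + 1) * (x * B) - x * (real d + 1) * \<kappa> - 2 * x * (real d + 1)" for A B
          by (simp add: algebra_simps)
        ultimately show ?thesis by (simp only:) (simp add: algebra_simps)
      qed
      also have "\<dots> \<le> 0" using main k by simp
      finally show ?thesis using x0 by (simp add: mult_le_0_iff zero_le_mult_iff)
    qed
  qed (use k0 G0 in auto)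
qed


text \<open>\<open>hfun\<close> is positive at 8/10, so \<open>x_bal\<close> lies beyond. In the
  shifted variable \<open>y = x - 8 / 10\<close> the polynomial inequality has positive constant and
  linear terms and a remainder of visible sign.\<close>

lemma multipliers_2:
  assumes "x = x_bal 2"
  shows "rfun' 2 x \<le> x / 2"
    "x * (1 - x / 2 - x / (real 2 + 1) - (real 2 - 1) * x\<^sup>2 / 2) \<le> (1 - x) ^ (2 + 1) * (1 + (real 2 - 1) * x)"
proof -
  have "root 2 (8 / 10) \<le> root 2 ((8945 / 10000)\<^sup>2)" by (subst real_root_le_iff) (auto simp: power2_eq_square)
  then have s: "root 2 (8 / 10) \<le> 8945 / 10000" by (simp add: real_root_power_cancel)
  have "3 * rfun 2 (8 / 10) = 3 * (8 / 10) - 2 * (8 / 10) * root 2 (8 / 10) - (1 - 8 / 10) ^ 3"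
    using rfun_root[of 2 "8 / 10"] by (simp add: numeral_eq_Suc)
  then have "0 < hfun 2 (8 / 10)" using s by (simp add: hfun_def power2_eq_square power3_eq_cube)
  then have x: "8 / 10 < x" 
  proof -
    have "beta 2 \<le> 8 / 10" by (subst beta_le_iff) (auto simp: power2_eq_square)
    then show ?thesis using \<open>0 < hfun 2 (8 / 10)\<close> unfolding assms by (intro x_bal_ge) auto
  qed
  have x1: "x < 1" using x_bal[of 2] assms by simp
  have "root 2 ((8 / 10)\<^sup>2) \<le> root 2 x" using x by (subst real_root_le_iff) (auto simp: power2_eq_square)
  then have "8 / 10 \<le> root 2 x" by (simp add: real_root_power_cancel)
  moreover have "(1 - x)\<^sup>2 \<le> (2 / 10)\<^sup>2" using x x1 by (intro power_mono) auto
  ultimately show "rfun' 2 x \<le> x / 2" using x by (simp add: rfun'_def power2_eq_square)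
  define y where "y = x - 8 / 10"
  have y: "0 \<le> y" "y \<le> 1" "x = 8 / 10 + y" using x x1 by (auto simp: y_def)
  have "(1 - x) ^ 3 * (1 + x) - x * (1 - x / 2 - x / 3 - x\<^sup>2 / 2)
      = 7 / 1875 + 407 / 375 * y + y\<^sup>2 * (449 / 150 - 7 / 10 * y - 1 / 1 * y\<^sup>2)"
    unfolding y(3) by (simp add: eval_nat_numeral field_simps)
  moreover have "y\<^sup>2 \<le> 1" using y by (simp add: power_le_one)
  then have "0 \<le> y\<^sup>2 * (449 / 150 - 7 / 10 * y - 1 / 1 * y\<^sup>2)"
    using y by (intro mult_nonneg_nonneg) auto
  ultimately have "x * (1 - x / 2 - x / 3 - x\<^sup>2 / 2) \<le> (1 - x) ^ 3 * (1 + x)"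
    using y(1) by linarith
  then show "x * (1 - x / 2 - x / (real 2 + 1) - (real 2 - 1) * x\<^sup>2 / 2) \<le> (1 - x) ^ (2 + 1) * (1 + (real 2 - 1) * x)"
    by simp
qed

text \<open>The same method with 675/1000. At this point the polynomial difference is only
  24767/51200000, so \<open>x_bal\<close> must be bounded from below quite precisely.\<close>

lemma multipliers_3:
  assumes "x = x_bal 3"
  shows "rfun' 3 x \<le> x / 2"
    "x * (1 - x / 2 - x / (real 3 + 1) - (real 3 - 1) * x\<^sup>2 / 2) \<le> (1 - x) ^ (3 + 1) * (1 + (real 3 - 1) * x)"
proof -
  let ?z = "675 / 1000 :: real"
  have "root 3 ?z \<le> root 3 ((8775 / 10000) ^ 3)" by (subst real_root_le_iff) (auto simp: power3_eq_cube)
  then have s: "root 3 ?z \<le> 8775 / 10000" by (simp add: real_root_power_cancel)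
  have "4 * rfun 3 ?z = 4 * ?z - 3 * ?z * root 3 ?z - (1 - ?z) ^ 4"
    using rfun_root[of 3 ?z] by (simp add: numeral_eq_Suc)
  then have "0 < hfun 3 ?z" using s by (simp add: hfun_def power2_eq_square power4_eq_xxxx)
  then have x: "?z < x" 
  proof -
    have "beta 3 \<le> ?z" by (subst beta_le_iff) (auto simp: power3_eq_cube)
    then show ?thesis using \<open>0 < hfun 3 ?z\<close> unfolding assms by (intro x_bal_ge) auto
  qed
  have x1: "x < 1" using x_bal[of 3] assms by simp
  have "root 3 ((85 / 100) ^ 3) \<le> root 3 x" using x by (subst real_root_le_iff) (auto simp: power3_eq_cube)
  then have "85 / 100 \<le> root 3 x" by (simp add: real_root_power_cancel)
  moreover have "(1 - x) ^ 3 \<le> (325 / 1000) ^ 3" using x x1 by (intro power_mono) auto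
  ultimately show "rfun' 3 x \<le> x / 2" using x by (simp add: rfun'_def power3_eq_cube)
  define y where "y = x - ?z"
  have y: "0 \<le> y" "y \<le> 1" "x = ?z + y" using x x1 by (auto simp: y_def)
  have "(1 - x) ^ 4 * (1 + 2 * x) - x * (1 - x / 2 - x / 4 - x\<^sup>2)
      = 24767 / 51200000 + 11049 / 10240 * y + y\<^sup>2 * (12767 / 3200 - 63 / 80 * y - 1 / 4 * y\<^sup>2) + 2 / 1 * y ^ 5"
    unfolding y(3) by (simp add: eval_nat_numeral field_simps)
  moreover have "y\<^sup>2 \<le> 1" using y by (simp add: power_le_one)
  then have "0 \<le> y\<^sup>2 * (12767 / 3200 - 63 / 80 * y - 1 / 4 * y\<^sup>2)"
    using y by (intro mult_nonneg_nonneg) auto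
  moreover have "0 \<le> y ^ 5" using y by simp
  ultimately have "x * (1 - x / 2 - x / 4 - x\<^sup>2) \<le> (1 - x) ^ 4 * (1 + 2 * x)"
    using y(1) by linarith
  then show "x * (1 - x / 2 - x / (real 3 + 1) - (real 3 - 1) * x\<^sup>2 / 2) \<le> (1 - x) ^ (3 + 1) * (1 + (real 3 - 1) * x)"
    by simp
qed

section \<open>The lower bound\<close>

text \<open>Double counting: demands and loads, which are given per pair or per element, become sums
  over the extensions.\<close>

lemma sum_weight_card:
  fixes w :: "'a \<Rightarrow> real"
  assumes "finite L" "finite T"
  shows "(\<Sum>M\<in>L. w M * card {p\<in>T. Q M p}) = (\<Sum>p\<in>T. \<Sum>M | M \<in> L \<and> Q M p. w M)"
proof -
  have "(\<Sum>M\<in>L. w M * card {p\<in>T. Q M p}) = (\<Sum>M\<in>L. \<Sum>p\<in>T. if Q M p then w M else 0)"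
    using assms by (intro sum.cong refl) (simp add: sum.If_cases Int_def mult.commute conj_commute)
  also have "\<dots> = (\<Sum>p\<in>T. \<Sum>M\<in>L. if Q M p then w M else 0)" by (rule sum.swap)
  also have "\<dots> = (\<Sum>p\<in>T. \<Sum>M | M \<in> L \<and> Q M p. w M)"
    by (rule sum.cong[OF refl], rule sum.inter_filter[symmetric], rule assms(1))
  finally show ?thesis .
qed

lemma ple_antisym: "M \<in> ple P \<Longrightarrow> (u, v) \<in> M \<Longrightarrow> (v, u) \<in> M \<Longrightarrow> u = v"
  unfolding ple_def order_on_defs mem_Collect_eq by (blast dest: antisymD)

lemma ple_trans:
  assumes "M \<in> ple P" "(u, v) \<in> M" "(v, t) \<in> M"
  shows "(u, t) \<in> M"
proof -
  have "trans M" using assms(1) unfolding ple_def order_on_defs by blast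
  then show ?thesis using assms(2,3) by (rule transD)
qed

lemma ple_total:
  assumes M: "M \<in> ple P" and u: "u \<in> Field M" and v: "v \<in> Field M"
  shows "(u, v) \<in> M \<or> (v, u) \<in> M"
proof -
  have "refl_on (Field M) M" "total_on (Field M) M"
    using M unfolding ple_def order_on_defs by blast+
  then show ?thesis using u v unfolding refl_on_def total_on_def by metis
qed

lemma ple_refl: "M \<in> ple P \<Longrightarrow> u \<in> Field M \<Longrightarrow> (u, u) \<in> M"
  using ple_total[of M P u u] by simp

text \<open>By antisymmetry the pairs of distinct elements that an extension contains are disjoint
  from their mirror images, and both lie in the square of its part of \<open>C\<close>; hence the
  factor \<open>2\<close>.\<close>

lemma antichain_pair_bound:
  assumes fin: "finite (Field P)" and w: "fractional_local_realizer P w"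
    and C: "C \<subseteq> Field P" and anti: "\<And>u v. u \<in> C \<Longrightarrow> v \<in> C \<Longrightarrow> u \<noteq> v \<Longrightarrow> (u, v) \<notin> P"
  shows "2 * (real (card C) * (real (card C) - 1)) \<le> (\<Sum>M\<in>ple P. w M * (real (card (C \<inter> Field M)))\<^sup>2)"
proof -
  have finC: "finite C" using C fin finite_subset by blast
  have finL: "finite (ple P)" using finite_ple[OF fin] .
  have w0: "\<And>M. M \<in> ple P \<Longrightarrow> 0 \<le> w M"
    using w by (auto simp: fractional_local_realizer_def local_weight_def)
  define T where "T = C \<times> C - (\<lambda>u. (u, u)) ` C"
  have finT: "finite T" using finC by (simp add: T_def)
  have cardT: "real (card T) = real (card C) * (real (card C) - 1)"
  proof -
    have "card T = card C * card C - card C"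
      unfolding T_def using finC by (subst card_Diff_subset) (auto simp: card_image inj_on_def)
    then show ?thesis by (cases "card C") (auto simp: algebra_simps)
  qed
  have "real (card T) \<le> (\<Sum>p\<in>T. \<Sum>M | M \<in> ple P \<and> p \<in> M. w M)"
  proof -
    have "1 \<le> (\<Sum>M | M \<in> ple P \<and> p \<in> M. w M)" if "p \<in> T" for p
    proof -
      obtain u v where "p = (u, v)" by (cases p)
      then have p: "p = (u, v)" "u \<in> C" "v \<in> C" "u \<noteq> v" using that by (auto simp: T_def)
      then have "(\<Sum>M | M \<in> ple P \<and> (u, v) \<in> M \<and> v \<noteq> u. w M) \<ge> 1"
        using w C anti unfolding fractional_local_realizer_def by blast
      then show ?thesis using p by simp
    qed
    then have "(\<Sum>p\<in>T. 1) \<le> (\<Sum>p\<in>T. \<Sum>M | M \<in> ple P \<and> p \<in> M. w M)" by (rule sum_mono)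
    then show ?thesis by simp
  qed
  also have "\<dots> = (\<Sum>M\<in>ple P. w M * card {p\<in>T. p \<in> M})"
    using sum_weight_card[OF finL finT, of w "\<lambda>M p. p \<in> M"] by simp
  finally have "2 * real (card T) \<le> 2 * (\<Sum>M\<in>ple P. w M * card {p\<in>T. p \<in> M})" by simp
  also have "\<dots> = (\<Sum>M\<in>ple P. w M * real (2 * card {p\<in>T. p \<in> M}))"
    by (simp add: sum_distrib_left mult_ac)
  also have "\<dots> \<le> (\<Sum>M\<in>ple P. w M * (real (card (C \<inter> Field M)))\<^sup>2)"
  proof (intro sum_mono mult_left_mono w0)
    fix M assume M: "M \<in> ple P"
    let ?A = "{p\<in>T. p \<in> M}" and ?F = "C \<inter> Field M"
    have "?A \<inter> prod.swap ` ?A = {}" using ple_antisym[OF M] by (auto simp: T_def)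
    moreover have "?A \<union> prod.swap ` ?A \<subseteq> ?F \<times> ?F" by (auto simp: T_def intro: FieldI1 FieldI2)
    moreover have "finite ?A" "finite ?F" using finT finC by auto
    moreover have "card (prod.swap ` ?A) = card ?A" by (intro card_image) auto
    ultimately have "card ?A + card ?A \<le> card (?F \<times> ?F)"
      by (metis (no_types, lifting) card_Un_disjoint card_mono finite_SigmaI finite_imageI)
    then have "2 * card ?A \<le> card ?F * card ?F" unfolding card_cartesian_product by linarith
    then have "real (2 * card ?A) \<le> real (card ?F * card ?F)" by (rule of_nat_mono)
    then show "real (2 * card ?A) \<le> (real (card ?F))\<^sup>2" by (simp add: power2_eq_square)
  qed
  finally show ?thesis by (simp add: cardT)
qed

text \<open>The division-free form of \<open>(m choose d) / (n choose d) \<le> (m / n) ^ d\<close>;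
  each new factor \<open>(m - d) / (n - d)\<close> is at most \<open>m / n\<close>.\<close>

lemma binomial_power_le:
  assumes "m \<le> n"
  shows "(m choose d) * n ^ d \<le> (n choose d) * m ^ d"
proof (induction d)
  case (Suc d)
  have *: "(k choose Suc d) * Suc d = (k choose d) * (k - d)" for k
    using binomial_absorption[of d k] binomial_absorb_comp[of k d] by (simp add: mult.commute)
  have "(m - d) * n \<le> m * (n - d)"
    using assms by (simp add: diff_mult_distrib diff_mult_distrib2) (metis diff_le_mono2 mult.commute mult_le_mono2)
  then have "(m choose d) * n ^ d * ((m - d) * n) \<le> (n choose d) * m ^ d * (m * (n - d))"
    using Suc.IH by (rule mult_le_mono[rotated])
  also have "(m choose d) * n ^ d * ((m - d) * n) = (m choose Suc d) * n ^ Suc d * Suc d"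
  proof -
    have "(m choose d) * n ^ d * ((m - d) * n) = n ^ d * n * ((m choose d) * (m - d))" by (simp only: mult_ac)
    then show ?thesis by (simp add: *[symmetric] mult_ac del: mult_Suc_right mult_Suc)
  qed
  also have "(n choose d) * m ^ d * (m * (n - d)) = (n choose Suc d) * m ^ Suc d * Suc d"
  proof -
    have "(n choose d) * m ^ d * (m * (n - d)) = m ^ d * m * ((n choose d) * (n - d))" by (simp only: mult_ac)
    then show ?thesis by (simp add: *[symmetric] mult_ac del: mult_Suc_right mult_Suc)
  qed
  finally show ?case by (simp only: mult_le_cancel2)
qed simp

text \<open>The sum takes the right endpoints of a decreasing integrand.\<close>

lemma sum_le_Rfun:
  fixes a n d :: nat
  assumes d: "0 < d" and n: "0 < n" and a: "a \<le> n" and y: "0 \<le> y" "y \<le> 1"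
  shows "(\<Sum>i=1..a. min y ((1 - real i / real n) ^ d)) \<le> n * Rfun d (a / n) y"
  using a
proof (induction a)
  case 0
  have "Rfun d 0 y = 0" using y d by (subst Rfun_le) auto
  then show ?case by simp
next
  case (Suc a)
  have "(Suc a / real n - a / real n) * min y ((1 - Suc a / real n) ^ d) \<le> Rfun d (Suc a / n) y - Rfun d (a / n) y"
    using Suc.prems n y d by (intro Rfun_increment) (auto simp: field_simps)
  moreover have "Suc a / real n - a / real n = 1 / n" by (simp add: diff_divide_distrib[symmetric])
  ultimately have "min y ((1 - Suc a / real n) ^ d) \<le> n * Rfun d (Suc a / n) y - n * Rfun d (a / n) y"
    using n by (simp add: field_simps)
  then show ?case using Suc by simp
qed

lemma up_count_le:
  assumes d: "2 \<le> d" "d \<le> n" and M: "M \<in> ple (subset_poset d n)"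
    and a: "a = card {x \<in> {1..n}. {x} \<in> Field M}"
    and b: "b = card {S. S \<subseteq> {1..n} \<and> card S = d \<and> S \<in> Field M}"
  shows "real (card {p \<in> Sigma {1..n} (\<lambda>x. {S. S \<subseteq> {1..n} - {x} \<and> card S = d}). (snd p, {fst p}) \<in> M})
    \<le> n * (n choose d) * Rfun d (a / n) (b / (n choose d))"
proof -
  let ?P = "subset_poset d n"
  let ?N = "n choose d"
  define X where "X = {x \<in> {1..n}. {x} \<in> Field M}"
  \<comment> \<open>\<open>up x\<close> contains \<open>x\<close>, so its size is the rank from the
    top and runs through \<open>1..a\<close>, as the right-endpoint sum requires.\<close>
  define up where "up x = {y \<in> X. ({x}, {y}) \<in> M}" for x
  define below where "below x = {S. S \<subseteq> {1..n} - {x} \<and> card S = d \<and> (S, {x}) \<in> M}" for x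
  have finX: "finite X" and aX: "card X = a" by (auto simp: X_def a)
  have N: "0 < ?N" using d by simp
  have b_le: "b \<le> ?N"
  proof -
    have "b \<le> card {S. S \<subseteq> {1..n} \<and> card S = d}" unfolding b by (intro card_mono) auto
    then show ?thesis by (simp add: n_subsets)
  qed
  have "{x \<in> {1..n}. {x} \<in> Field M} \<subseteq> {1..n}" by auto
  from card_mono[OF _ this] have a_le: "a \<le> n" unfolding a by simp
  have finup: "finite (up x)" for x using finX by (simp add: up_def)
  have finbelow: "finite (below x)" for x
    by (rule finite_subset[of _ "Pow {1..n}"]) (auto simp: below_def)
  have MP: "(u, v) \<in> M" if "u \<in> Field M" "v \<in> Field M" "(u, v) \<in> ?P" for u v
    using M that by (auto simp: ple_def)
  have mono_up: "up y \<subseteq> up x" if "({x}, {y}) \<in> M" for x y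
    using that ple_trans[OF M] by (auto simp: up_def)
  have inj: "inj_on (\<lambda>x. card (up x)) X"
  proof (rule inj_onI)
    have *: "x = y" if "x \<in> X" "y \<in> X" "card (up x) = card (up y)" "({x}, {y}) \<in> M" for x y
    proof -
      have "up y = up x" using mono_up[OF that(4)] finup that(3) by (intro card_subset_eq) auto
      moreover have "x \<in> up x" using that(1) ple_refl[OF M] by (auto simp: up_def X_def)
      ultimately have "({y}, {x}) \<in> M" by (auto simp: up_def)
      then show ?thesis using ple_antisym[OF M that(4)] by simp
    qed
    fix x y assume xy: "x \<in> X" "y \<in> X" "card (up x) = card (up y)"
    have "({x}, {y}) \<in> M \<or> ({y}, {x}) \<in> M" using xy ple_total[OF M] by (auto simp: X_def)
    then show "x = y" using *[of x y] *[of y x] xy by auto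
  qed
  have img: "(\<lambda>x. card (up x)) ` X = {1..a}"
  proof (rule card_subset_eq)
    show "(\<lambda>x. card (up x)) ` X \<subseteq> {1..a}"
    proof
      fix i assume "i \<in> (\<lambda>x. card (up x)) ` X"
      then obtain x where x: "x \<in> X" "i = card (up x)" by auto
      have "x \<in> up x" using x ple_refl[OF M] by (auto simp: up_def X_def)
      then have "0 < card (up x)" using finup card_gt_0_iff by blast
      moreover have "card (up x) \<le> card X" using finX by (intro card_mono) (auto simp: up_def)
      ultimately show "i \<in> {1..a}" using x aX by auto
    qed
    show "card ((\<lambda>x. card (up x)) ` X) = card {1..a}" using inj aX by (simp add: card_image)
  qed simp
  have below_le: "real (card (below x)) \<le> ?N * min (b / ?N) ((1 - card (up x) / real n) ^ d)" if x: "x \<in> X" for x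
  proof -
    have "finite {S. S \<subseteq> {1..n} \<and> card S = d \<and> S \<in> Field M}" by simp
    moreover have "below x \<subseteq> {S. S \<subseteq> {1..n} \<and> card S = d \<and> S \<in> Field M}"
      unfolding below_def by (blast intro: FieldI1)
    ultimately have "card (below x) \<le> b" unfolding b by (rule card_mono)
    moreover have "real (card (below x)) \<le> ?N * (1 - card (up x) / real n) ^ d"
    proof -
      have ux: "up x \<subseteq> {1..n}" by (auto simp: up_def X_def)
      \<comment> \<open>A set \<open>S\<close> below \<open>{x}\<close> with an element
        \<open>y\<close> in \<open>up x\<close> would close the cycle \<open>{y}\<close>,
        \<open>S\<close>, \<open>{x}\<close>, \<open>{y}\<close> in \<open>M\<close>, while
        \<open>d \<ge> 2\<close> keeps \<open>S\<close> apart from \<open>{y}\<close>.\<close>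
      have "y \<notin> S" if "S \<in> below x" "y \<in> up x" for S y
      proof
        assume "y \<in> S"
        have y: "({x}, {y}) \<in> M" "y \<in> {1..n}" using that by (auto simp: up_def X_def)
        have S: "S \<subseteq> {1..n}" "card S = d" "(S, {x}) \<in> M" using that by (auto simp: below_def)
        have "({y}, S) \<in> ?P" using \<open>y \<in> S\<close> y S by (auto simp: subset_poset_def)
        then have "({y}, S) \<in> M" using y S by (intro MP) (auto intro: FieldI1 FieldI2)
        moreover have "(S, {y}) \<in> M" using ple_trans[OF M] S y by blast
        ultimately have "S = {y}" using ple_antisym[OF M] by blast
        then show False using S d by simp
      qed
      then have "below x \<subseteq> {S. S \<subseteq> {1..n} - up x \<and> card S = d}" by (auto simp: below_def)
      then have "card (below x) \<le> card {S. S \<subseteq> {1..n} - up x \<and> card S = d}"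
        by (intro card_mono) auto
      also have "\<dots> = (n - card (up x)) choose d"
        using ux finup by (simp add: n_subsets card_Diff_subset)
      finally have le: "card (below x) \<le> (n - card (up x)) choose d" .
      have "card (up x) \<le> n" using card_mono[OF _ ux] by simp
      have "real ((n - card (up x)) choose d) * real n ^ d \<le> real ?N * real (n - card (up x)) ^ d"
        using binomial_power_le[of "n - card (up x)" n d] by (metis diff_le_self of_nat_le_iff of_nat_mult of_nat_power)
      then have "real ((n - card (up x)) choose d) \<le> real ?N * real (n - card (up x)) ^ d / real n ^ d"
        using d by (simp add: pos_le_divide_eq)
      also have "\<dots> = ?N * (1 - card (up x) / real n) ^ d"
      proof -
        have "real (n - card (up x)) / n = 1 - card (up x) / real n"
          using \<open>card (up x) \<le> n\<close> d by (simp add: of_nat_diff field_simps)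
        moreover have "real ?N * real (n - card (up x)) ^ d / real n ^ d = real ?N * (real (n - card (up x)) / n) ^ d"
          by (simp add: power_divide)
        ultimately show ?thesis by simp
      qed
      finally show ?thesis using le by linarith
    qed
    moreover have "real b = ?N * (b / ?N)" using N by simp
    ultimately show ?thesis by (auto simp: min_def)
  qed
  have "{p \<in> Sigma {1..n} (\<lambda>x. {S. S \<subseteq> {1..n} - {x} \<and> card S = d}). (snd p, {fst p}) \<in> M} = Sigma X below"
    (is "?L = _")
  proof (intro equalityI subsetI)
    fix p assume "p \<in> ?L"
    then obtain x S where p: "p = (x, S)" "x \<in> {1..n}" "S \<subseteq> {1..n} - {x}" "card S = d" "(S, {x}) \<in> M"
      by (cases p) auto
    then show "p \<in> Sigma X below" using FieldI2[OF p(5)] by (simp add: X_def below_def)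
  next
    fix p assume "p \<in> Sigma X below"
    then obtain x S where "p = (x, S)" "x \<in> X" "S \<in> below x" by (cases p) auto
    then show "p \<in> ?L" by (simp add: X_def below_def)
  qed
  then have "real (card {p \<in> Sigma {1..n} (\<lambda>x. {S. S \<subseteq> {1..n} - {x} \<and> card S = d}). (snd p, {fst p}) \<in> M})
      = (\<Sum>x\<in>X. real (card (below x)))"
    using finX finbelow by (simp add: card_SigmaI)
  also have "\<dots> \<le> (\<Sum>x\<in>X. ?N * min (b / ?N) ((1 - card (up x) / real n) ^ d))"
    using below_le by (intro sum_mono)
  also have "\<dots> = ?N * (\<Sum>x\<in>X. min (b / ?N) ((1 - card (up x) / real n) ^ d))"
    by (simp add: sum_distrib_left)
  also have "(\<Sum>x\<in>X. min (b / ?N) ((1 - card (up x) / real n) ^ d)) = (\<Sum>i=1..a. min (b / ?N) ((1 - real i / real n) ^ d))"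
    unfolding img[symmetric] using inj by (simp add: sum.reindex)
  also have "?N * (\<Sum>i=1..a. min (b / ?N) ((1 - real i / real n) ^ d)) \<le> ?N * (n * Rfun d (a / n) (b / ?N))"
    using d a_le b_le N by (intro mult_left_mono sum_le_Rfun) (auto simp: field_simps)
  finally show ?thesis by (simp add: mult_ac)
qed

lemma finite_Field_subset_poset: "finite (Field (subset_poset d n))"
  unfolding Field_subset_poset by (rule finite_subset[of _ "Pow {1..n}"]) auto

text \<open>The dual inequality is summed against an optimal realizer. The right-hand side becomes a
  convex combination of average loads, at most \<open>fldim\<close>; on the left the three averages
  are at least \<open>1\<close>, \<open>2\<close> and \<open>2\<close>, up to the factor
  \<open>1 - d / n\<close>.\<close>

lemma fldim_lower_bound:
  fixes \<kappa> \<delta> \<epsilon> \<rho> :: real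
  assumes d: "2 \<le> d" "d \<le> n" and nonneg: "0 \<le> \<kappa>" "0 \<le> \<delta>" "0 \<le> \<epsilon>" "0 \<le> \<rho>" "\<rho> \<le> 1"
    and dual: "\<And>q y. 0 \<le> q \<Longrightarrow> q \<le> 1 \<Longrightarrow> 0 \<le> y \<Longrightarrow> y \<le> 1 \<Longrightarrow>
       \<kappa> * Rfun d q y + \<delta> * q\<^sup>2 + \<epsilon> * y\<^sup>2 \<le> \<rho> * q + (1 - \<rho>) * y"
  shows "(\<kappa> + 2 * \<delta> + 2 * \<epsilon>) * (1 - d / n) \<le> fldim (subset_poset d n)"
proof -
  let ?P = "subset_poset d n"
  define N where "N = n choose d"
  have n0: "0 < n" and N0: "0 < N" using d by (auto simp: N_def)
  have FP: "Field ?P = {X. X \<subseteq> {1..n} \<and> card X \<in> {1, d}}" by (rule Field_subset_poset)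
  have finP: "finite (Field ?P)" by (rule finite_Field_subset_poset)
  have "{1} \<in> Field ?P" using n0 unfolding FP by auto
  then have neP: "Field ?P \<noteq> {}" by blast
  obtain w where w: "fractional_local_realizer ?P w" and fl: "fldim ?P = mu ?P w"
    using fldim_attained[OF finP neP partial_order_subset_poset] by blast
  define m where "m = mu ?P w"
  define L where "L = ple ?P"
  have finL: "finite L" unfolding L_def using finite_ple[OF finP] .
  have w0: "\<And>M. M \<in> L \<Longrightarrow> 0 \<le> w M"
    using w by (auto simp: fractional_local_realizer_def local_weight_def L_def)
  have mu_le: "(\<Sum>M | M \<in> L \<and> u \<in> Field M. w M) \<le> m" if "u \<in> Field ?P" for u
    using finP that unfolding m_def mu_def mu_elem_def L_def by (intro Max_ge) auto
  define A where "A = (\<lambda>x::nat. {x}) ` {1..n}"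
  define B where "B = {S. S \<subseteq> {1..n} \<and> card S = d}"
  have cA: "card A = n" "finite A" by (auto simp: A_def card_image)
  have cB: "card B = N" "finite B" by (auto simp: B_def N_def n_subsets)
  have AP: "A \<subseteq> Field ?P" and BP: "B \<subseteq> Field ?P" unfolding FP by (auto simp: A_def B_def)
  define a where "a M = card (A \<inter> Field M)" for M
  define b where "b M = card (B \<inter> Field M)" for M
  have antiA: "(u, v) \<notin> ?P" if "u \<in> A" "v \<in> A" "u \<noteq> v" for u v
    using that by (auto simp: A_def subset_poset_def)
  have antiB: "(u, v) \<notin> ?P" if "u \<in> B" "v \<in> B" "u \<noteq> v" for u v
    using that card_subset_eq[of v u] finite_subset[of v "{1..n}"] by (auto simp: B_def subset_poset_def)
  have load: "(\<Sum>M\<in>L. w M * card (C \<inter> Field M)) \<le> card C * m" if C: "C \<subseteq> Field ?P" for C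
  proof -
    have "C \<inter> Field M = {u \<in> C. u \<in> Field M}" for M :: "nat set rel" by blast
    then have "(\<Sum>M\<in>L. w M * card (C \<inter> Field M)) = (\<Sum>u\<in>C. \<Sum>M | M \<in> L \<and> u \<in> Field M. w M)"
      using sum_weight_card[OF finL, of C w "\<lambda>M u. u \<in> Field M"] finite_subset[OF C finP] by simp
    also have "\<dots> \<le> (\<Sum>u\<in>C. m)" using mu_le C by (intro sum_mono) auto
    finally show ?thesis by simp
  qed
  define T where "T = Sigma {1..n} (\<lambda>x. {S. S \<subseteq> {1..n} - {x} \<and> card S = d})"
  have finT: "finite T" unfolding T_def by auto
  have cT: "card T = n * ((n - 1) choose d)"
  proof -
    have "card {S. S \<subseteq> {1..n} - {x} \<and> card S = d} = (n - 1) choose d" if "x \<in> {1..n}" for x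
      using that by (simp add: n_subsets)
    then show ?thesis unfolding T_def by (simp add: card_SigmaI)
  qed
  define U where "U M = card {p \<in> T. (snd p, {fst p}) \<in> M}" for M
  have upper: "U M \<le> n * N * Rfun d (a M / n) (b M / N)" if "M \<in> L" for M
  proof -
    have "a M = card {x \<in> {1..n}. {x} \<in> Field M}"
    proof -
      have "A \<inter> Field M = (\<lambda>x. {x}) ` {x \<in> {1..n}. {x} \<in> Field M}" by (auto simp: A_def)
      then show ?thesis by (simp add: a_def card_image)
    qed
    moreover have "b M = card {S. S \<subseteq> {1..n} \<and> card S = d \<and> S \<in> Field M}"
      unfolding b_def B_def by (rule arg_cong[where f = card]) auto
    ultimately show ?thesis
      using up_count_le[OF d] that unfolding U_def T_def L_def N_def by simp
  qed
  have up: "real (card T) \<le> (\<Sum>M\<in>L. w M * U M)"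
  proof -
    have "1 \<le> (\<Sum>M | M \<in> L \<and> (snd p, {fst p}) \<in> M. w M)" if "p \<in> T" for p
    proof -
      obtain x S where p: "p = (x, S)" by (cases p)
      then have xS: "x \<in> {1..n}" "S \<subseteq> {1..n}" "x \<notin> S" "card S = d" using that by (auto simp: T_def)
      have "{x} \<in> Field ?P" "S \<in> Field ?P" "({x}, S) \<notin> ?P" "(S, {x}) \<notin> ?P"
        using xS d unfolding FP by (auto simp: subset_poset_def subset_singleton_iff)
      then have "(\<Sum>M | M \<in> L \<and> (S, {x}) \<in> M \<and> {x} \<noteq> S. w M) \<ge> 1"
        using w unfolding fractional_local_realizer_def L_def by blast
      moreover have "{x} \<noteq> S" using xS by auto
      ultimately show ?thesis by (simp add: p)
    qed
    then have "(\<Sum>p\<in>T. 1) \<le> (\<Sum>p\<in>T. \<Sum>M | M \<in> L \<and> (snd p, {fst p}) \<in> M. w M)" by (rule sum_mono)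
    then show ?thesis
      using sum_weight_card[OF finL finT, of w "\<lambda>M p. (snd p, {fst p}) \<in> M"] by (simp add: U_def)
  qed
  have pairA: "2 * (real n * (real n - 1)) \<le> (\<Sum>M\<in>L. w M * (real (a M))\<^sup>2)"
    using antichain_pair_bound[OF finP w AP antiA] by (simp add: cA a_def L_def)
  have pairB: "2 * (real N * (real N - 1)) \<le> (\<Sum>M\<in>L. w M * (real (b M))\<^sup>2)"
    using antichain_pair_bound[OF finP w BP antiB] by (simp add: cB b_def L_def)
  have loadA: "(\<Sum>M\<in>L. w M * a M) \<le> n * m" using load[OF AP] by (simp add: cA a_def)
  have loadB: "(\<Sum>M\<in>L. w M * b M) \<le> N * m" using load[OF BP] by (simp add: cB b_def)
  have pointwise: "\<kappa> * (U M / (n * N)) + \<delta> * ((a M)\<^sup>2 / n\<^sup>2) + \<epsilon> * ((b M)\<^sup>2 / N\<^sup>2)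
      \<le> \<rho> * (a M / n) + (1 - \<rho>) * (b M / N)" if M: "M \<in> L" for M
  proof -
    have "a M \<le> n" unfolding a_def using card_mono[of A "A \<inter> Field M"] cA by simp
    moreover have "b M \<le> N" unfolding b_def using card_mono[of B "B \<inter> Field M"] cB by simp
    ultimately have "\<kappa> * Rfun d (a M / n) (b M / N) + \<delta> * (a M / n)\<^sup>2 + \<epsilon> * (b M / N)\<^sup>2
        \<le> \<rho> * (a M / n) + (1 - \<rho>) * (b M / N)"
      using n0 N0 by (intro dual) auto
    moreover have "U M / (n * N) \<le> Rfun d (a M / n) (b M / N)"
      using upper[OF M] n0 N0 by (simp add: divide_le_eq mult_ac)
    then have "\<kappa> * (U M / (n * N)) \<le> \<kappa> * Rfun d (a M / n) (b M / N)"
      using nonneg by (intro mult_left_mono)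
    ultimately show ?thesis by (simp add: power_divide)
  qed
  have "\<kappa> * ((\<Sum>M\<in>L. w M * U M) / (n * N)) + \<delta> * ((\<Sum>M\<in>L. w M * (real (a M))\<^sup>2) / n\<^sup>2)
      + \<epsilon> * ((\<Sum>M\<in>L. w M * (real (b M))\<^sup>2) / N\<^sup>2)
    = (\<Sum>M\<in>L. w M * (\<kappa> * (U M / (n * N)) + \<delta> * ((a M)\<^sup>2 / n\<^sup>2) + \<epsilon> * ((b M)\<^sup>2 / N\<^sup>2)))"
    by (simp add: sum_divide_distrib sum_distrib_left sum.distrib distrib_left mult_ac)
  also have "\<dots> \<le> (\<Sum>M\<in>L. w M * (\<rho> * (a M / n) + (1 - \<rho>) * (b M / N)))"
    using pointwise w0 by (intro sum_mono mult_left_mono)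
  also have "\<dots> = \<rho> * ((\<Sum>M\<in>L. w M * a M) / n) + (1 - \<rho>) * ((\<Sum>M\<in>L. w M * b M) / N)"
    by (simp add: sum_divide_distrib sum_distrib_left sum.distrib distrib_left mult_ac)
  also have "\<dots> \<le> \<rho> * m + (1 - \<rho>) * m"
    using nonneg loadA loadB n0 N0 by (intro add_mono mult_left_mono) (auto simp: divide_le_eq mult_ac)
  finally have total: "\<kappa> * ((\<Sum>M\<in>L. w M * U M) / (n * N)) + \<delta> * ((\<Sum>M\<in>L. w M * (real (a M))\<^sup>2) / n\<^sup>2)
      + \<epsilon> * ((\<Sum>M\<in>L. w M * (real (b M))\<^sup>2) / N\<^sup>2) \<le> m" by (simp add: algebra_simps)
  \<comment> \<open>Only pairs with \<open>x \<notin> S\<close> demand a reversal; they are the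
    fraction \<open>1 - d / n\<close> of all pairs.\<close>
  have c1: "1 - d / n \<le> (\<Sum>M\<in>L. w M * U M) / (n * N)"
  proof -
    have "n * ((n - 1) choose d) = (n - d) * N"
      using binomial_absorb_comp[of n d] by (simp add: N_def)
    then have "real (card T) = (real n - d) * N"
      using d unfolding cT by (simp only: of_nat_mult of_nat_diff)
    then have "(real n - d) * N / (n * N) \<le> (\<Sum>M\<in>L. w M * U M) / (n * N)"
      using up by (intro divide_right_mono) auto
    then show ?thesis using n0 N0 by (simp add: diff_divide_distrib)
  qed
  have c2: "2 * (1 - d / n) \<le> (\<Sum>M\<in>L. w M * (real (a M))\<^sup>2) / n\<^sup>2"
  proof -
    have "2 * (1 - d / n) \<le> 2 * (1 - 1 / real n)" using d n0 by (simp add: divide_right_mono)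
    also have "\<dots> = 2 * (real n * (real n - 1)) / n\<^sup>2" using n0 by (simp add: field_simps power2_eq_square)
    also have "\<dots> \<le> (\<Sum>M\<in>L. w M * (real (a M))\<^sup>2) / n\<^sup>2" using pairA by (intro divide_right_mono) auto
    finally show ?thesis .
  qed
  have c3: "2 * (1 - d / n) \<le> (\<Sum>M\<in>L. w M * (real (b M))\<^sup>2) / N\<^sup>2"
  proof -
    \<comment> \<open>Makes the loss \<open>1 / N\<close> at the pairs of sets at most
      \<open>d / n\<close>, so that one factor serves all three demands.\<close>
    have "n \<le> d * N"
    proof -
      obtain k where k: "d = Suc k" using d by (cases d) auto
      have "d * N = n * ((n - 1) choose k)" unfolding N_def k by (rule binomial_absorption)
      moreover have "1 \<le> (n - 1) choose k" using d k zero_less_binomial[of k "n - 1"] by linarith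
      then have "n * 1 \<le> n * ((n - 1) choose k)" by (rule mult_le_mono2)
      ultimately show ?thesis by simp
    qed
    then have "real n \<le> d * N" by (metis of_nat_le_iff of_nat_mult)
    then have "1 / real N \<le> d / n" using n0 N0 by (simp add: field_simps)
    then have "2 * (1 - d / n) \<le> 2 * (1 - 1 / real N)" by simp
    also have "\<dots> = 2 * (real N * (real N - 1)) / N\<^sup>2" using N0 by (simp add: field_simps power2_eq_square)
    also have "\<dots> \<le> (\<Sum>M\<in>L. w M * (real (b M))\<^sup>2) / N\<^sup>2" using pairB by (intro divide_right_mono) auto
    finally show ?thesis .
  qed
  have "(\<kappa> + 2 * \<delta> + 2 * \<epsilon>) * (1 - d / n)
      = \<kappa> * (1 - d / n) + \<delta> * (2 * (1 - d / n)) + \<epsilon> * (2 * (1 - d / n))"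
    by (simp add: algebra_simps)
  also have "\<dots> \<le> m"
    using mult_left_mono[OF c1 nonneg(1)] mult_left_mono[OF c2 nonneg(2)] mult_left_mono[OF c3 nonneg(3)] total
    by linarith
  finally show ?thesis by (simp add: fl m_def)
qed

section \<open>Random colexicographic extensions\<close>

text \<open>Local weights may not exceed \<open>1\<close>. Cutting off there preserves a demand of
  \<open>1\<close>: either one term already reaches \<open>1\<close>, or nothing is cut.\<close>

lemma min_one_sum_ge:
  fixes c :: "'a \<Rightarrow> real"
  assumes "finite S" "\<And>M. M \<in> S \<Longrightarrow> 0 \<le> c M" "1 \<le> (\<Sum>M\<in>S. c M)"
  shows "1 \<le> (\<Sum>M\<in>S. min 1 (c M))"
proof (cases "\<exists>M\<in>S. 1 \<le> c M")
  case True
  then obtain M where M: "M \<in> S" "1 \<le> c M" by blast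
  then have "1 = min 1 (c M)" by simp
  also have "\<dots> \<le> (\<Sum>M\<in>S. min 1 (c M))" using assms M by (intro member_le_sum) auto
  finally show ?thesis .
next
  case False
  then have "(\<Sum>M\<in>S. min 1 (c M)) = (\<Sum>M\<in>S. c M)" by (intro sum.cong) auto
  then show ?thesis using assms by simp
qed

text \<open>Different indices may yield the same extension, so the weights are collected along the
  fibres of \<open>E\<close> and then cut off at \<open>1\<close>.\<close>

lemma fldim_le_mixture:
  fixes P :: "'a rel" and c :: "'i \<Rightarrow> real"
  assumes fin: "finite (Field P)" and ne: "Field P \<noteq> {}" and po: "Partial_order P"
    and I: "finite I" "\<And>i. i \<in> I \<Longrightarrow> 0 \<le> c i" "\<And>i. i \<in> I \<Longrightarrow> E i \<in> ple P"
    and comparable: "\<And>u v. (u, v) \<in> P \<Longrightarrow> 1 \<le> (\<Sum>i | i \<in> I \<and> (u, v) \<in> E i. c i)"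
    and incomparable: "\<And>u v. u \<in> Field P \<Longrightarrow> v \<in> Field P \<Longrightarrow> (u, v) \<notin> P \<Longrightarrow> (v, u) \<notin> P \<Longrightarrow>
       1 \<le> (\<Sum>i | i \<in> I \<and> (v, u) \<in> E i. c i)"
    and load: "\<And>u. u \<in> Field P \<Longrightarrow> (\<Sum>i | i \<in> I \<and> u \<in> Field (E i). c i) \<le> C"
  shows "fldim P \<le> C"
proof -
  define t where "t M = (\<Sum>i | i \<in> I \<and> E i = M. c i)" for M
  define w where "w M = min 1 (t M)" for M
  have t0: "0 \<le> t M" for M using I by (auto simp: t_def intro: sum_nonneg)
  have finL: "finite (ple P)" using finite_ple[OF fin] .
  have group: "(\<Sum>M | M \<in> ple P \<and> Q M. t M) = (\<Sum>i | i \<in> I \<and> Q (E i). c i)" for Q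
  proof -
    have "(\<Sum>M | M \<in> ple P \<and> Q M. t M)
        = (\<Sum>M | M \<in> ple P \<and> Q M. sum c {i \<in> {i. i \<in> I \<and> Q (E i)}. E i = M})"
      unfolding t_def by (intro sum.cong refl) auto
    also have "\<dots> = (\<Sum>i | i \<in> I \<and> Q (E i). c i)" using finL I by (intro sum.group) auto
    finally show ?thesis .
  qed
  have ge: "1 \<le> (\<Sum>M | M \<in> ple P \<and> Q M. w M)" if "1 \<le> (\<Sum>i | i \<in> I \<and> Q (E i). c i)" for Q
    unfolding w_def using that finL t0 group[of Q] by (intro min_one_sum_ge) auto
  have "fractional_local_realizer P w"
    unfolding fractional_local_realizer_def local_weight_def
  proof (intro conjI ballI impI)
    fix u v assume uv: "u \<in> Field P" "v \<in> Field P"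
    show "1 \<le> (\<Sum>M | M \<in> ple P \<and> (u, v) \<in> M. w M)" if "(u, v) \<in> P"
      using comparable[OF that] by (rule ge)
    assume *: "(u, v) \<notin> P \<and> (v, u) \<notin> P"
    have "(u, u) \<in> P" using uv po by (auto simp: order_on_defs refl_on_def)
    then have "u \<noteq> v" using * by auto
    then show "1 \<le> (\<Sum>M | M \<in> ple P \<and> (v, u) \<in> M \<and> u \<noteq> v. w M)"
      using ge[of "\<lambda>M. (v, u) \<in> M"] incomparable[OF uv] * by simp
  qed (auto simp: w_def t0)
  moreover have "mu P w \<le> C"
    unfolding mu_def
  proof (subst Max_le_iff)
    show "\<forall>a\<in>(\<lambda>u. mu_elem P u w) ` Field P. a \<le> C"
    proof clarify
      fix u assume u: "u \<in> Field P"
      have "mu_elem P u w \<le> (\<Sum>M | M \<in> ple P \<and> u \<in> Field M. t M)"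
        unfolding mu_elem_def by (intro sum_mono) (simp add: w_def)
      also have "\<dots> \<le> C" unfolding group using load[OF u] .
      finally show "mu_elem P u w \<le> C" .
    qed
  qed (use fin ne in auto)
  ultimately show ?thesis using fldim_attained[OF fin ne po] by fastforce
qed

section \<open>Labelings and the orders they induce\<close>

text \<open>Injectivity gives distinct sets distinct images, which makes the induced order
  antisymmetric.\<close>

definition labelings :: "nat \<Rightarrow> nat \<Rightarrow> (nat \<Rightarrow> nat) set" where
  "labelings n K = {f \<in> {1..n} \<rightarrow>\<^sub>E {..<K}. inj_on f {1..n}}"

definition members :: "nat \<Rightarrow> nat \<Rightarrow> nat \<Rightarrow> nat \<Rightarrow> (nat \<Rightarrow> nat) \<Rightarrow> nat set set" where
  "members d n a m f = (\<lambda>i. {i}) ` {i \<in> {1..n}. a \<le> f i} \<union> {S. S \<subseteq> {1..n} \<and> card S = d \<and> (\<forall>i\<in>S. f i < m)}"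

text \<open>Comparing the numbers \<open>set_encode (f ` X)\<close> amounts to the colexicographic order induced by the
  labels, which extends inclusion and puts a set right above its largest element.\<close>

definition colex_ext :: "nat \<Rightarrow> nat \<Rightarrow> nat \<Rightarrow> nat \<Rightarrow> (nat \<Rightarrow> nat) \<Rightarrow> nat set rel" where
  "colex_ext d n a m f = {(X, Y). X \<in> members d n a m f \<and> Y \<in> members d n a m f \<and>
     set_encode (f ` X) \<le> set_encode (f ` Y)}"

lemma members_subset: "X \<in> members d n a m f \<Longrightarrow> X \<subseteq> {1..n}"
  by (auto simp: members_def)

lemma members_finite: "X \<in> members d n a m f \<Longrightarrow> finite X"
  using members_subset finite_subset finite_atLeastAtMost by metis

lemma singleton_member: "2 \<le> d \<Longrightarrow> {i} \<in> members d n a m f \<longleftrightarrow> i \<in> {1..n} \<and> a \<le> f i"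
  by (auto simp: members_def)

lemma set_member:
  assumes "2 \<le> d" "card S = d"
  shows "S \<in> members d n a m f \<longleftrightarrow> S \<subseteq> {1..n} \<and> (\<forall>i\<in>S. f i < m)"
  using assms by (auto simp: members_def)

lemma Field_colex_ext: "Field (colex_ext d n a m f) = members d n a m f"
  by (auto simp: Field_def colex_ext_def)

lemma colex_ext_total:
  "X \<in> members d n a m f \<Longrightarrow> Y \<in> members d n a m f \<Longrightarrow>
    (X, Y) \<in> colex_ext d n a m f \<or> (Y, X) \<in> colex_ext d n a m f"
  by (auto simp: colex_ext_def)

lemma set_encode_mono: "finite B \<Longrightarrow> A \<subseteq> B \<Longrightarrow> set_encode A \<le> set_encode B"
  unfolding set_encode_def by (intro sum_mono2) auto

lemma colex_ext_ple:
  assumes d: "2 \<le> d" and inj: "inj_on f {1..n}"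
  shows "colex_ext d n a m f \<in> ple (subset_poset d n)"
proof -
  let ?M = "colex_ext d n a m f" and ?F = "members d n a m f"
  have anti: "X = Y" if "X \<in> ?F" "Y \<in> ?F" "set_encode (f ` X) = set_encode (f ` Y)" for X Y
  proof -
    have "f ` X = f ` Y"
      using that members_finite by (metis finite_imageI set_encode_inverse)
    then show ?thesis using inj_on_image_eq_iff[OF inj] members_subset that(1,2) by metis
  qed
  have "refl_on ?F ?M" "trans ?M" "antisym ?M" "total_on ?F ?M" "?M \<subseteq> ?F \<times> ?F"
    using anti by (auto simp: refl_on_def trans_def antisym_def total_on_def colex_ext_def)
  then have "Linear_order ?M" unfolding Field_colex_ext order_on_defs by blast
  moreover have "?F \<subseteq> Field (subset_poset d n)"
    unfolding Field_subset_poset by (auto simp: members_def)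
  moreover have "Restr (subset_poset d n) ?F \<subseteq> ?M"
    using members_finite by (auto simp: subset_poset_def colex_ext_def intro!: set_encode_mono image_mono)
  ultimately show ?thesis unfolding ple_def mem_Collect_eq Field_colex_ext by blast
qed

text \<open>\<open>2 ^ k\<close> encodes \<open>{k}\<close>, and the smaller powers of two add up to
  only \<open>2 ^ k - 1\<close>.\<close>

lemma set_encode_less_iff:
  assumes "finite A" "k \<notin> A"
  shows "set_encode A \<le> 2 ^ k \<longleftrightarrow> (\<forall>i\<in>A. i < k)"
proof
  assume *: "set_encode A \<le> 2 ^ k"
  show "\<forall>i\<in>A. i < k"
  proof
    fix i assume i: "i \<in> A"
    have "(2::nat) ^ i \<le> set_encode A"
      using set_encode_mono[of A "{i}"] i assms by (simp add: set_encode_def)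
    then have "(2::nat) ^ i \<le> 2 ^ k" using * by linarith
    then have "i \<le> k" by simp
    then show "i < k" using i assms by (cases "i = k") auto
  qed
next
  assume "\<forall>i\<in>A. i < k"
  then have "set_encode A \<le> set_encode {..<k}" by (intro set_encode_mono) auto
  also have "\<dots> = 2 ^ k - 1" by (simp add: set_encode_def lessThan_atLeast0 sum_power2)
  finally show "set_encode A \<le> 2 ^ k" by simp
qed

lemma below_singleton_iff:
  assumes d: "2 \<le> d" and inj: "inj_on f {1..n}" and S: "S \<subseteq> {1..n}" "card S = d" and x: "x \<in> {1..n}" "x \<notin> S"
  shows "(S, {x}) \<in> colex_ext d n a m f \<longleftrightarrow> a \<le> f x \<and> (\<forall>i\<in>S. f i < min (f x) m)"
proof -
  have "f x \<notin> f ` S" using inj_on_image_mem_iff[OF inj x(1) S(1)] x(2) by simp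
  moreover have "finite (f ` S)" using S finite_subset by blast
  ultimately have "set_encode (f ` S) \<le> 2 ^ f x \<longleftrightarrow> (\<forall>i\<in>S. f i < f x)"
    by (subst set_encode_less_iff) auto
  moreover have "(S, {x}) \<in> colex_ext d n a m f \<longleftrightarrow>
      S \<in> members d n a m f \<and> {x} \<in> members d n a m f \<and> set_encode (f ` S) \<le> 2 ^ f x"
    by (simp add: colex_ext_def set_encode_def)
  ultimately show ?thesis
    using S x(1) unfolding set_member[OF d S(2)] singleton_member[OF d] min_less_iff_conj by blast
qed

text \<open>An involution exchanging \<open>S - T\<close> and \<open>T - S\<close>, so that one map
  carries each set to the other.\<close>

lemma swap_exists:
  assumes "S \<subseteq> A" "T \<subseteq> A" "finite A" "card S = card T"
  obtains p where "bij_betw p A A" "p ` S = T" "p ` T = S"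
proof -
  have fin: "finite S" "finite T" using assms finite_subset by blast+
  have "card (S - T) = card (T - S)"
    using assms fin by (metis card_Diff_subset_Int Int_commute finite_Int)
  then obtain h where h: "bij_betw h (S - T) (T - S)"
    using fin by (metis finite_Diff finite_same_card_bij)
  define p where "p i = (if i \<in> S - T then h i else if i \<in> T - S then inv_into (S - T) h i else i)" for i
  have h1: "h i \<in> T - S" if "i \<in> S - T" for i using h that by (auto simp: bij_betw_def)
  have h2: "inv_into (S - T) h i \<in> S - T" if "i \<in> T - S" for i
    using h that by (metis bij_betw_def inv_into_into)
  have pp: "p (p i) = i" for i
  proof (cases "i \<in> S - T")
    case True
    then have "p i = h i" by (simp add: p_def)
    moreover have "h i \<in> T - S" "h i \<notin> S - T" using h1[OF True] by auto
    moreover have "inv_into (S - T) h (h i) = i" using h True by (meson bij_betw_inv_into_left)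
    ultimately show ?thesis unfolding p_def by simp
  next
    case False
    show ?thesis
    proof (cases "i \<in> T - S")
      case True
      then have "p i = inv_into (S - T) h i" using False by (simp add: p_def)
      moreover have "inv_into (S - T) h i \<in> S - T" using h2[OF True] .
      moreover have "h (inv_into (S - T) h i) = i" using h True by (meson bij_betw_inv_into_right)
      ultimately show ?thesis unfolding p_def by simp
    qed (use False in \<open>auto simp: p_def\<close>)
  qed
  have pS: "p i \<in> T" if "i \<in> S" for i using that h1[of i] by (auto simp: p_def)
  have pT: "p i \<in> S" if "i \<in> T" for i using that h2[of i] by (auto simp: p_def)
  have pA: "p i \<in> A" if "i \<in> A" for i using that pS[of i] pT[of i] assms by (auto simp: p_def)
  show ?thesis
  proof
    show "bij_betw p A A" by (rule bij_betwI[of _ _ _ p]) (auto simp: pp pA)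
    show "p ` S = T" using pS pT pp by (auto simp: image_iff) metis
    show "p ` T = S" using pS pT pp by (auto simp: image_iff) metis
  qed
qed

text \<open>Composing the labels with such a permutation is an injection of the labelings into
  themselves that interchanges the roles of \<open>S\<close> and \<open>T\<close>. Thus neither
  order of two sets of equal size is favoured.\<close>

lemma colex_ext_swap:
  assumes d: "2 \<le> d" and S: "S \<subseteq> {1..n}" and T: "T \<subseteq> {1..n}" "card S = card T" "card S \<in> {1, d}"
  shows "card {f \<in> labelings n K. (S, T) \<in> colex_ext d n a m f}
    \<le> card {f \<in> labelings n K. (T, S) \<in> colex_ext d n a m f}"
proof -
  obtain p where p: "bij_betw p {1..n} {1..n}" "p ` S = T" "p ` T = S"
    using swap_exists[OF S T(1) _ T(2)] by blast
  define F where "F f = restrict (f \<circ> p) {1..n}" for f :: "nat \<Rightarrow> nat"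
  have pin: "p i \<in> {1..n}" if "i \<in> {1..n}" for i using p(1) that by (auto simp: bij_betw_def)
  have lab: "F f \<in> labelings n K" if f: "f \<in> labelings n K" for f
  proof -
    have "inj_on p {1..n}" "p ` {1..n} = {1..n}" using p(1) by (auto simp: bij_betw_def)
    moreover have "inj_on f {1..n}" using f by (simp add: labelings_def)
    ultimately have "inj_on (f \<circ> p) {1..n}" by (intro comp_inj_on) simp_all
    moreover have "inj_on (F f) {1..n} \<longleftrightarrow> inj_on (f \<circ> p) {1..n}" by (rule inj_on_cong) (simp add: F_def)
    ultimately have "inj_on (F f) {1..n}" by blast
    moreover have "F f \<in> {1..n} \<rightarrow>\<^sub>E {..<K}"
      using f pin by (auto simp: F_def labelings_def PiE_def Pi_def)
    ultimately show ?thesis by (simp add: labelings_def)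
  qed
  have im: "F f ` X = f ` (p ` X)" if "X \<subseteq> {1..n}" for f X
    unfolding image_image using that by (intro image_cong) (auto simp: F_def)
  have imS: "F f ` S = f ` T" and imT: "F f ` T = f ` S" for f
    using im[OF S] im[OF T(1)] p(2,3) by simp_all
  have mem: "F f \<in> {g. X \<in> members d n a m g} \<longleftrightarrow> f \<in> {g. p ` X \<in> members d n a m g}"
    if "X \<in> {S, T}" for X f
  proof -
    have X: "X \<subseteq> {1..n}" "p ` X \<subseteq> {1..n}" "card X = card (p ` X)" "card X \<in> {1, d}"
      using that S T p by auto
    show ?thesis
    proof (cases "card X = d")
      case True
      have "(\<forall>i\<in>X. F f i < m) \<longleftrightarrow> (\<forall>j\<in>p ` X. f j < m)"
        using X(1) by (simp add: F_def subset_iff)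
      then show ?thesis
        using X(1,2) True set_member[OF d, of X] set_member[OF d, of "p ` X"] X(3) by simp
    next
      case False
      then obtain i where i: "X = {i}" using X(4) by (auto simp: card_1_singleton_iff)
      then show ?thesis using X d by (simp add: singleton_member[OF d] F_def)
    qed
  qed
  have "F ` {f \<in> labelings n K. (S, T) \<in> colex_ext d n a m f} \<subseteq> {f \<in> labelings n K. (T, S) \<in> colex_ext d n a m f}"
    using lab mem[of S] mem[of T] imS imT p by (auto simp: colex_ext_def)
  moreover have "inj_on F (labelings n K)"
  proof (rule inj_onI)
    fix f g assume f: "f \<in> labelings n K" and g: "g \<in> labelings n K" and eq: "F f = F g"
    have "f i = g i" for i
    proof (cases "i \<in> {1..n}")
      case True
      then have "i \<in> p ` {1..n}" using bij_betw_imp_surj_on[OF p(1)] by simp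
      then obtain j where j: "j \<in> {1..n}" "i = p j" by blast
      then show ?thesis using fun_cong[OF eq, of j] by (simp add: F_def)
    next
      case False
      then show ?thesis using f g by (auto simp: labelings_def PiE_def extensional_def)
    qed
    then show "f = g" by auto
  qed
  moreover have "finite (labelings n K)"
    unfolding labelings_def by (rule finite_subset[of _ "{1..n} \<rightarrow>\<^sub>E {..<K}"]) (auto intro: finite_PiE)
  ultimately show ?thesis
    by (metis (no_types, lifting) card_image card_mono finite_subset inj_on_subset mem_Collect_eq subsetI)
qed

section \<open>Product measure and injective labelings\<close>

definition prob :: "nat \<Rightarrow> nat \<Rightarrow> ((nat \<Rightarrow> nat) \<Rightarrow> bool) \<Rightarrow> real" where
  "prob n K Q = card {f \<in> {1..n} \<rightarrow>\<^sub>E {..<K}. Q f} / real K ^ n"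

text \<open>The denominator is \<open>K ^ n\<close>, not the number of injective labelings; so
  \<open>freq\<close> is at most \<open>prob\<close> and falls short of it by at most
  \<open>n ^ 2 / K\<close>.\<close>

definition freq :: "nat \<Rightarrow> nat \<Rightarrow> ((nat \<Rightarrow> nat) \<Rightarrow> bool) \<Rightarrow> real" where
  "freq n K Q = card {f \<in> labelings n K. Q f} / real K ^ n"

lemma finite_funcs: "finite ({1..n::nat} \<rightarrow>\<^sub>E {..<K::nat})"
  by (intro finite_PiE) auto

lemma finite_labelings: "finite (labelings n K)"
  unfolding labelings_def using finite_funcs by simp

text \<open>Independence of the labels under the uniform measure on all functions.\<close>

lemma prob_box:
  assumes K: "0 < K" and J: "J \<subseteq> {1..n}" and B: "\<And>i. i \<in> J \<Longrightarrow> B i \<subseteq> {..<K}"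
  shows "prob n K (\<lambda>f. \<forall>i\<in>J. f i \<in> B i) = (\<Prod>i\<in>J. card (B i) / real K)"
proof -
  have fJ: "finite J" using J finite_subset by blast
  have "{f \<in> {1..n} \<rightarrow>\<^sub>E {..<K}. \<forall>i\<in>J. f i \<in> B i} = (\<Pi>\<^sub>E i\<in>{1..n}. if i \<in> J then B i else {..<K})"
  proof (intro set_eqI iffI)
    fix f assume f: "f \<in> (\<Pi>\<^sub>E i\<in>{1..n}. if i \<in> J then B i else {..<K})"
    have *: "f i \<in> (if i \<in> J then B i else {..<K})" if "i \<in> {1..n}" for i
      using PiE_mem[OF f that] .
    have "f i \<in> B i" if "i \<in> J" for i using *[of i] that J by auto
    moreover have "f i \<in> {..<K}" if "i \<in> {1..n}" for i
      using *[OF that] B[of i] by (cases "i \<in> J") auto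
    moreover have "f i = undefined" if "i \<notin> {1..n}" for i using PiE_arb[OF f that] .
    ultimately show "f \<in> {f \<in> {1..n} \<rightarrow>\<^sub>E {..<K}. \<forall>i\<in>J. f i \<in> B i}"
      by (simp add: PiE_iff extensional_def)
  next
    fix f assume "f \<in> {f \<in> {1..n} \<rightarrow>\<^sub>E {..<K}. \<forall>i\<in>J. f i \<in> B i}"
    then show "f \<in> (\<Pi>\<^sub>E i\<in>{1..n}. if i \<in> J then B i else {..<K})"
      by (simp add: PiE_iff)
  qed
  then have "card {f \<in> {1..n} \<rightarrow>\<^sub>E {..<K}. \<forall>i\<in>J. f i \<in> B i} = (\<Prod>i\<in>{1..n}. card (if i \<in> J then B i else {..<K}))"
    by (simp add: card_PiE)
  then have "prob n K (\<lambda>f. \<forall>i\<in>J. f i \<in> B i) = (\<Prod>i\<in>{1..n}. card (if i \<in> J then B i else {..<K}) / real K)"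
    by (simp add: prob_def prod_dividef)
  also have "\<dots> = (\<Prod>i\<in>{1..n}. if i \<in> J then card (B i) / real K else 1)"
    using K by (intro prod.cong) auto
  also have "\<dots> = (\<Prod>i\<in>J. card (B i) / real K)"
    using J by (simp add: prod.If_cases Int_absorb1)
  finally show ?thesis .
qed

text \<open>Union bound over pairs of points, each of which collides with probability
  \<open>1 / K\<close>.\<close>

lemma prob_noninj:
  assumes "0 < K"
  shows "prob n K (\<lambda>f. \<not> inj_on f {1..n}) \<le> real n ^ 2 / K"
proof -
  let ?F = "{1..n} \<rightarrow>\<^sub>E {..<K}"
  define T where "T = {1..n} \<times> {1..n} - Id"
  define D where "D p = {f \<in> ?F. f (fst p) = f (snd p)}" for p
  have finD: "finite (D p)" for p unfolding D_def using finite_funcs by simp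
  have "{f \<in> ?F. \<not> inj_on f {1..n}} \<subseteq> (\<Union>p\<in>T. D p)"
  proof
    fix f assume f: "f \<in> {f \<in> ?F. \<not> inj_on f {1..n}}"
    then obtain i j where "i \<in> {1..n}" "j \<in> {1..n}" "i \<noteq> j" "f i = f j"
      unfolding inj_on_def by blast
    then have "(i, j) \<in> T" "f \<in> D (i, j)" using f by (simp_all add: T_def D_def)
    then show "f \<in> (\<Union>p\<in>T. D p)" by blast
  qed
  then have "card {f \<in> ?F. \<not> inj_on f {1..n}} \<le> card (\<Union>p\<in>T. D p)"
    using finD by (intro card_mono) (auto simp: T_def)
  also have "\<dots> \<le> (\<Sum>p\<in>T. card (D p))" by (intro card_UN_le) (auto simp: T_def)
  finally have "prob n K (\<lambda>f. \<not> inj_on f {1..n}) \<le> (\<Sum>p\<in>T. real (card (D p))) / real K ^ n"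
    unfolding prob_def by (intro divide_right_mono) (auto simp flip: of_nat_sum)
  also have "\<dots> = (\<Sum>p\<in>T. card (D p) / real K ^ n)" by (simp add: sum_divide_distrib)
  also have "\<dots> \<le> (\<Sum>p\<in>T. 1 / K)"
  proof (intro sum_mono)
    fix p assume "p \<in> T"
    then obtain i j where p: "p = (i, j)" "i \<in> {1..n}" "j \<in> {1..n}" "i \<noteq> j" by (cases p) (auto simp: T_def)
    have "D p = (\<Union>t<K. {f \<in> ?F. \<forall>l\<in>{i, j}. f l \<in> {t}})"
      using p by (auto simp: D_def PiE_def Pi_def)
    then have "card (D p) \<le> (\<Sum>t<K. card {f \<in> ?F. \<forall>l\<in>{i, j}. f l \<in> {t}})"
      using card_UN_le[of "{..<K}"] by simp
    then have "real (card (D p)) \<le> (\<Sum>t<K. real (card {f \<in> ?F. \<forall>l\<in>{i, j}. f l \<in> {t}}))"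
      by (simp flip: of_nat_sum)
    then have "card (D p) / real K ^ n \<le> (\<Sum>t<K. prob n K (\<lambda>f. \<forall>l\<in>{i, j}. f l \<in> {t}))"
      by (simp add: prob_def sum_divide_distrib[symmetric] divide_right_mono)
    also have "\<dots> = (\<Sum>t<K. 1 / real K * (1 / real K))"
      using p assms by (intro sum.cong refl, subst prob_box) auto
    also have "\<dots> = 1 / K" using assms by simp
    finally show "card (D p) / real K ^ n \<le> 1 / K" .
  qed
  also have "\<dots> = card T / K" by simp
  also have "\<dots> \<le> real n ^ 2 / K"
  proof -
    have "card T \<le> card ({1..n} \<times> {1..n})" unfolding T_def by (intro card_mono) auto
    then have "card T \<le> n * n" by simp
    then have "real (card T) \<le> real (n * n)" by (rule of_nat_mono)
    then show ?thesis by (intro divide_right_mono) (auto simp: power2_eq_square)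
  qed
  finally show ?thesis .
qed

lemma freq_le_prob: "freq n K Q \<le> prob n K Q"
  unfolding freq_def prob_def labelings_def using finite_funcs
  by (intro divide_right_mono of_nat_mono card_mono) auto

lemma prob_le_freq:
  assumes "0 < K"
  shows "prob n K Q - real n ^ 2 / K \<le> freq n K Q"
proof -
  let ?F = "{1..n} \<rightarrow>\<^sub>E {..<K}"
  have "{f \<in> ?F. Q f} \<subseteq> {f \<in> labelings n K. Q f} \<union> {f \<in> ?F. \<not> inj_on f {1..n}}"
    by (auto simp: labelings_def)
  then have "card {f \<in> ?F. Q f} \<le> card ({f \<in> labelings n K. Q f} \<union> {f \<in> ?F. \<not> inj_on f {1..n}})"
    using finite_funcs finite_labelings by (intro card_mono) auto
  also have "\<dots> \<le> card {f \<in> labelings n K. Q f} + card {f \<in> ?F. \<not> inj_on f {1..n}}" by (rule card_Un_le)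
  finally have "real (card {f \<in> ?F. Q f}) \<le> card {f \<in> labelings n K. Q f} + card {f \<in> ?F. \<not> inj_on f {1..n}}"
    by (simp flip: of_nat_add)
  then have "prob n K Q \<le> freq n K Q + prob n K (\<lambda>f. \<not> inj_on f {1..n})"
    unfolding prob_def freq_def by (simp add: add_divide_distrib[symmetric] divide_right_mono)
  then show ?thesis using prob_noninj[OF assms, of n] by linarith
qed

text \<open>The counterpart of \<open>sum_le_Rfun\<close> with left endpoints.\<close>

lemma Rfun_le_sum:
  fixes a n d :: nat
  assumes d: "0 < d" and n: "0 < n" and a: "a \<le> n" and y: "0 \<le> y" "y \<le> 1"
  shows "n * Rfun d (a / n) y \<le> (\<Sum>i<a. min y ((1 - real i / real n) ^ d))"
  using a
proof (induction a)
  case 0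
  have "Rfun d 0 y = 0" using y d by (subst Rfun_le) auto
  then show ?case by simp
next
  case (Suc a)
  have "Rfun d (Suc a / n) y - Rfun d (a / n) y \<le> (Suc a / real n - a / real n) * min y ((1 - a / real n) ^ d)"
    using Suc.prems n y d by (intro Rfun_increment) (auto simp: field_simps)
  moreover have "Suc a / real n - a / real n = 1 / n" by (simp add: diff_divide_distrib[symmetric])
  ultimately have "Rfun d (Suc a / n) y - Rfun d (a / n) y \<le> 1 / n * min y ((1 - a / real n) ^ d)" by simp
  then have "n * (Rfun d (Suc a / n) y - Rfun d (a / n) y) \<le> n * (1 / n * min y ((1 - a / real n) ^ d))"
    by (intro mult_left_mono) auto
  then have "n * Rfun d (Suc a / n) y - n * Rfun d (a / n) y \<le> min y ((1 - a / real n) ^ d)"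
    using n by (simp add: right_diff_distrib)
  then show ?case using Suc.IH[OF Suc_leD[OF Suc.prems]] unfolding sum.lessThan_Suc by linarith
qed

text \<open>The sum runs over the label \<open>t\<close> of the point; given it, all
  \<open>d\<close> labels of the set must be below \<open>min t m\<close>.\<close>

definition up_prob :: "nat \<Rightarrow> nat \<Rightarrow> nat \<Rightarrow> nat \<Rightarrow> real" where
  "up_prob d K a m = (\<Sum>t\<in>{a..<K}. (real (min t m) / real K) ^ d / K)"

lemma prob_up:
  assumes d: "2 \<le> d" and K: "0 < K" "m \<le> K" and S: "S \<subseteq> {1..n}" "card S = d" and x: "x \<in> {1..n}" "x \<notin> S"
  shows "prob n K (\<lambda>f. a \<le> f x \<and> (\<forall>i\<in>S. f i < min (f x) m)) = up_prob d K a m"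
proof -
  let ?F = "{1..n} \<rightarrow>\<^sub>E {..<K}"
  define B where "B t i = (if i = x then {t} else {..<min t m})" for t i :: nat
  define Q where "Q t f \<longleftrightarrow> (\<forall>i\<in>insert x S. f i \<in> B t i)" for t f
  have fS: "finite S" using S finite_subset by blast
  have Q: "Q t f \<longleftrightarrow> f x = t \<and> (\<forall>i\<in>S. f i < min t m)" for t f
    using x by (auto simp: Q_def B_def)
  have "{f \<in> ?F. a \<le> f x \<and> (\<forall>i\<in>S. f i < min (f x) m)} = (\<Union>t\<in>{a..<K}. {f \<in> ?F. Q t f})"
    using x(1) by (auto simp: Q PiE_iff)
  then have "card {f \<in> ?F. a \<le> f x \<and> (\<forall>i\<in>S. f i < min (f x) m)} = (\<Sum>t\<in>{a..<K}. card {f \<in> ?F. Q t f})"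
    using finite_funcs by (simp only:, subst card_UN_disjoint) (auto simp: Q)
  then have "prob n K (\<lambda>f. a \<le> f x \<and> (\<forall>i\<in>S. f i < min (f x) m)) = (\<Sum>t\<in>{a..<K}. prob n K (Q t))"
    by (simp add: prob_def sum_divide_distrib)
  also have "\<dots> = up_prob d K a m"
    unfolding up_prob_def
  proof (intro sum.cong refl)
    fix t assume t: "t \<in> {a..<K}"
    have "prob n K (Q t) = (\<Prod>i\<in>insert x S. card (B t i) / real K)"
      unfolding Q_def[abs_def] using K t S x by (intro prob_box) (auto simp: B_def)
    also have "\<dots> = 1 / K * (\<Prod>i\<in>S. card (B t i) / real K)"
      using fS x by (simp add: B_def)
    also have "(\<Prod>i\<in>S. card (B t i) / real K) = (\<Prod>i\<in>S. real (min t m) / real K)"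
      using x by (intro prod.cong) (auto simp: B_def)
    finally show "prob n K (Q t) = (real (min t m) / real K) ^ d / K" using S by simp
  qed
  finally show ?thesis .
qed

text \<open>Counting \<open>i = K - t\<close> from the top turns \<open>up_prob\<close> into a
  right-endpoint sum for \<open>R\<close>. Adding the term for \<open>i = 0\<close>, which is at
  most \<open>1\<close>, covers the left-endpoint sum; hence the error \<open>1 / K\<close>.\<close>

lemma up_prob_bounds:
  assumes d: "0 < d" and K: "0 < K" "a \<le> K" "m \<le> K"
  shows "up_prob d K a m \<le> Rfun d (real (K - a) / real K) ((real m / real K) ^ d)"
    and "Rfun d (real (K - a) / real K) ((real m / real K) ^ d) - 1 / K \<le> up_prob d K a m"
proof -
  define y where "y = (m / real K) ^ d"
  have y: "0 \<le> y" "y \<le> 1" using K by (auto simp: y_def power_le_one)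
  define g where "g i = min y ((1 - real i / real K) ^ d)" for i
  have eq: "K * up_prob d K a m = (\<Sum>i\<in>{1..K - a}. g i)"
  proof -
    have "K * up_prob d K a m = (\<Sum>t\<in>{a..<K}. (real (min t m) / real K) ^ d)"
      using K by (simp add: up_prob_def sum_distrib_left)
    also have "\<dots> = (\<Sum>i\<in>{1..K - a}. (real (min (K - i) m) / real K) ^ d)"
      using K by (intro sum.reindex_bij_witness[of _ "\<lambda>i. K - i" "\<lambda>t. K - t"]) auto
    also have "\<dots> = (\<Sum>i\<in>{1..K - a}. g i)"
    proof (intro sum.cong refl)
      fix i assume "i \<in> {1..K - a}"
      then have i: "i \<le> K" by auto
      have e: "1 - real i / real K = real (K - i) / K" using K i by (simp add: of_nat_diff diff_divide_distrib)
      show "(real (min (K - i) m) / real K) ^ d = g i"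
      proof (cases "K - i \<le> m")
        case True
        then have "(real (K - i) / K) ^ d \<le> (m / real K) ^ d"
          by (intro power_mono divide_right_mono) auto
        then show ?thesis using True unfolding g_def e y_def by (simp add: min_absorb1 min_absorb2)
      next
        case False
        then have "(m / real K) ^ d \<le> (real (K - i) / K) ^ d"
          by (intro power_mono divide_right_mono) auto
        then show ?thesis using False unfolding g_def e y_def by (simp add: min_absorb1 min_absorb2)
      qed
    qed
    finally show ?thesis .
  qed
  have q: "real K - real a = real (K - a)" using K by (simp add: of_nat_diff)
  have "K * up_prob d K a m \<le> K * Rfun d (real (K - a) / K) y"
    unfolding eq g_def using d K y by (intro sum_le_Rfun) auto
  then show "up_prob d K a m \<le> Rfun d (real (K - a) / real K) ((real m / real K) ^ d)"
    using K by (simp add: y_def)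
  have "K * Rfun d (real (K - a) / K) y \<le> (\<Sum>i<K - a. g i)"
    unfolding g_def using d K y by (intro Rfun_le_sum) auto
  also have "\<dots> \<le> (\<Sum>i\<in>insert 0 {1..K - a}. g i)"
    using y K by (intro sum_mono2) (auto simp: g_def)
  also have "\<dots> = g 0 + K * up_prob d K a m" unfolding eq by simp
  also have "\<dots> \<le> 1 + K * up_prob d K a m" using y by (simp add: g_def)
  finally show "Rfun d (real (K - a) / real K) ((real m / real K) ^ d) - 1 / K \<le> up_prob d K a m"
    using K by (simp add: y_def field_simps)
qed

section \<open>Frequencies within one family\<close>

context
  fixes d n K a m :: nat and q v :: real
  assumes d: "2 \<le> d" and K: "0 < K" "a \<le> K" "m \<le> K"
    and q: "q = real (K - a) / K" and v: "v = real m / K"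
begin

abbreviation "partial_ext \<equiv> colex_ext d n a m"

lemma labelings_cases: "f \<in> labelings n K \<Longrightarrow> inj_on f {1..n} \<and> (\<forall>i\<in>{1..n}. f i < K)"
  by (auto simp: labelings_def PiE_iff)

lemma freq_cong:
  assumes "\<And>f. inj_on f {1..n} \<Longrightarrow> (\<forall>i\<in>{1..n}. f i < K) \<Longrightarrow> Q f \<longleftrightarrow> R f"
  shows "freq n K Q = freq n K R"
proof -
  have "{f \<in> labelings n K. Q f} = {f \<in> labelings n K. R f}" using assms labelings_cases by blast
  then show ?thesis by (simp add: freq_def)
qed

lemma freq_singleton:
  assumes "x \<in> {1..n}"
  shows "freq n K (\<lambda>f. {x} \<in> Field (partial_ext f)) \<le> q" "q - real n ^ 2 / K \<le> freq n K (\<lambda>f. {x} \<in> Field (partial_ext f))"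
proof -
  have "freq n K (\<lambda>f. {x} \<in> Field (partial_ext f)) = freq n K (\<lambda>f. \<forall>i\<in>{x}. f i \<in> {a..<K})"
    using assms d by (intro freq_cong) (simp add: Field_colex_ext singleton_member)
  moreover have "prob n K (\<lambda>f. \<forall>i\<in>{x}. f i \<in> {a..<K}) = q"
    using assms K q by (subst prob_box) auto
  ultimately show "freq n K (\<lambda>f. {x} \<in> Field (partial_ext f)) \<le> q" "q - real n ^ 2 / K \<le> freq n K (\<lambda>f. {x} \<in> Field (partial_ext f))"
    using freq_le_prob[of n K "\<lambda>f. \<forall>i\<in>{x}. f i \<in> {a..<K}"] prob_le_freq[OF K(1), of n "\<lambda>f. \<forall>i\<in>{x}. f i \<in> {a..<K}"]
    by linarith+
qed

lemma freq_set:
  assumes "S \<subseteq> {1..n}" "card S = d"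
  shows "freq n K (\<lambda>f. S \<in> Field (partial_ext f)) \<le> v ^ d" "v ^ d - real n ^ 2 / K \<le> freq n K (\<lambda>f. S \<in> Field (partial_ext f))"
proof -
  have "freq n K (\<lambda>f. S \<in> Field (partial_ext f)) = freq n K (\<lambda>f. \<forall>i\<in>S. f i \<in> {..<m})"
    using assms d by (intro freq_cong) (simp add: Field_colex_ext set_member)
  moreover have "prob n K (\<lambda>f. \<forall>i\<in>S. f i \<in> {..<m}) = v ^ d"
    using assms K v by (subst prob_box) auto
  ultimately show "freq n K (\<lambda>f. S \<in> Field (partial_ext f)) \<le> v ^ d" "v ^ d - real n ^ 2 / K \<le> freq n K (\<lambda>f. S \<in> Field (partial_ext f))"
    using freq_le_prob[of n K "\<lambda>f. \<forall>i\<in>S. f i \<in> {..<m}"] prob_le_freq[OF K(1), of n "\<lambda>f. \<forall>i\<in>S. f i \<in> {..<m}"]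
    by linarith+
qed

text \<open>The label of \<open>x\<close> must lie in \<open>[a, m)\<close>, the other
  \<open>d - 1\<close> labels below \<open>m\<close>. The difference \<open>m - a\<close> is
  truncated at \<open>0\<close>, so \<open>v + q - 1\<close> is a lower bound for its share.\<close>

lemma freq_comparable:
  assumes S: "S \<subseteq> {1..n}" "card S = d" and x: "x \<in> S"
  shows "v ^ (d - 1) * (v + q - 1) - real n ^ 2 / K \<le> freq n K (\<lambda>f. ({x}, S) \<in> partial_ext f)"
proof -
  define B where "B i = (if i = x then {a..<m} else {..<m})" for i
  have fS: "finite S" using S finite_subset by blast
  have x1: "x \<in> {1..n}" using S x by auto
  have "freq n K (\<lambda>f. ({x}, S) \<in> partial_ext f) = freq n K (\<lambda>f. \<forall>i\<in>S. f i \<in> B i)"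
  proof (rule freq_cong)
    fix f assume f: "inj_on f {1..n}" "\<forall>i\<in>{1..n}. f i < K"
    have "set_encode (f ` {x}) \<le> set_encode (f ` S)" using x fS by (intro set_encode_mono) auto
    then have "({x}, S) \<in> partial_ext f \<longleftrightarrow> a \<le> f x \<and> (\<forall>i\<in>S. f i < m)"
      using S x1 by (simp add: colex_ext_def singleton_member[OF d] set_member[OF d])
    also have "\<dots> \<longleftrightarrow> (\<forall>i\<in>S. f i \<in> B i)" using x by (auto simp: B_def)
    finally show "({x}, S) \<in> partial_ext f \<longleftrightarrow> (\<forall>i\<in>S. f i \<in> B i)" .
  qed
  moreover have "v ^ (d - 1) * (v + q - 1) \<le> prob n K (\<lambda>f. \<forall>i\<in>S. f i \<in> B i)"
  proof -
    have "prob n K (\<lambda>f. \<forall>i\<in>S. f i \<in> B i) = (\<Prod>i\<in>S. card (B i) / real K)"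
      using S K by (intro prob_box) (auto simp: B_def)
    also have "\<dots> = real (m - a) / K * (\<Prod>i\<in>S - {x}. card (B i) / real K)"
      using fS x by (subst prod.remove[of S x]) (auto simp: B_def)
    also have "(\<Prod>i\<in>S - {x}. card (B i) / real K) = (\<Prod>i\<in>S - {x}. v)"
      by (intro prod.cong) (auto simp: B_def v)
    also have "\<dots> = v ^ (d - 1)" using S x fS by simp
    finally have "prob n K (\<lambda>f. \<forall>i\<in>S. f i \<in> B i) = real (m - a) / K * v ^ (d - 1)" .
    moreover have "v + q - 1 \<le> real (m - a) / K"
    proof -
      have "v + q - 1 = (real m - real a) / K" using K by (simp add: v q of_nat_diff field_simps)
      also have "\<dots> \<le> real (m - a) / K" by (intro divide_right_mono) linarith+
      finally show ?thesis .
    qed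
    moreover have "0 \<le> v ^ (d - 1)" by (simp add: v)
    ultimately show ?thesis
      using mult_left_mono[of "v + q - 1" "real (m - a) / K" "v ^ (d - 1)"] by (simp only: mult.commute)
  qed
  ultimately show ?thesis using prob_le_freq[OF K(1), of n "\<lambda>f. \<forall>i\<in>S. f i \<in> B i"] by linarith
qed

lemma freq_half:
  assumes "S \<subseteq> {1..n}" "T \<subseteq> {1..n}" "card S = card T" "card S \<in> {1, d}"
  shows "freq n K (\<lambda>f. S \<in> Field (partial_ext f) \<and> T \<in> Field (partial_ext f)) / 2 \<le> freq n K (\<lambda>f. (T, S) \<in> partial_ext f)"
proof -
  let ?A = "{f \<in> labelings n K. (S, T) \<in> partial_ext f}" and ?B = "{f \<in> labelings n K. (T, S) \<in> partial_ext f}"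
  have "{f \<in> labelings n K. S \<in> Field (partial_ext f) \<and> T \<in> Field (partial_ext f)} \<subseteq> ?A \<union> ?B"
    unfolding Field_colex_ext using colex_ext_total[of S d n a m _ T] by blast
  then have "card {f \<in> labelings n K. S \<in> Field (partial_ext f) \<and> T \<in> Field (partial_ext f)} \<le> card (?A \<union> ?B)"
    using finite_labelings by (intro card_mono) auto
  also have "\<dots> \<le> card ?A + card ?B" by (rule card_Un_le)
  also have "\<dots> \<le> 2 * card ?B" using colex_ext_swap[OF d assms, of K a m] by linarith
  finally have "real (card {f \<in> labelings n K. S \<in> Field (partial_ext f) \<and> T \<in> Field (partial_ext f)}) \<le> 2 * real (card ?B)"
    by linarith
  then have "freq n K (\<lambda>f. S \<in> Field (partial_ext f) \<and> T \<in> Field (partial_ext f)) \<le> 2 * freq n K (\<lambda>f. (T, S) \<in> partial_ext f)"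
    unfolding freq_def times_divide_eq_right by (rule divide_right_mono) simp
  then show ?thesis by simp
qed

lemma freq_singletons:
  assumes "x \<in> {1..n}" "y \<in> {1..n}" "x \<noteq> y"
  shows "(q\<^sup>2 - real n ^ 2 / K) / 2 \<le> freq n K (\<lambda>f. ({y}, {x}) \<in> partial_ext f)"
proof -
  have "freq n K (\<lambda>f. {x} \<in> Field (partial_ext f) \<and> {y} \<in> Field (partial_ext f)) = freq n K (\<lambda>f. \<forall>i\<in>{x, y}. f i \<in> {a..<K})"
    using assms d by (intro freq_cong) (auto simp: Field_colex_ext singleton_member)
  moreover have "prob n K (\<lambda>f. \<forall>i\<in>{x, y}. f i \<in> {a..<K}) = q\<^sup>2"
    using assms K q by (subst prob_box) (auto simp: power2_eq_square)
  ultimately have "q\<^sup>2 - real n ^ 2 / K \<le> freq n K (\<lambda>f. {x} \<in> Field (partial_ext f) \<and> {y} \<in> Field (partial_ext f))"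
    using prob_le_freq[OF K(1), of n "\<lambda>f. \<forall>i\<in>{x, y}. f i \<in> {a..<K}"] by linarith
  then show ?thesis using freq_half[of "{x}" "{y}"] assms by simp
qed

lemma freq_sets:
  assumes S: "S \<subseteq> {1..n}" "card S = d" and T: "T \<subseteq> {1..n}" "card T = d"
  shows "(v ^ (2 * d) - real n ^ 2 / K) / 2 \<le> freq n K (\<lambda>f. (T, S) \<in> partial_ext f)"
proof -
  have "freq n K (\<lambda>f. S \<in> Field (partial_ext f) \<and> T \<in> Field (partial_ext f)) = freq n K (\<lambda>f. \<forall>i\<in>S \<union> T. f i \<in> {..<m})"
    using assms d by (intro freq_cong) (auto simp: Field_colex_ext set_member)
  moreover have "prob n K (\<lambda>f. \<forall>i\<in>S \<union> T. f i \<in> {..<m}) = v ^ card (S \<union> T)"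
    using assms K v by (subst prob_box) auto
  ultimately have "v ^ card (S \<union> T) - real n ^ 2 / K \<le> freq n K (\<lambda>f. S \<in> Field (partial_ext f) \<and> T \<in> Field (partial_ext f))"
    using prob_le_freq[OF K(1), of n "\<lambda>f. \<forall>i\<in>S \<union> T. f i \<in> {..<m}"] by linarith
  \<comment> \<open>Disjoint sets are the worst case: overlapping ones impose fewer
    conditions.\<close>
  moreover have "v ^ (2 * d) \<le> v ^ card (S \<union> T)"
    using card_Un_le[of S T] assms K v by (intro power_decreasing) auto
  ultimately show ?thesis using freq_half[of S T] assms by simp
qed

lemma freq_up:
  assumes S: "S \<subseteq> {1..n}" "card S = d" and x: "x \<in> {1..n}" "x \<notin> S"
  shows "Rfun d q (v ^ d) - 1 / K - real n ^ 2 / K \<le> freq n K (\<lambda>f. (S, {x}) \<in> partial_ext f)"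
    and "freq n K (\<lambda>f. (S, {x}) \<in> partial_ext f) \<le> Rfun d q (v ^ d)"
proof -
  have "freq n K (\<lambda>f. (S, {x}) \<in> partial_ext f) = freq n K (\<lambda>f. a \<le> f x \<and> (\<forall>i\<in>S. f i < min (f x) m))"
    using assms d by (intro freq_cong below_singleton_iff) auto
  moreover have "prob n K (\<lambda>f. a \<le> f x \<and> (\<forall>i\<in>S. f i < min (f x) m)) = up_prob d K a m"
    by (rule prob_up[OF d K(1,3) S x])
  ultimately have "up_prob d K a m - real n ^ 2 / K \<le> freq n K (\<lambda>f. (S, {x}) \<in> partial_ext f)"
    "freq n K (\<lambda>f. (S, {x}) \<in> partial_ext f) \<le> up_prob d K a m"
    using freq_le_prob[of n K "\<lambda>f. a \<le> f x \<and> (\<forall>i\<in>S. f i < min (f x) m)"]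
      prob_le_freq[OF K(1), of n "\<lambda>f. a \<le> f x \<and> (\<forall>i\<in>S. f i < min (f x) m)"] by linarith+
  then show "Rfun d q (v ^ d) - 1 / K - real n ^ 2 / K \<le> freq n K (\<lambda>f. (S, {x}) \<in> partial_ext f)"
    "freq n K (\<lambda>f. (S, {x}) \<in> partial_ext f) \<le> Rfun d q (v ^ d)"
    using up_prob_bounds[of d K a m] d K unfolding q v by auto
qed

text \<open>Joint presence minus the opposite order; this is where the upper estimate of
  \<open>freq_up\<close> enters.\<close>

lemma freq_down:
  assumes S: "S \<subseteq> {1..n}" "card S = d" and x: "x \<in> {1..n}" "x \<notin> S"
  shows "q * v ^ d - real n ^ 2 / K - Rfun d q (v ^ d) \<le> freq n K (\<lambda>f. ({x}, S) \<in> partial_ext f)"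
proof -
  define B where "B i = (if i = x then {a..<K} else {..<m})" for i
  let ?Q = "\<lambda>f. \<forall>i\<in>insert x S. f i \<in> B i"
  have fS: "finite S" using S finite_subset by blast
  have "prob n K ?Q = (\<Prod>i\<in>insert x S. card (B i) / real K)"
    using S x K by (intro prob_box) (auto simp: B_def)
  also have "\<dots> = q * (\<Prod>i\<in>S. card (B i) / real K)" using fS x by (simp add: B_def q)
  also have "(\<Prod>i\<in>S. card (B i) / real K) = (\<Prod>i\<in>S. v)"
    using x by (intro prod.cong) (auto simp: B_def v)
  finally have "prob n K ?Q = q * v ^ d" using S by simp
  then have 1: "q * v ^ d - real n ^ 2 / K \<le> freq n K ?Q" using prob_le_freq[OF K(1), of n ?Q] by linarith
  have "{f \<in> labelings n K. ?Q f} \<subseteq> {f \<in> labelings n K. ({x}, S) \<in> partial_ext f} \<union> {f \<in> labelings n K. (S, {x}) \<in> partial_ext f}"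
  proof
    fix f assume f: "f \<in> {f \<in> labelings n K. ?Q f}"
    then have "f i \<in> B i" if "i \<in> insert x S" for i using that by blast
    moreover have "B i = {..<m}" if "i \<in> S" for i using that x by (auto simp: B_def)
    ultimately have "a \<le> f x" "\<forall>i\<in>S. f i < m" by (force simp: B_def)+
    then have "{x} \<in> members d n a m f" "S \<in> members d n a m f"
      using S x d by (auto simp: singleton_member set_member)
    then show "f \<in> {f \<in> labelings n K. ({x}, S) \<in> partial_ext f} \<union> {f \<in> labelings n K. (S, {x}) \<in> partial_ext f}"
      using colex_ext_total[of "{x}" d n a m f S] f by blast
  qed
  then have "card {f \<in> labelings n K. ?Q f} \<le> card ({f \<in> labelings n K. ({x}, S) \<in> partial_ext f} \<union> {f \<in> labelings n K. (S, {x}) \<in> partial_ext f})"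
    using finite_labelings by (intro card_mono) auto
  also have "\<dots> \<le> card {f \<in> labelings n K. ({x}, S) \<in> partial_ext f} + card {f \<in> labelings n K. (S, {x}) \<in> partial_ext f}"
    by (rule card_Un_le)
  finally have "real (card {f \<in> labelings n K. ?Q f}) \<le> real (card {f \<in> labelings n K. ({x}, S) \<in> partial_ext f}) + real (card {f \<in> labelings n K. (S, {x}) \<in> partial_ext f})"
    by linarith
  then have "freq n K ?Q \<le> freq n K (\<lambda>f. ({x}, S) \<in> partial_ext f) + freq n K (\<lambda>f. (S, {x}) \<in> partial_ext f)"
    unfolding freq_def add_divide_distrib[symmetric] by (rule divide_right_mono) simp
  then show ?thesis using 1 freq_up(2)[OF S x] by linarith
qed

end

section \<open>Two families combined\<close>

lemma sum_two_families:
  "(\<Sum>i | i \<in> labelings n K \<times> (UNIV :: bool set) \<and> Q (E (fst i) (snd i)). (if snd i then W1 else W2) / (real K ^ n * \<rho>))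
    = (W1 * freq n K (\<lambda>f. Q (E f True)) + W2 * freq n K (\<lambda>f. Q (E f False))) / \<rho>"
proof -
  have "{i. i \<in> labelings n K \<times> (UNIV :: bool set) \<and> Q (E (fst i) (snd i))}
      = (\<lambda>f. (f, True)) ` {f \<in> labelings n K. Q (E f True)} \<union> (\<lambda>f. (f, False)) ` {f \<in> labelings n K. Q (E f False)}"
    (is "_ = ?A \<union> ?B")
    by (auto simp: image_iff) (metis (full_types))+
  then have "(\<Sum>i | i \<in> labelings n K \<times> (UNIV :: bool set) \<and> Q (E (fst i) (snd i)). (if snd i then W1 else W2) / (real K ^ n * \<rho>))
      = (\<Sum>i\<in>?A. (if snd i then W1 else W2) / (real K ^ n * \<rho>)) + (\<Sum>i\<in>?B. (if snd i then W1 else W2) / (real K ^ n * \<rho>))"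
    using finite_labelings by (simp only:, intro sum.union_disjoint) auto
  also have "\<dots> = card {f \<in> labelings n K. Q (E f True)} * (W1 / (real K ^ n * \<rho>))
      + card {f \<in> labelings n K. Q (E f False)} * (W2 / (real K ^ n * \<rho>))"
    by (simp add: sum.reindex inj_on_def)
  also have "\<dots> = (W1 * freq n K (\<lambda>f. Q (E f True)) + W2 * freq n K (\<lambda>f. Q (E f False))) / \<rho>"
    by (simp add: freq_def add_divide_distrib mult.commute)
  finally show ?thesis .
qed

text \<open>\<open>W1\<close> and \<open>W2\<close> are the total weights of the two families; in
  the second every singleton and every set is present (\<open>q = v = 1\<close>). \<rho> is a level
  reached by all demands, and dividing the weights by it produces a realizer. \<open>e\<close> is
  the loss from non-injective labelings.\<close>

lemma fldim_le_two_families: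
  fixes W1 W2 \<rho> C q v :: real
  assumes d: "2 \<le> d" "d \<le> n" and K: "0 < K" "a \<le> K" "m \<le> K"
    and q: "q = real (K - a) / K" and v: "v = real m / K"
    and W: "0 \<le> W1" "0 \<le> W2" and \<rho>: "0 < \<rho>"
    and e: "e = real n ^ 2 / K"
    and self: "\<rho> \<le> W1 * (q - e) + W2 * (1 - e)" "\<rho> \<le> W1 * (v ^ d - e) + W2 * (1 - e)"
    and comp: "\<rho> \<le> W1 * (v ^ (d - 1) * (v + q - 1) - e) + W2 * (1 - e)"
    and pair: "\<rho> \<le> (W1 * (q\<^sup>2 - e) + W2 * (1 - e)) / 2" "\<rho> \<le> (W1 * (v ^ (2 * d) - e) + W2 * (1 - e)) / 2"
    and up: "\<rho> \<le> W1 * (Rfun d q (v ^ d) - 1 / K - e) + W2 * (Rfun d 1 1 - 1 / K - e)"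
    and down: "\<rho> \<le> W1 * (q * v ^ d - e - Rfun d q (v ^ d)) + W2 * (1 - e - Rfun d 1 1)"
    and C: "W1 * q + W2 \<le> C" "W1 * v ^ d + W2 \<le> C"
  shows "fldim (subset_poset d n) \<le> C / \<rho>"
proof -
  let ?P = "subset_poset d n"
  define E where "E f t = colex_ext d n (if t then a else 0) (if t then m else K) f" for f t
  define I where "I = labelings n K \<times> (UNIV :: bool set)"
  define c where "c i = (if snd i then W1 else W2) / (real K ^ n * \<rho>)" for i :: "(nat \<Rightarrow> nat) \<times> bool"
  have E: "E f True = colex_ext d n a m f" "E f False = colex_ext d n 0 K f" for f by (simp_all add: E_def)
  have q2: "(1::real) = real (K - 0) / K" and v2: "(1::real) = real K / K" using K by auto
  note fam1 = d(1) K(1,2,3) q v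
  note fam2 = d(1) K(1) le0 order_refl q2 v2
  have sum: "(\<Sum>i | i \<in> I \<and> Q (E (fst i) (snd i)). c i)
      = (W1 * freq n K (\<lambda>f. Q (colex_ext d n a m f)) + W2 * freq n K (\<lambda>f. Q (colex_ext d n 0 K f))) / \<rho>" for Q
    unfolding I_def c_def sum_two_families E by simp
  have ge: "1 \<le> (\<Sum>i | i \<in> I \<and> Q (E (fst i) (snd i)). c i)"
    if "b1 \<le> freq n K (\<lambda>f. Q (colex_ext d n a m f))" "b2 \<le> freq n K (\<lambda>f. Q (colex_ext d n 0 K f))"
      "\<rho> \<le> W1 * b1 + W2 * b2" for Q b1 b2
  proof -
    have "W1 * b1 + W2 * b2 \<le> W1 * freq n K (\<lambda>f. Q (colex_ext d n a m f)) + W2 * freq n K (\<lambda>f. Q (colex_ext d n 0 K f))"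
      using that W by (intro add_mono mult_left_mono) auto
    then show ?thesis unfolding sum using that \<rho> by simp
  qed
  have pair': "\<rho> \<le> W1 * ((q\<^sup>2 - e) / 2) + W2 * ((1 - e) / 2)" "\<rho> \<le> W1 * ((v ^ (2 * d) - e) / 2) + W2 * ((1 - e) / 2)"
    using pair by (simp_all add: add_divide_distrib)
  have FP: "u \<in> Field ?P \<longleftrightarrow> (\<exists>x\<in>{1..n}. u = {x}) \<or> (u \<subseteq> {1..n} \<and> card u = d)" for u
    unfolding Field_subset_poset by (auto simp: card_1_singleton_iff)
  have n0: "{1} \<in> Field ?P" using d unfolding FP by auto
  show ?thesis
  proof (rule fldim_le_mixture[where c = c and I = I and E = "\<lambda>i. E (fst i) (snd i)"])
    show "finite (Field ?P)" by (rule finite_Field_subset_poset)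
    show "Field ?P \<noteq> {}" using n0 by blast
    show "Partial_order ?P" by (rule partial_order_subset_poset)
    show "finite I" unfolding I_def using finite_labelings by simp
    show "0 \<le> c i" for i using W \<rho> by (simp add: c_def)
    show "E (fst i) (snd i) \<in> ple ?P" if "i \<in> I" for i
      using that d(1) unfolding E_def I_def labelings_def by (intro colex_ext_ple) auto
  next
    fix u assume "u \<in> Field ?P"
    then consider x where "x \<in> {1..n}" "u = {x}" | "u \<subseteq> {1..n}" "card u = d" unfolding FP by blast
    then have "W1 * freq n K (\<lambda>f. u \<in> Field (colex_ext d n a m f)) + W2 * freq n K (\<lambda>f. u \<in> Field (colex_ext d n 0 K f)) \<le> C"
    proof cases
      case 1
      have "W1 * freq n K (\<lambda>f. u \<in> Field (colex_ext d n a m f)) \<le> W1 * q"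
        "W2 * freq n K (\<lambda>f. u \<in> Field (colex_ext d n 0 K f)) \<le> W2 * 1"
        unfolding 1(2) using freq_singleton(1)[OF fam1 1(1)] freq_singleton(1)[OF fam2 1(1)] W
        by (intro mult_left_mono; simp)+
      then show ?thesis using C by simp
    next
      case 2
      have "W1 * freq n K (\<lambda>f. u \<in> Field (colex_ext d n a m f)) \<le> W1 * v ^ d"
        "W2 * freq n K (\<lambda>f. u \<in> Field (colex_ext d n 0 K f)) \<le> W2 * 1"
        using freq_set(1)[OF fam1 2] freq_set(1)[OF fam2 2] W
        by (intro mult_left_mono; simp)+
      then show ?thesis using C by simp
    qed
    then show "(\<Sum>i | i \<in> I \<and> u \<in> Field (E (fst i) (snd i)). c i) \<le> C / \<rho>"
      unfolding sum[of "\<lambda>M. u \<in> Field M"] using \<rho> by (intro divide_right_mono) auto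
  next
    fix u w assume uw: "(u, w) \<in> ?P"
    then have F: "u \<in> Field ?P" "w \<in> Field ?P" "u \<subseteq> w" by (auto intro: FieldI1 FieldI2 simp: subset_poset_def)
    have fin: "finite w" using F unfolding FP using finite_subset by auto
    have refl: "(X, X) \<in> colex_ext d n b l f \<longleftrightarrow> X \<in> Field (colex_ext d n b l f)" for X b l f
      unfolding Field_colex_ext by (simp add: colex_ext_def)
    consider x where "x \<in> {1..n}" "u = {x}" "w = {x}" | "u = w" "w \<subseteq> {1..n}" "card w = d"
      | x where "u = {x}" "w \<subseteq> {1..n}" "card w = d" "x \<in> w"
    proof -
      consider x where "x \<in> {1..n}" "u = {x}" | "u \<subseteq> {1..n}" "card u = d" using F(1) unfolding FP by blast
      then show ?thesis
      proof cases
        case 1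
        then show ?thesis using F that(1)[of x] that(3)[of x] unfolding FP by auto
      next
        case 2
        have "card u \<le> card w" using F fin by (intro card_mono) auto
        then have "card w = d" "w \<subseteq> {1..n}" using F(2) 2 d(1) unfolding FP by auto
        then have "u = w" using 2 F fin by (intro card_subset_eq) auto
        then show ?thesis using that(2) \<open>card w = d\<close> \<open>w \<subseteq> {1..n}\<close> by blast
      qed
    qed
    then show "1 \<le> (\<Sum>i | i \<in> I \<and> (u, w) \<in> E (fst i) (snd i). c i)"
    proof cases
      case 1
      show ?thesis unfolding 1(2,3)
        by (rule ge[of "q - e" "\<lambda>M. ({x}, {x}) \<in> M" "1 - e"]; unfold refl e)
          (use freq_singleton(2)[OF fam1 1(1)] freq_singleton(2)[OF fam2 1(1)] self(1) in \<open>simp_all add: e\<close>)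
    next
      case 2
      show ?thesis unfolding 2(1)
        by (rule ge[of "v ^ d - e" "\<lambda>M. (w, w) \<in> M" "1 - e"]; unfold refl e)
          (use freq_set(2)[OF fam1 2(2,3)] freq_set(2)[OF fam2 2(2,3)] self(2) in \<open>simp_all add: e\<close>)
    next
      case 3
      show ?thesis unfolding 3(1)
        by (rule ge[of "v ^ (d - 1) * (v + q - 1) - e" "\<lambda>M. ({x}, w) \<in> M" "1 - e"]; unfold e)
          (use freq_comparable[OF fam1 3(2,3,4)] freq_comparable[OF fam2 3(2,3,4)] comp in \<open>simp_all add: e\<close>)
    qed
  next
    fix u w assume F: "u \<in> Field ?P" "w \<in> Field ?P" and inc: "(u, w) \<notin> ?P" "(w, u) \<notin> ?P"
    have ne: "u \<noteq> w" using F(1) inc unfolding FP by (auto simp: subset_poset_def)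
    have inc': "x \<notin> S" if "({x}, S) \<notin> ?P" "x \<in> {1..n}" "S \<subseteq> {1..n}" "card S = d" for x S
      using that by (auto simp: subset_poset_def)
    consider x y where "u = {x}" "w = {y}" "x \<in> {1..n}" "y \<in> {1..n}" | x where "u = {x}" "x \<in> {1..n}" "w \<subseteq> {1..n}" "card w = d"
      | y where "w = {y}" "y \<in> {1..n}" "u \<subseteq> {1..n}" "card u = d" | "u \<subseteq> {1..n}" "card u = d" "w \<subseteq> {1..n}" "card w = d"
      using F unfolding FP by blast
    then show "1 \<le> (\<Sum>i | i \<in> I \<and> (w, u) \<in> E (fst i) (snd i). c i)"
    proof cases
      case 1
      have xy: "x \<noteq> y" using ne 1 by auto
      show ?thesis unfolding 1(1,2)
        by (rule ge[of "(q\<^sup>2 - e) / 2" "\<lambda>M. ({y}, {x}) \<in> M" "(1 - e) / 2"])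
          (use freq_singletons[OF fam1 1(3,4) xy] freq_singletons[OF fam2 1(3,4) xy] pair'(1) in \<open>simp_all add: e\<close>)
    next
      case 2
      have xS: "x \<notin> w" using inc' 2 inc by blast
      show ?thesis unfolding 2(1)
        by (rule ge[of "Rfun d q (v ^ d) - 1 / K - e" "\<lambda>M. (w, {x}) \<in> M" "Rfun d 1 1 - 1 / K - e"])
          (use freq_up(1)[OF fam1 2(3,4,2) xS] freq_up(1)[OF fam2 2(3,4,2) xS] up in \<open>simp_all add: e\<close>)
    next
      case 3
      have xS: "y \<notin> u" using inc' 3 inc by blast
      show ?thesis unfolding 3(1)
        by (rule ge[of "q * v ^ d - e - Rfun d q (v ^ d)" "\<lambda>M. ({y}, u) \<in> M" "1 - e - Rfun d 1 1"])
          (use freq_down[OF fam1 3(3,4,2) xS] freq_down[OF fam2 3(3,4,2) xS] down in \<open>simp_all add: e\<close>)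
    next
      case 4
      show ?thesis
        by (rule ge[of "(v ^ (2 * d) - e) / 2" "\<lambda>M. (w, u) \<in> M" "(1 - e) / 2"])
          (use freq_sets[OF fam1 4] freq_sets[OF fam2 4] pair'(2) in \<open>simp_all add: e\<close>)
    qed
  qed
qed

lemma tendsto_Rfun:
  assumes "0 < d" "(q \<longlongrightarrow> q') F" "(y \<longlongrightarrow> y') F"
  shows "((\<lambda>k. Rfun d (q k) (y k)) \<longlongrightarrow> Rfun d q' y') F"
proof -
  have "real d + 1 \<noteq> 0" by linarith
  then show ?thesis unfolding Rfun_def Let_def
    using assms by (intro tendsto_intros) auto
qed

text \<open>Only \<open>K\<close> tends to infinity while \<open>n\<close> stays fixed, so the bound
  holds for each \<open>n \<ge> d\<close> without an error term.\<close>

lemma fldim_upper_bound: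
  assumes d: "2 \<le> d" "d \<le> n" and x: "beta d \<le> x" "x < 1" and r: "x\<^sup>2 / 2 \<le> rfun d x"
  shows "fldim (subset_poset d n) \<le> 2 + (real d - 1) * (x - x\<^sup>2) / ((real d + 1) * rfun d x - x\<^sup>2)"
proof -
  define D where "D = (real d + 1) * rfun d x - x\<^sup>2"
  define s where "s = root d x"
  define W1 where "W1 = (real d - 1) / D"
  define W2 where "W2 = 2 - W1 * x\<^sup>2"
  define C where "C = W1 * x + W2"
  have d1: "1 \<le> d" using d by simp
  have x0: "0 < x" using beta[OF d1] x by linarith
  have s: "0 < s" "s < 1" "s ^ d = x" "1 - x \<le> s"
    using x0 x d one_minus_le_root[OF d1 x(1)] by (auto simp: s_def)
  have D: "0 < D" unfolding D_def using D_pos[OF d1 x] .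
  have W1: "0 \<le> W1" "W1 * D = real d - 1" using D d by (simp_all add: W1_def)
  have W2: "0 \<le> W2"
  proof -
    have "(real d + 1) * (x\<^sup>2 / 2) \<le> (real d + 1) * rfun d x" using r by (intro mult_left_mono) auto
    then have "(real d - 1) * x\<^sup>2 \<le> 2 * D" by (simp add: D_def algebra_simps)
    then show ?thesis using D by (simp add: W2_def W1_def divide_le_eq)
  qed
  have sum2: "W1 * x\<^sup>2 + W2 = 2" by (simp add: W2_def)
  have R11: "Rfun d 1 1 = 1 / (real d + 1)"
    using Rfun_diag[of d 1] beta[OF d1] d by (simp add: rfun_1 add.commute)
  have up: "W1 * rfun d x + W2 / (real d + 1) = 1"
  proof -
    have ne: "real d + 1 \<noteq> 0" by linarith
    have "(real d + 1) * (W1 * rfun d x + W2 / (real d + 1)) = W1 * D + (W1 * x\<^sup>2 + W2)"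
      using ne by (simp add: D_def distrib_left) (simp add: algebra_simps)
    also have "\<dots> = (real d + 1) * 1" by (simp add: W1 sum2)
    finally show ?thesis using ne mult_left_cancel by blast
  qed
  \<comment> \<open>A singleton and a set containing it: relative to \<open>x ^ 2\<close> the first
    family loses \<open>x * (1 - x) * (1 - s) / s\<close>. By \<open>1 - x \<le> s\<close> and
    \<open>D_ge\<close> this costs at most \<open>1\<close> of the total
    \<open>W1 * x ^ 2 + W2 = 2\<close>.\<close>
  have comp: "1 \<le> W1 * (s ^ (d - 1) * (s + x - 1)) + W2"
  proof -
    have sx: "s ^ (d - 1) * s = x" using s(3) d by (metis Suc_diff_1 d1 less_eq_Suc_le power_Suc2 One_nat_def)
    have "(1 - x) * (1 - s) * ((real d - 1) * x) \<le> s * (1 - s) * ((real d - 1) * x)"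
      using s x0 d by (intro mult_right_mono) auto
    also have "\<dots> \<le> s * (d * x * (1 - s))" using s x0 by (simp add: algebra_simps)
    also have "\<dots> \<le> s * D" using D_ge[OF d1 x(1)] x s by (simp add: D_def s_def)
    finally have "(real d - 1) * (x * (1 - x) * (1 - s)) \<le> D * s" by (simp add: algebra_simps)
    then have "W1 * (x * (1 - x) * (1 - s)) \<le> s"
      using D by (simp add: W1_def pos_divide_le_eq mult.commute)
    moreover have "s * (x\<^sup>2 - s ^ (d - 1) * (s + x - 1)) = x * (1 - x) * (1 - s)"
      using sx by (simp add: algebra_simps power2_eq_square)
    ultimately have "s * (W1 * (x\<^sup>2 - s ^ (d - 1) * (s + x - 1))) \<le> s * 1" by (metis mult.left_commute mult_1_right)
    then have "W1 * (x\<^sup>2 - s ^ (d - 1) * (s + x - 1)) \<le> 1" using s by simp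
    then show ?thesis using sum2 by (simp add: algebra_simps)
  qed
  \<comment> \<open>The rounding is such that \<open>q \<le> x\<close> and \<open>v \<le> s\<close>;
    both converge from below.\<close>
  define a where "a K = nat \<lceil>(1 - x) * real K\<rceil>" for K
  define m where "m K = nat \<lfloor>s * real K\<rfloor>" for K
  define q where "q K = real (K - a K) / K" for K
  define v where "v K = real (m K) / K" for K
  define e where "e K = real n ^ 2 / real K" for K
  have aK: "a K \<le> K" for K
    using x0 x by (simp add: a_def nat_le_iff ceiling_le_iff mult_left_le_one_le)
  have mK: "m K \<le> K" for K
  proof -
    have "\<lfloor>s * real K\<rfloor> \<le> \<lfloor>real K\<rfloor>" using s by (intro floor_mono) (simp add: mult_left_le_one_le)
    then show ?thesis by (simp add: m_def nat_le_iff)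
  qed
  have inv0: "(\<lambda>K. 1 / real K) \<longlonglongrightarrow> 0" by (rule lim_1_over_n)
  have e0: "e \<longlonglongrightarrow> 0" unfolding e_def[abs_def] using tendsto_mult_right[OF inv0, of "real n ^ 2"] by simp
  have qlim: "q \<longlonglongrightarrow> x"
  proof (rule tendsto_sandwich[of "\<lambda>K. x - 1 / real K" _ _ "\<lambda>_. x"])
    have "x - 1 / K \<le> q K \<and> q K \<le> x" if K: "0 < K" for K
    proof -
      have "0 \<le> (1 - x) * K" using x by simp
      then have "(1 - x) * K \<le> a K" "a K \<le> (1 - x) * K + 1" unfolding a_def by linarith+
      then have "x * K - 1 \<le> K - a K" "real K - a K \<le> x * K" by (simp_all add: algebra_simps)
      moreover have "real (K - a K) = real K - a K" using aK[of K] by simp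
      ultimately have "(x * K - 1) / K \<le> q K" "q K \<le> (x * K) / K"
        unfolding q_def by (intro divide_right_mono; simp)+
      then show ?thesis using K by (simp add: diff_divide_distrib)
    qed
    then show "\<forall>\<^sub>F K in sequentially. x - 1 / K \<le> q K" "\<forall>\<^sub>F K in sequentially. q K \<le> x"
      by (auto intro!: eventually_sequentiallyI[of 1])
    show "(\<lambda>K. x - 1 / real K) \<longlonglongrightarrow> x" using tendsto_diff[OF tendsto_const inv0, of x] by simp
  qed simp
  have vlim: "v \<longlonglongrightarrow> s"
  proof (rule tendsto_sandwich[of "\<lambda>K. s - 1 / real K" _ _ "\<lambda>_. s"])
    have "s - 1 / K \<le> v K \<and> v K \<le> s" if K: "0 < K" for K
    proof -
      have "0 \<le> s * K" using s by simp
      then have "s * K - 1 \<le> m K" "m K \<le> s * K" unfolding m_def by linarith+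
      then have "(s * K - 1) / K \<le> v K" "v K \<le> (s * K) / K"
        unfolding v_def by (intro divide_right_mono; simp)+
      then show ?thesis using K by (simp add: diff_divide_distrib)
    qed
    then show "\<forall>\<^sub>F K in sequentially. s - 1 / K \<le> v K" "\<forall>\<^sub>F K in sequentially. v K \<le> s"
      by (auto intro!: eventually_sequentiallyI[of 1])
    show "(\<lambda>K. s - 1 / real K) \<longlonglongrightarrow> s" using tendsto_diff[OF tendsto_const inv0, of s] by simp
  qed simp
  have vd: "(\<lambda>K. v K ^ d) \<longlonglongrightarrow> x" using tendsto_power[OF vlim, of d] s by simp
  have Rlim: "(\<lambda>K. Rfun d (q K) (v K ^ d)) \<longlonglongrightarrow> rfun d x"
    using tendsto_Rfun[OF _ qlim vd, of d] Rfun_diag[OF d1 x(1)] x d by simp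
  define b1 where "b1 K = W1 * (q K - e K) + W2 * (1 - e K)" for K
  define b2 where "b2 K = W1 * (v K ^ d - e K) + W2 * (1 - e K)" for K
  define b3 where "b3 K = W1 * (v K ^ (d - 1) * (v K + q K - 1) - e K) + W2 * (1 - e K)" for K
  define b4 where "b4 K = (W1 * ((q K)\<^sup>2 - e K) + W2 * (1 - e K)) / 2" for K
  define b5 where "b5 K = (W1 * (v K ^ (2 * d) - e K) + W2 * (1 - e K)) / 2" for K
  define b6 where "b6 K = W1 * (Rfun d (q K) (v K ^ d) - 1 / K - e K) + W2 * (Rfun d 1 1 - 1 / K - e K)" for K
  define b7 where "b7 K = W1 * (q K * v K ^ d - e K - Rfun d (q K) (v K ^ d)) + W2 * (1 - e K - Rfun d 1 1)" for K
  \<comment> \<open>The weakest of the seven demands. Its limit is at least \<open>1\<close>, so in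
    the limit dividing by it does not increase the load.\<close>
  define \<rho> where "\<rho> K = min (b1 K) (min (b2 K) (min (b3 K) (min (b4 K) (min (b5 K) (min (b6 K) (b7 K))))))" for K
  have below: "\<rho> K \<le> b1 K" "\<rho> K \<le> b2 K" "\<rho> K \<le> b3 K" "\<rho> K \<le> b4 K" "\<rho> K \<le> b5 K" "\<rho> K \<le> b6 K" "\<rho> K \<le> b7 K" for K
    unfolding \<rho>_def by linarith+
  have "b1 \<longlonglongrightarrow> W1 * (x - 0) + W2 * (1 - 0)" unfolding b1_def[abs_def] by (intro tendsto_intros qlim e0)
  moreover have "b2 \<longlonglongrightarrow> W1 * (x - 0) + W2 * (1 - 0)" unfolding b2_def[abs_def] by (intro tendsto_intros vd e0)
  moreover have "b3 \<longlonglongrightarrow> W1 * (s ^ (d - 1) * (s + x - 1) - 0) + W2 * (1 - 0)"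
    unfolding b3_def[abs_def] by (intro tendsto_intros qlim vlim e0)
  moreover have "b4 \<longlonglongrightarrow> (W1 * (x\<^sup>2 - 0) + W2 * (1 - 0)) / 2"
    unfolding b4_def[abs_def] by (intro tendsto_intros qlim e0) auto
  moreover have "(\<lambda>K. v K ^ (2 * d)) \<longlonglongrightarrow> x\<^sup>2"
    using tendsto_power[OF vd, of 2] by (simp add: power_mult[symmetric] mult.commute)
  then have "b5 \<longlonglongrightarrow> (W1 * (x\<^sup>2 - 0) + W2 * (1 - 0)) / 2"
    unfolding b5_def[abs_def] by (intro tendsto_intros e0) auto
  moreover have "b6 \<longlonglongrightarrow> W1 * (rfun d x - 0 - 0) + W2 * (Rfun d 1 1 - 0 - 0)"
    unfolding b6_def[abs_def] by (intro tendsto_intros Rlim inv0 e0)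
  moreover have "b7 \<longlonglongrightarrow> W1 * (x * x - 0 - rfun d x) + W2 * (1 - 0 - Rfun d 1 1)"
    unfolding b7_def[abs_def] by (intro tendsto_intros Rlim qlim vd e0)
  ultimately have "\<rho> \<longlonglongrightarrow> min (W1 * (x - 0) + W2 * (1 - 0)) (min (W1 * (x - 0) + W2 * (1 - 0))
      (min (W1 * (s ^ (d - 1) * (s + x - 1) - 0) + W2 * (1 - 0)) (min ((W1 * (x\<^sup>2 - 0) + W2 * (1 - 0)) / 2)
      (min ((W1 * (x\<^sup>2 - 0) + W2 * (1 - 0)) / 2) (min (W1 * (rfun d x - 0 - 0) + W2 * (Rfun d 1 1 - 0 - 0))
      (W1 * (x * x - 0 - rfun d x) + W2 * (1 - 0 - Rfun d 1 1)))))))" (is "_ \<longlonglongrightarrow> ?L")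
    unfolding \<rho>_def[abs_def] by (intro tendsto_min)
  moreover have "1 \<le> ?L"
  proof -
    have "W1 * x\<^sup>2 \<le> W1 * x" using W1 x x0 by (intro mult_left_mono) (auto simp: power2_eq_square mult_left_le)
    then have "1 \<le> W1 * x + W2" using sum2 by linarith
    \<comment> \<open>Joint presence totals \<open>2\<close>; the reversed pairs take exactly
      \<open>1\<close> of it and leave \<open>1\<close> for the other order.\<close>
    moreover have "W1 * (x * x - rfun d x) + W2 * (1 - Rfun d 1 1) = 1"
      using up sum2 by (simp add: R11 algebra_simps power2_eq_square)
    ultimately show ?thesis using comp sum2 up by (simp add: R11)
  qed
  ultimately obtain L where L: "\<rho> \<longlonglongrightarrow> L" "1 \<le> L" by blast
  define Cs where "Cs K = max (W1 * q K + W2) (W1 * v K ^ d + W2)" for K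
  have Cs: "Cs \<longlonglongrightarrow> max C C"
    unfolding Cs_def[abs_def] C_def by (intro tendsto_intros qlim vd)
  have lim: "(\<lambda>K. Cs K / \<rho> K) \<longlonglongrightarrow> C / L" using tendsto_divide[OF Cs L(1)] L by simp
  have "\<forall>\<^sub>F K in sequentially. 0 < \<rho> K" using order_tendstoD(1)[OF L(1), of 0] L by simp
  then have "\<forall>\<^sub>F K in sequentially. fldim (subset_poset d n) \<le> Cs K / \<rho> K"
    using eventually_gt_at_top[of 0]
  proof eventually_elim
    case (elim K)
    show ?case
      by (rule fldim_le_two_families[OF d elim(2) aK mK q_def v_def W1(1) W2 elim(1) e_def
            below[unfolded b1_def b2_def b3_def b4_def b5_def b6_def b7_def]]) (simp_all add: Cs_def)
  qed
  then have "fldim (subset_poset d n) \<le> C / L"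
    using tendsto_lowerbound[OF lim] by simp
  also have "\<dots> \<le> C"
  proof -
    have "0 \<le> C" using W1 W2 x0 by (simp add: C_def)
    then show ?thesis using L(2) by (simp add: divide_le_eq mult_left_le mult_le_cancel_left1)
  qed
  also have "C = 2 + W1 * (x - x\<^sup>2)" by (simp add: C_def W2_def algebra_simps)
  also have "\<dots> = 2 + (real d - 1) * (x - x\<^sup>2) / D" by (simp add: W1_def)
  finally show ?thesis unfolding D_def .
qed

section \<open>The limit\<close>

text \<open>The first equation for \<open>c\<close> is the dual value, the second the load of the
  mixture.\<close>

lemma fldim_tendsto:
  assumes d: "2 \<le> d" and x: "beta d \<le> x" "x < 1" and r: "x\<^sup>2 / 2 \<le> rfun d x"
    and nonneg: "0 \<le> \<kappa>" "0 \<le> G"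
    and eq: "\<kappa> * rfun d x + G * x\<^sup>2 = x" and crit: "\<kappa> * rfun' d x + 2 * G * x = 1"
    and corner: "\<kappa> / (real d + 1) + G \<le> 1"
    and c: "\<kappa> + 2 * G = c" "c = 2 + (real d - 1) * (x - x\<^sup>2) / ((real d + 1) * rfun d x - x\<^sup>2)"
  shows "(\<lambda>n. fldim (subset_poset d n)) \<longlonglongrightarrow> c"
proof (rule tendsto_sandwich[of "\<lambda>n. c * (1 - d / real n)" _ _ "\<lambda>_. c"])
  obtain \<delta> \<epsilon> \<mu> :: real where *: "0 \<le> \<delta>" "0 \<le> \<epsilon>" "\<delta> + \<epsilon> = G" "0 \<le> \<mu>" "\<mu> \<le> 1"
    "\<And>q y. 0 \<le> q \<Longrightarrow> q \<le> 1 \<Longrightarrow> 0 \<le> y \<Longrightarrow> y \<le> 1 \<Longrightarrow>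
       \<kappa> * Rfun d q y + \<delta> * q\<^sup>2 + \<epsilon> * y\<^sup>2 \<le> \<mu> * q + (1 - \<mu>) * y"
    using dual_inequality[OF d x nonneg eq crit corner] by blast
  have cc: "c = \<kappa> + 2 * \<delta> + 2 * \<epsilon>" using c(1) *(3) by simp
  show "\<forall>\<^sub>F n in sequentially. c * (1 - d / real n) \<le> fldim (subset_poset d n)"
    using eventually_ge_at_top[of d]
    by eventually_elim (unfold cc, rule fldim_lower_bound[OF d _ nonneg(1) *(1,2,4,5,6)])
  show "\<forall>\<^sub>F n in sequentially. fldim (subset_poset d n) \<le> c"
    using eventually_ge_at_top[of d]
    by eventually_elim (unfold c(2), rule fldim_upper_bound[OF d _ x r])
  have "(\<lambda>n. c * (1 - real d * (1 / real n))) \<longlonglongrightarrow> c * (1 - real d * 0)"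
    by (intro tendsto_intros lim_1_over_n)
  then show "(\<lambda>n. c * (1 - d / real n)) \<longlonglongrightarrow> c" by simp
qed simp

theorem theorem2p2:
  fixes d :: nat
  assumes "2 \<le> d"
  shows "convergent (\<lambda>n. fldim (subset_poset d n)) \<and>
         (d \<le> 3 \<longrightarrow> FLD d = c_bal d) \<and>
         (4 \<le> d \<longrightarrow> FLD d = c_bst d)"
proof (cases "4 \<le> d")
  case True
  note b = x_bst[OF True]
  obtain \<kappa> G where *: "0 \<le> \<kappa>" "0 \<le> G" "\<kappa> * rfun d (x_bst d) + G * (x_bst d)\<^sup>2 = x_bst d"
    "\<kappa> * rfun' d (x_bst d) + 2 * G * x_bst d = 1" "\<kappa> / (real d + 1) + G \<le> 1" "\<kappa> + 2 * G = c_bst d"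
    using multipliers_bst[OF True refl] by blast
  have "(\<lambda>n. fldim (subset_poset d n)) \<longlonglongrightarrow> c_bst d"
    using b(4) by (intro fldim_tendsto[OF assms b(1,2) _ *]) (simp_all add: hfun_def c_bst_def)
  then show ?thesis using True by (auto simp: FLD_def convergent_def intro: limI)
next
  case False
  define x where "x = x_bal d"
  have d: "d = 2 \<or> d = 3" using assms False by auto
  note b = x_bal[OF assms, folded x_def]
  have x0: "0 < x" using beta(1)[of d] assms b by linarith
  have "rfun' d x \<le> x / 2"
    "x * (1 - x / 2 - x / (real d + 1) - (real d - 1) * x\<^sup>2 / 2) \<le> (1 - x) ^ (d + 1) * (1 + (real d - 1) * x)"
    using d multipliers_2[of x] multipliers_3[of x] x_def by blast+
  then obtain \<kappa> G where *: "0 \<le> \<kappa>" "0 \<le> G" "\<kappa> * rfun d x + G * x\<^sup>2 = x"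
    "\<kappa> * rfun' d x + 2 * G * x = 1" "\<kappa> / (real d + 1) + G \<le> 1" "\<kappa> + 2 * G = c_bal d"
    using multipliers_bal[OF assms x_def] by blast
  \<comment> \<open>At \<open>x_bal\<close> the second family has weight \<open>0\<close>, and both
    expressions equal \<open>2 / x\<close>.\<close>
  have c: "c_bal d = 2 + (real d - 1) * (x - x\<^sup>2) / ((real d + 1) * rfun d x - x\<^sup>2)"
  proof -
    have ne: "real d - 1 \<noteq> 0" using assms by simp
    have D: "(real d + 1) * rfun d x - x\<^sup>2 = (real d - 1) * (x\<^sup>2 / 2)" by (simp add: b(3) algebra_simps)
    have "c_bal d = 2 / x" using x0 by (simp add: c_bal_def b(3) power2_eq_square flip: x_def)
    also have "\<dots> = 2 + (x - x\<^sup>2) / (x\<^sup>2 / 2)" using x0 by (simp add: field_simps power2_eq_square)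
    finally show ?thesis unfolding D mult_divide_mult_cancel_left[OF ne] .
  qed
  have "(\<lambda>n. fldim (subset_poset d n)) \<longlonglongrightarrow> c_bal d"
    by (rule fldim_tendsto[OF assms b(1,2) _ * c]) (simp add: b(3))
  then show ?thesis using False by (auto simp: FLD_def convergent_def intro: limI)
qed

end
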